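(* Assume that $\downarrow$-loveliness is first-order. Let $\langle M,P(M)\rangle$ be a lovely pair and let $\bar a\subset M$ be P-independent. Then $\mathrm{acl}^2(\bar a)\cap M^{\mathrm{eq}}=\mathrm{acl}^1(\bar a)\cap M^{\mathrm{eq}}$ and $\mathrm{dcl}^2(\bar a)\cap M^{\mathrm{eq}}=\mathrm{dcl}^1(\bar a)\cap M^{\mathrm{eq}}$. Here $\mathrm{acl}^1,\mathrm{dcl}^1$ denote algebraic and definable closure for imaginary elements in $M^{\mathrm{eq}}$ ($M$ as an $\mathcal L$-structure), and $\mathrm{acl}^2,\mathrm{dcl}^2$ denote algebraic and definable closure for imaginary elements in $\langle M,P(M)\rangle^{\mathrm{eq}}$.
   Context: $T$ is a complete first-order theory in a language $\mathcal L$ and $\mathfrak C$ is a monster model of $T$; "small" means of cardinality smaller than the monstrosity of $\mathfrak C$ (its degree of saturation and strong homogeneity); tuples have small length. Juxtaposition denotes union, and tuples are identified with their sets of entries. An independence relation on $\mathfrak C$ is a ternary relation $A\downarrow_C B$ on small subsets of $\mathfrak C$ such that for all small $A,B,C,D$: (Invariance) $A\downarrow_B C\Rightarrow\sigma(A)\downarrow_{\sigma(B)}\sigma(C)$ for $\sigma\in\mathrm{Aut}(\mathfrak C)$; (Normality) $A\downarrow_C B\Rightarrow AC\downarrow_C B$; (Symmetry) $A\downarrow_B C\Rightarrow C\downarrow_B A$; (Transitivity) if $B\subseteq C\subseteq D$, then $A\downarrow_B D$ iff $A\downarrow_B C$ and $A\downarrow_C D$; (Finite character) $A\downarrow_B C$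 iff $A_0\downarrow_B C$ for all finite $A_0\subseteq A$; (Extension) there is $A'\equiv_B A$ with $A'\downarrow_B C$; (Local character) there is a small cardinal $\lambda$ depending only on $\downarrow$ such that for all small $A,C$ there is $C_0\subseteq C$ with $|C_0|<\lambda+|A|^+$ and $A\downarrow_{C_0}C$. For arbitrary $A,B,C\subseteq\mathfrak C$, $A\downarrow_B C$ means: for all small $A'\subseteq A$, $B'\subseteq B$, $C'\subseteq C$ there is a small $B''$ with $B'\subseteq B''\subseteq B$ and $A'\downarrow_{B''}C'$. Fix an independence relation $\downarrow$ on $\mathfrak C$. $\kappa_0$ is the least regular cardinal $\mu$ such that for every finite tuple $\bar a$ and small set $B$ there is $B_0\subseteq B$ with $|B_0|<\mu$ and $\bar a\downarrow_{B_0}B$. $\mathcal L^2=\mathcal L\cup\{P\}$ with $P$ a new unary predicate; $T^2$ is the theory of all expansions of $T$ to $\mathcal L^2$. A superscript 1 (resp. 2) on a model-theoretic notion refers to $\mathcal L$ (resp. $\mathcal L^2$). Models of $T$ are elementary substructures of $\mathfrak C$; a model of $T^2$ is written $M_P=\langle M,P(M)\rangle$, and $P(A)=P(M)\cap A$ for $A\subseteq M$. For a complete type $q$ over $A\supseteq B$, $q\downarrow_B A$ means $c\downarrow_B A$ for a realization $c$ of $q$ in $\mathfrak C$. Fix a small cardinal $\kappa>\max(\kappa_0,|T|)$; a set or tuple is very small if its cardinality is $<\kappa$. $M_P\models T^2$ is a ($\downarrow$-)lovely pair if: (1) $M$ is a small model of $T$; (2) (Density property) for every very small $A\subset M$ and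 $q\in S^1_1(A)$ with $q\downarrow_{P(A)}A$, $q$ is realized in $P(M)$; (3) (Extension property) for every very small $A\subset M$ and $q\in S^1_1(A)$ there is $b\in M$ realizing $q$ with $b\downarrow_A P(M)$. $T^d$ is the $\mathcal L^2$-theory of $\downarrow$-lovely pairs. "Loveliness is first-order" means that every sufficiently saturated model of $T^d$ is a lovely pair. A set (or tuple) $A\subseteq M$ is P-independent if $A\downarrow_{P(A)}P(M)$. *)

theory Defs
  imports Main
begin

unbundle cardinal_syntax

section \<open>Many-sorted first-order logic\<close>

text \<open>
  The base language is one-sorted (sort type \<^typ>\<open>unit\<close>); sorts are needed for
  \<open>M\<^sup>e\<^sup>q\<close>. A variable is a pair of a sort and an index.
\<close>

type_synonym 's var = "'s \<times> nat"

datatype ('s, 'f) tm = Var "'s var" | Fn 'f "('s, 'f) tm list"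

datatype ('s, 'f, 'r) fm =
    Eq "('s, 'f) tm" "('s, 'f) tm"
  | Rel 'r "('s, 'f) tm list"
  | Neg "('s, 'f, 'r) fm"
  | Conj "('s, 'f, 'r) fm" "('s, 'f, 'r) fm"
  | Ex "'s var" "('s, 'f, 'r) fm"

record ('s, 'f, 'r) lang =
  Sorts :: "'s set"
  Funs :: "'f set"
  fdom :: "'f \<Rightarrow> 's list"
  fcod :: "'f \<Rightarrow> 's"
  Rels :: "'r set"
  rdom :: "'r \<Rightarrow> 's list"

primrec sort_of :: "('s, 'f, 'r) lang \<Rightarrow> ('s, 'f) tm \<Rightarrow> 's" where
  "sort_of L (Var x) = fst x"
| "sort_of L (Fn f ts) = fcod L f"

primrec wf_tm :: "('s, 'f, 'r) lang \<Rightarrow> ('s, 'f) tm \<Rightarrow> bool" where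
  "wf_tm L (Var x) \<longleftrightarrow> fst x \<in> Sorts L"
| "wf_tm L (Fn f ts) \<longleftrightarrow>
     f \<in> Funs L \<and> list_all (wf_tm L) ts \<and> map (sort_of L) ts = fdom L f"

primrec wf_fm :: "('s, 'f, 'r) lang \<Rightarrow> ('s, 'f, 'r) fm \<Rightarrow> bool" where
  "wf_fm L (Eq t u) \<longleftrightarrow> wf_tm L t \<and> wf_tm L u \<and> sort_of L t = sort_of L u"
| "wf_fm L (Rel r ts) \<longleftrightarrow>
     r \<in> Rels L \<and> list_all (wf_tm L) ts \<and> map (sort_of L) ts = rdom L r"
| "wf_fm L (Neg \<phi>) \<longleftrightarrow> wf_fm L \<phi>"
| "wf_fm L (Conj \<phi> \<psi>) \<longleftrightarrow> wf_fm L \<phi> \<and> wf_fm L \<psi>"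
| "wf_fm L (Ex x \<phi>) \<longleftrightarrow> fst x \<in> Sorts L \<and> wf_fm L \<phi>"

primrec tm_vars :: "('s, 'f) tm \<Rightarrow> 's var set" where
  "tm_vars (Var x) = {x}"
| "tm_vars (Fn f ts) = \<Union> (set (map tm_vars ts))"

primrec fv :: "('s, 'f, 'r) fm \<Rightarrow> 's var set" where
  "fv (Eq t u) = tm_vars t \<union> tm_vars u"
| "fv (Rel r ts) = \<Union> (set (map tm_vars ts))"
| "fv (Neg \<phi>) = fv \<phi>"
| "fv (Conj \<phi> \<psi>) = fv \<phi> \<union> fv \<psi>"
| "fv (Ex x \<phi>) = fv \<phi> - {x}"

definition sentences :: "('s, 'f, 'r) lang \<Rightarrow> ('s, 'f, 'r) fm set" where
  "sentences L = {\<phi>. wf_fm L \<phi> \<and> fv \<phi> = {}}"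

record ('s, 'f, 'r, 'a) struc =
  Dom :: "'s \<Rightarrow> 'a set"
  Fint :: "'f \<Rightarrow> 'a list \<Rightarrow> 'a"
  Rint :: "'r \<Rightarrow> 'a list \<Rightarrow> bool"

definition is_struc :: "('s, 'f, 'r) lang \<Rightarrow> ('s, 'f, 'r, 'a) struc \<Rightarrow> bool" where
  "is_struc L M \<longleftrightarrow>
     (\<forall>s\<in>Sorts L. Dom M s \<noteq> {}) \<and>
     (\<forall>f\<in>Funs L. \<forall>xs. list_all2 (\<lambda>x s. x \<in> Dom M s) xs (fdom L f) \<longrightarrow>
        Fint M f xs \<in> Dom M (fcod L f))"

primrec eval :: "('s, 'f, 'r, 'a) struc \<Rightarrow> ('s var \<Rightarrow> 'a) \<Rightarrow> ('s, 'f) tm \<Rightarrow> 'a" where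
  "eval M v (Var x) = v x"
| "eval M v (Fn f ts) = Fint M f (map (eval M v) ts)"

primrec sat :: "('s, 'f, 'r, 'a) struc \<Rightarrow> ('s var \<Rightarrow> 'a) \<Rightarrow> ('s, 'f, 'r) fm \<Rightarrow> bool" where
  "sat M v (Eq t u) \<longleftrightarrow> eval M v t = eval M v u"
| "sat M v (Rel r ts) \<longleftrightarrow> Rint M r (map (eval M v) ts)"
| "sat M v (Neg \<phi>) \<longleftrightarrow> \<not> sat M v \<phi>"
| "sat M v (Conj \<phi> \<psi>) \<longleftrightarrow> sat M v \<phi> \<and> sat M v \<psi>"
| "sat M v (Ex x \<phi>) \<longleftrightarrow> (\<exists>b\<in>Dom M (fst x). sat M (v(x := b)) \<phi>)"

definition models :: "('s, 'f, 'r, 'a) struc \<Rightarrow> ('s, 'f, 'r) fm set \<Rightarrow> bool" where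
  "models M T \<longleftrightarrow> (\<forall>\<phi>\<in>T. \<forall>v. sat M v \<phi>)"

text \<open>
  Complete theories are taken to be deductively closed; consistency will follow from
  the existence of a model.
\<close>

definition complete_theory :: "('s, 'f, 'r) lang \<Rightarrow> ('s, 'f, 'r) fm set \<Rightarrow> bool" where
  "complete_theory L T \<longleftrightarrow>
     T \<subseteq> sentences L \<and> (\<forall>\<phi>\<in>sentences L. \<phi> \<in> T \<or> Neg \<phi> \<in> T)"


section \<open>Types, saturation, algebraic and definable closure\<close>

text \<open>
  A formula over \<open>A\<close> in one free variable of sort \<open>s\<close> is a pair \<open>(\<phi>, v)\<close>: the free
  variable is \<open>(s, 0)\<close>, and \<open>v\<close> interprets the other free variables of \<open>\<phi>\<close> by
  parameters from \<open>A\<close>.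
\<close>

definition param_fms ::
  "('s, 'f, 'r) lang \<Rightarrow> ('s, 'f, 'r, 'a) struc \<Rightarrow> 's \<Rightarrow> 'a set \<Rightarrow>
   (('s, 'f, 'r) fm \<times> ('s var \<Rightarrow> 'a)) set" where
  "param_fms L M s A =
     {(\<phi>, v). wf_fm L \<phi> \<and> (\<forall>x\<in>fv \<phi> - {(s, 0)}. v x \<in> A \<inter> Dom M (fst x))}"

definition solves ::
  "('s, 'f, 'r, 'a) struc \<Rightarrow> 's \<Rightarrow> 'a \<Rightarrow> ('s, 'f, 'r) fm \<times> ('s var \<Rightarrow> 'a) \<Rightarrow> bool" where
  "solves M s b \<phi>v \<longleftrightarrow> b \<in> Dom M s \<and> sat M ((snd \<phi>v)((s, 0) := b)) (fst \<phi>v)"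

definition realizes ::
  "('s, 'f, 'r, 'a) struc \<Rightarrow> 's \<Rightarrow> 'a \<Rightarrow>
   (('s, 'f, 'r) fm \<times> ('s var \<Rightarrow> 'a)) set \<Rightarrow> bool" where
  "realizes M s b q \<longleftrightarrow> b \<in> Dom M s \<and> (\<forall>\<phi>v\<in>q. solves M s b \<phi>v)"

definition complete_types ::
  "('s, 'f, 'r) lang \<Rightarrow> ('s, 'f, 'r, 'a) struc \<Rightarrow> 's \<Rightarrow> 'a set \<Rightarrow>
   (('s, 'f, 'r) fm \<times> ('s var \<Rightarrow> 'a)) set set" where
  "complete_types L M s A =
     {q. q \<subseteq> param_fms L M s A \<and>
         (\<forall>q0 \<subseteq> q. finite q0 \<longrightarrow> (\<exists>b. realizes M s b q0)) \<and>
         (\<forall>(\<phi>, v)\<in>param_fms L M s A. (\<phi>, v) \<in> q \<or> (Neg \<phi>, v) \<in> q)}"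

definition saturated ::
  "('s, 'f, 'r) lang \<Rightarrow> ('s, 'f, 'r, 'a) struc \<Rightarrow> 'k rel \<Rightarrow> bool" where
  "saturated L M \<mu> \<longleftrightarrow>
     (\<forall>s\<in>Sorts L. \<forall>A \<subseteq> (\<Union>s'\<in>Sorts L. Dom M s'). |A| <o \<mu> \<longrightarrow>
        (\<forall>q\<in>complete_types L M s A. \<exists>b. realizes M s b q))"

definition acl :: "('s, 'f, 'r) lang \<Rightarrow> ('s, 'f, 'r, 'a) struc \<Rightarrow> 'a set \<Rightarrow> 'a set" where
  "acl L M A = {e. \<exists>s\<in>Sorts L. \<exists>\<phi>v\<in>param_fms L M s A.
     solves M s e \<phi>v \<and> finite {b. solves M s b \<phi>v}}"

definition dcl :: "('s, 'f, 'r) lang \<Rightarrow> ('s, 'f, 'r, 'a) struc \<Rightarrow> 'a set \<Rightarrow> 'a set" where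
  "dcl L M A = {e. \<exists>s\<in>Sorts L. \<exists>\<phi>v\<in>param_fms L M s A.
     {b. solves M s b \<phi>v} = {e}}"


section \<open>One-sorted structures\<close>

definition one_sorted :: "(unit, 'f, 'r) lang \<Rightarrow> bool" where
  "one_sorted L \<longleftrightarrow> Sorts L = {()}"

abbreviation Univ :: "(unit, 'f, 'r, 'a) struc \<Rightarrow> 'a set" where
  "Univ M \<equiv> Dom M ()"

definition restr :: "(unit, 'f, 'r, 'a) struc \<Rightarrow> 'a set \<Rightarrow> (unit, 'f, 'r, 'a) struc" where
  "restr C M = C\<lparr>Dom := \<lambda>_. M\<rparr>"

definition elementary_substructure ::
  "(unit, 'f, 'r) lang \<Rightarrow> 'a set \<Rightarrow> (unit, 'f, 'r, 'a) struc \<Rightarrow> bool" where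
  "elementary_substructure L M C \<longleftrightarrow>
     M \<subseteq> Univ C \<and> is_struc L (restr C M) \<and>
     (\<forall>\<phi> v. wf_fm L \<phi> \<longrightarrow> (\<forall>x\<in>fv \<phi>. v x \<in> M) \<longrightarrow> (sat (restr C M) v \<phi> \<longleftrightarrow> sat C v \<phi>))"

definition elementary_map ::
  "(unit, 'f, 'r) lang \<Rightarrow> (unit, 'f, 'r, 'a) struc \<Rightarrow> 'a set \<Rightarrow> ('a \<Rightarrow> 'a) \<Rightarrow> bool" where
  "elementary_map L C A f \<longleftrightarrow>
     A \<subseteq> Univ C \<and> f ` A \<subseteq> Univ C \<and>
     (\<forall>\<phi> v. wf_fm L \<phi> \<longrightarrow> (\<forall>x\<in>fv \<phi>. v x \<in> A) \<longrightarrow> (sat C v \<phi> \<longleftrightarrow> sat C (f \<circ> v) \<phi>))"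

text \<open>\<open>A' \<equiv>\<^sub>B A\<close>, for sets identified with tuples enumerating them.\<close>

definition equiv_over ::
  "(unit, 'f, 'r) lang \<Rightarrow> (unit, 'f, 'r, 'a) struc \<Rightarrow> 'a set \<Rightarrow> 'a set \<Rightarrow> 'a set \<Rightarrow> bool" where
  "equiv_over L C B A' A \<longleftrightarrow>
     (\<exists>f. elementary_map L C (A \<union> B) f \<and> (\<forall>b\<in>B. f b = b) \<and> f ` A = A')"

definition automorphism ::
  "(unit, 'f, 'r) lang \<Rightarrow> (unit, 'f, 'r, 'a) struc \<Rightarrow> ('a \<Rightarrow> 'a) \<Rightarrow> bool" where
  "automorphism L C \<sigma> \<longleftrightarrow>
     bij_betw \<sigma> (Univ C) (Univ C) \<and>
     (\<forall>f\<in>Funs L. \<forall>xs. set xs \<subseteq> Univ C \<longrightarrow> length xs = length (fdom L f) \<longrightarrow>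
        \<sigma> (Fint C f xs) = Fint C f (map \<sigma> xs)) \<and>
     (\<forall>r\<in>Rels L. \<forall>xs. set xs \<subseteq> Univ C \<longrightarrow> length xs = length (rdom L r) \<longrightarrow>
        (Rint C r xs \<longleftrightarrow> Rint C r (map \<sigma> xs)))"

definition strongly_homogeneous ::
  "(unit, 'f, 'r) lang \<Rightarrow> (unit, 'f, 'r, 'a) struc \<Rightarrow> 'k rel \<Rightarrow> bool" where
  "strongly_homogeneous L C \<mu> \<longleftrightarrow>
     (\<forall>A f. |A| <o \<mu> \<longrightarrow> elementary_map L C A f \<longrightarrow>
        (\<exists>\<sigma>. automorphism L C \<sigma> \<and> (\<forall>a\<in>A. \<sigma> a = f a)))"

text \<open>\<open>\<mu>\<close> is the monstrosity of \<open>C\<close>.\<close>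

definition monster_model ::
  "(unit, 'f, 'r) lang \<Rightarrow> (unit, 'f, 'r) fm set \<Rightarrow> (unit, 'f, 'r, 'a) struc \<Rightarrow>
   'k rel \<Rightarrow> bool" where
  "monster_model L T C \<mu> \<longleftrightarrow>
     is_struc L C \<and> models C T \<and> Cinfinite \<mu> \<and>
     saturated L C \<mu> \<and> strongly_homogeneous L C \<mu>"

definition small ::
  "(unit, 'f, 'r, 'a) struc \<Rightarrow> 'k rel \<Rightarrow> 'a set \<Rightarrow> bool" where
  "small C \<mu> A \<longleftrightarrow> A \<subseteq> Univ C \<and> |A| <o \<mu>"


section \<open>Independence relations\<close>

text \<open>
  \<open>ind A B D\<close> stands for \<open>A \<down>\<^sub>B D\<close>: the base is the middle argument. Cardinals below
  the monstrosity \<open>\<mu> :: 'k rel\<close> are, up to isomorphism, cardinals on the type \<open>'k\<close>,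
  so quantifying over \<open>'k rel\<close> covers all small cardinals.
\<close>

definition independence_relation ::
  "(unit, 'f, 'r) lang \<Rightarrow> (unit, 'f, 'r, 'a) struc \<Rightarrow> 'k rel \<Rightarrow>
   ('a set \<Rightarrow> 'a set \<Rightarrow> 'a set \<Rightarrow> bool) \<Rightarrow> bool" where
  "independence_relation L C \<mu> ind \<longleftrightarrow>
     \<comment> \<open>invariance\<close>
     (\<forall>\<sigma> A B D. automorphism L C \<sigma> \<longrightarrow> small C \<mu> A \<longrightarrow> small C \<mu> B \<longrightarrow> small C \<mu> D \<longrightarrow>
        ind A B D \<longrightarrow> ind (\<sigma> ` A) (\<sigma> ` B) (\<sigma> ` D)) \<and>
     \<comment> \<open>normality\<close>
     (\<forall>A B D. small C \<mu> A \<longrightarrow> small C \<mu> B \<longrightarrow> small C \<mu> D \<longrightarrow>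
        ind A D B \<longrightarrow> ind (A \<union> D) D B) \<and>
     \<comment> \<open>symmetry\<close>
     (\<forall>A B D. small C \<mu> A \<longrightarrow> small C \<mu> B \<longrightarrow> small C \<mu> D \<longrightarrow>
        ind A B D \<longrightarrow> ind D B A) \<and>
     \<comment> \<open>transitivity\<close>
     (\<forall>A B D E. small C \<mu> A \<longrightarrow> small C \<mu> B \<longrightarrow> small C \<mu> D \<longrightarrow> small C \<mu> E \<longrightarrow>
        B \<subseteq> D \<longrightarrow> D \<subseteq> E \<longrightarrow> (ind A B E \<longleftrightarrow> ind A B D \<and> ind A D E)) \<and>
     \<comment> \<open>finite character\<close>
     (\<forall>A B D. small C \<mu> A \<longrightarrow> small C \<mu> B \<longrightarrow> small C \<mu> D \<longrightarrow>
        (ind A B D \<longleftrightarrow> (\<forall>A0 \<subseteq> A. finite A0 \<longrightarrow> ind A0 B D))) \<and>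
     \<comment> \<open>extension\<close>
     (\<forall>A B D. small C \<mu> A \<longrightarrow> small C \<mu> B \<longrightarrow> small C \<mu> D \<longrightarrow>
        (\<exists>A'. equiv_over L C B A' A \<and> ind A' B D)) \<and>
     \<comment> \<open>local character\<close>
     (\<exists>lam :: 'k rel. Card_order lam \<and> lam <o \<mu> \<and>
        (\<forall>A D. small C \<mu> A \<longrightarrow> small C \<mu> D \<longrightarrow>
           (\<exists>D0 \<subseteq> D. |D0| <o lam +c cardSuc |A| \<and> ind A D0 D)))"

definition finitary_local_character ::
  "(unit, 'f, 'r, 'a) struc \<Rightarrow> 'k rel \<Rightarrow> ('a set \<Rightarrow> 'a set \<Rightarrow> 'a set \<Rightarrow> bool) \<Rightarrow>
   'k rel \<Rightarrow> bool" where
  "finitary_local_character C \<mu> ind c \<longleftrightarrow>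
     (\<forall>A B. A \<subseteq> Univ C \<longrightarrow> finite A \<longrightarrow> small C \<mu> B \<longrightarrow>
        (\<exists>B0 \<subseteq> B. |B0| <o c \<and> ind A B0 B))"

text \<open>Regular cardinals are infinite by convention.\<close>

definition is_kappa0 ::
  "(unit, 'f, 'r, 'a) struc \<Rightarrow> 'k rel \<Rightarrow> ('a set \<Rightarrow> 'a set \<Rightarrow> 'a set \<Rightarrow> bool) \<Rightarrow>
   'k rel \<Rightarrow> bool" where
  "is_kappa0 C \<mu> ind c \<longleftrightarrow>
     Cinfinite c \<and> regularCard c \<and> finitary_local_character C \<mu> ind c \<and>
     (\<forall>c' :: 'k rel. Cinfinite c' \<and> regularCard c' \<and> finitary_local_character C \<mu> ind c'
        \<longrightarrow> c \<le>o c')"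


section \<open>Lovely pairs\<close>

text \<open>\<open>L\<^sup>2\<close>: the new unary predicate \<open>P\<close> is \<^const>\<open>None\<close>.\<close>

definition lang2 :: "(unit, 'f, 'r) lang \<Rightarrow> (unit, 'f, 'r option) lang" where
  "lang2 L = \<lparr>Sorts = Sorts L, Funs = Funs L, fdom = fdom L, fcod = fcod L,
     Rels = insert None (Some ` Rels L),
     rdom = (\<lambda>r. case r of None \<Rightarrow> [()] | Some r' \<Rightarrow> rdom L r')\<rparr>"

text \<open>The structure \<open>\<langle>M, P\<rangle>\<close>, for \<open>M\<close> a substructure of \<open>C\<close> and \<open>P \<subseteq> M\<close>.\<close>

definition pair ::
  "(unit, 'f, 'r, 'a) struc \<Rightarrow> 'a set \<Rightarrow> 'a set \<Rightarrow> (unit, 'f, 'r option, 'a) struc" where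
  "pair C M P = \<lparr>Dom = (\<lambda>_. M), Fint = Fint C,
     Rint = (\<lambda>r xs. case r of None \<Rightarrow> (\<exists>p\<in>P. xs = [p]) | Some r' \<Rightarrow> Rint C r' xs)\<rparr>"

text \<open>
  \<open>M\<close> being small, \<open>P\<close> is small as well, so that \<open>b \<down>\<^sub>A P\<close> below is an instance of the
  relation on small sets.
\<close>

definition lovely_pair ::
  "(unit, 'f, 'r) lang \<Rightarrow> (unit, 'f, 'r, 'a) struc \<Rightarrow> 'k rel \<Rightarrow>
   ('a set \<Rightarrow> 'a set \<Rightarrow> 'a set \<Rightarrow> bool) \<Rightarrow> 'k rel \<Rightarrow> 'a set \<Rightarrow> 'a set \<Rightarrow> bool" where
  "lovely_pair L C \<mu> ind \<kappa> M P \<longleftrightarrow>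
     small C \<mu> M \<and> elementary_substructure L M C \<and> P \<subseteq> M \<and>
     \<comment> \<open>density property\<close>
     (\<forall>A \<subseteq> M. |A| <o \<kappa> \<longrightarrow> (\<forall>q\<in>complete_types L C () A.
        (\<exists>c. realizes C () c q \<and> ind {c} (P \<inter> A) A) \<longrightarrow> (\<exists>b\<in>P. realizes C () b q))) \<and>
     \<comment> \<open>extension property\<close>
     (\<forall>A \<subseteq> M. |A| <o \<kappa> \<longrightarrow> (\<forall>q\<in>complete_types L C () A.
        \<exists>b\<in>M. realizes C () b q \<and> ind {b} A P))"

definition lovely_theory ::
  "(unit, 'f, 'r) lang \<Rightarrow> (unit, 'f, 'r, 'a) struc \<Rightarrow> 'k rel \<Rightarrow>
   ('a set \<Rightarrow> 'a set \<Rightarrow> 'a set \<Rightarrow> bool) \<Rightarrow> 'k rel \<Rightarrow> (unit, 'f, 'r option) fm set" where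
  "lovely_theory L C \<mu> ind \<kappa> =
     {\<phi> \<in> sentences (lang2 L).
        \<forall>M P. lovely_pair L C \<mu> ind \<kappa> M P \<longrightarrow> models (pair C M P) {\<phi>}}"

definition loveliness_first_order ::
  "(unit, 'f, 'r) lang \<Rightarrow> (unit, 'f, 'r, 'a) struc \<Rightarrow> 'k rel \<Rightarrow>
   ('a set \<Rightarrow> 'a set \<Rightarrow> 'a set \<Rightarrow> bool) \<Rightarrow> 'k rel \<Rightarrow> bool" where
  "loveliness_first_order L C \<mu> ind \<kappa> \<longleftrightarrow>
     (\<exists>\<nu> :: 'k rel. Cinfinite \<nu> \<and> \<nu> <o \<mu> \<and>
        (\<forall>M P. small C \<mu> M \<longrightarrow> elementary_substructure L M C \<longrightarrow> P \<subseteq> M \<longrightarrow>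
           models (pair C M P) (lovely_theory L C \<mu> ind \<kappa>) \<longrightarrow>
           saturated (lang2 L) (pair C M P) \<nu> \<longrightarrow>
           lovely_pair L C \<mu> ind \<kappa> M P))"

definition P_independent ::
  "('a set \<Rightarrow> 'a set \<Rightarrow> 'a set \<Rightarrow> bool) \<Rightarrow> 'a set \<Rightarrow> 'a set \<Rightarrow> bool" where
  "P_independent ind P A \<longleftrightarrow> ind A (P \<inter> A) P"


section \<open>Imaginaries\<close>

text \<open>
  A sort of \<open>M\<^sup>e\<^sup>q\<close> is a pair \<open>(n, E)\<close> with \<open>E\<close> an equivalence relation on \<open>M\<^sup>n\<close> definable
  without parameters; its elements are the \<open>E\<close>-classes, tagged by \<open>(n, E)\<close> to make the
  sorts disjoint. The home sort is equality on \<open>M\<^sup>1\<close>. The language of \<open>M\<^sup>e\<^sup>q\<close> has the symbols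
  of \<open>L\<close> on the home sort and, for every sort, the projection from \<open>M\<^sup>n\<close> onto it.

  The universe and sorts of \<open>M\<^sup>e\<^sup>q\<close> for \<open>L\<close> are literally contained in those for \<open>L\<^sup>2\<close>, with
  the same home sort.
\<close>

type_synonym 'a eq_sort = "nat \<times> 'a list rel"
type_synonym 'a imag = "'a eq_sort \<times> 'a list set"

definition tuples :: "'a set \<Rightarrow> nat \<Rightarrow> 'a list set" where
  "tuples M n = {xs. length xs = n \<and> set xs \<subseteq> M}"

definition definable_equiv ::
  "(unit, 'f, 'r) lang \<Rightarrow> (unit, 'f, 'r, 'a) struc \<Rightarrow> nat \<Rightarrow> 'a list rel \<Rightarrow> bool" where
  "definable_equiv L M n E \<longleftrightarrow>
     equiv (tuples (Univ M) n) E \<and>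
     (\<exists>\<phi>. wf_fm L \<phi> \<and> fv \<phi> \<subseteq> UNIV \<times> {..<2 * n} \<and>
        E = {(xs, ys) \<in> tuples (Univ M) n \<times> tuples (Univ M) n.
               sat M (\<lambda>(_, i). (xs @ ys) ! i) \<phi>})"

definition home_sort :: "'a set \<Rightarrow> 'a eq_sort" where
  "home_sort M = (1, Id_on (tuples M 1))"

definition home :: "'a set \<Rightarrow> 'a \<Rightarrow> 'a imag" where
  "home M a = (home_sort M, {[a]})"

definition unhome :: "'a imag \<Rightarrow> 'a" where
  "unhome e = hd (the_elem (snd e))"

definition eq_sorts ::
  "(unit, 'f, 'r) lang \<Rightarrow> (unit, 'f, 'r, 'a) struc \<Rightarrow> 'a eq_sort set" where
  "eq_sorts L M = {(n, E). definable_equiv L M n E}"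

definition lang_eq ::
  "(unit, 'f, 'r) lang \<Rightarrow> (unit, 'f, 'r, 'a) struc \<Rightarrow>
   ('a eq_sort, 'f + 'a eq_sort, 'r) lang" where
  "lang_eq L M =
     (let h = home_sort (Univ M) in
      \<lparr>Sorts = eq_sorts L M,
       Funs = Inl ` Funs L \<union> Inr ` eq_sorts L M,
       fdom = case_sum (\<lambda>f. map (\<lambda>_. h) (fdom L f)) (\<lambda>(n, E). replicate n h),
       fcod = case_sum (\<lambda>_. h) (\<lambda>s. s),
       Rels = Rels L,
       rdom = (\<lambda>r. map (\<lambda>_. h) (rdom L r))\<rparr>)"

definition struc_eq ::
  "(unit, 'f, 'r, 'a) struc \<Rightarrow> ('a eq_sort, 'f + 'a eq_sort, 'r, 'a imag) struc" where
  "struc_eq M =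
     \<lparr>Dom = (\<lambda>(n, E). {(n, E)} \<times> (tuples (Univ M) n // E)),
      Fint = case_sum (\<lambda>f es. home (Univ M) (Fint M f (map unhome es)))
                      (\<lambda>(n, E) es. ((n, E), E `` {map unhome es})),
      Rint = (\<lambda>r es. Rint M r (map unhome es))\<rparr>"

definition univ_eq :: "(unit, 'f, 'r) lang \<Rightarrow> (unit, 'f, 'r, 'a) struc \<Rightarrow> 'a imag set" where
  "univ_eq L M = (\<Union>s\<in>eq_sorts L M. Dom (struc_eq M) s)"

definition acl_eq ::
  "(unit, 'f, 'r) lang \<Rightarrow> (unit, 'f, 'r, 'a) struc \<Rightarrow> 'a set \<Rightarrow> 'a imag set" where
  "acl_eq L M A = acl (lang_eq L M) (struc_eq M) (home (Univ M) ` A)"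

definition dcl_eq ::
  "(unit, 'f, 'r) lang \<Rightarrow> (unit, 'f, 'r, 'a) struc \<Rightarrow> 'a set \<Rightarrow> 'a imag set" where
  "dcl_eq L M A = dcl (lang_eq L M) (struc_eq M) (home (Univ M) ` A)"

end

theory Submission
  imports Defs
begin

text \<open>
  The inclusions of the \<open>L\<close>-closures in the \<open>L\<^sup>2\<close>-closures hold because \<open>\<langle>M, P\<rangle>\<close> expands \<open>M\<close> and every \<open>L\<close>-definable
  equivalence relation is \<open>L\<^sup>2\<close>-definable. For the others, let \<open>F\<close> be a finite set of imaginaries in
  \<open>M\<^sup>e\<^sup>q\<close>, of one sort, that is definable in the pair with parameters in the P-independent set \<open>A\<close>.
  The parameters lie in a very small P-independent \<open>B \<subseteq> A\<close>. If \<open>c\<close> is a tuple of \<open>M\<close> whose class \<open>e\<close>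
  is in \<open>F\<close>, then the conjugates of \<open>c\<close> over \<open>B\<close> in \<open>C\<close> have at most \<open>card F\<close> classes
  (\<open>at_most_classes_conjugates\<close>). By compactness some \<open>L\<close>-formula over \<open>B\<close> satisfied by \<open>c\<close> has
  solutions in at most \<open>card F\<close> classes (\<open>at_most_classes_definable\<close>), so that \<open>e\<close> is algebraic over
  \<open>B\<close> in \<open>M\<^sup>e\<^sup>q\<close>, and definable if \<open>F = {e}\<close>.

  The structure of the pair is used through a back-and-forth argument: \<open>L\<close>-elementary
  bijections between very small P-independent subsets of \<open>M\<close> that respect \<open>P\<close> form a back-and-forth
  system (\<open>BF_forth\<close>), hence preserve all formulas of \<open>L\<^sup>2\<close>, also about imaginaries (\<open>BF_sat_eq\<close>),
  and in particular \<open>F\<close> if they fix \<open>B\<close>. A point there is that an element of \<open>M\<close> independent from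
  \<open>P\<close> over a very small P-independent set \<open>B\<close> is in \<open>P\<close> iff it is independent from itself over \<open>P \<inter> B\<close>, which is a
  property of its type over \<open>B\<close> (\<open>mem_P_transfer\<close>).

  The number of classes is bounded as follows.

  \<^item> If \<open>B' \<supseteq> B\<close> is very small and P-independent and \<open>c\<close> is independent from \<open>P\<close> over \<open>B'\<close>, then
    finitely many inequivalent conjugates of \<open>c\<close> over \<open>B'\<close> can be moved into \<open>M\<close> and made
    independent from \<open>P\<close> over \<open>B'\<close>; they then correspond to \<open>c\<close> in the back-and-forth system, so that
    their classes are distinct members of \<open>F\<close> (\<open>at_most_classes_free\<close>).

  \<^item> By local character there is a very small \<open>D \<subseteq> P\<close> such that the preceding item applies, with
    \<open>B' = B \<union> D\<close>, to representatives of all members of \<open>F\<close>. Suppose that \<open>c\<close> has too many inequivalent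
    conjugates over \<open>B\<close>. By the extension axiom they may be taken jointly independent from \<open>D\<close> over
    \<open>B\<close>. For each such conjugate \<open>z\<close>, density yields a \<open>D'\<close> in \<open>P\<close> standing to \<open>c\<close> as \<open>D\<close> stands to
    \<open>z\<close>, and as \<open>D'\<close> corresponds to \<open>D\<close> over \<open>B\<close> in the back-and-forth system, \<open>z\<close> is conjugate over
    \<open>B \<union> D\<close> to a representative of a member of \<open>F\<close> (\<open>conjugate_over_P\<close>). This bounds the number of
    the \<open>z\<close> (\<open>at_most_classes_exists\<close>).

  \<^item> As there is a bound, a maximal inequivalent family of conjugates of \<open>c\<close> over \<open>B\<close>, moved into \<open>M\<close>
    independently from \<open>P\<close> over \<open>B\<close>, contains a tuple equivalent to \<open>c\<close> (\<open>free_representative\<close>). So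
    \<open>e\<close> has a representative to which the first item applies with \<open>B' = B\<close>.
\<close>

section \<open>Formulas: relevant variables and substitution\<close>

lemma finite_tm_vars: "finite (tm_vars t)"
  by (induction t) auto

lemma finite_fv: "finite (fv \<phi>)"
  by (induction \<phi>) (auto simp: finite_tm_vars)

lemma eval_cong: "(\<And>x. x \<in> tm_vars t \<Longrightarrow> v x = w x) \<Longrightarrow> eval M v t = eval M w t"
proof (induction t)
  case (Fn f ts)
  have "map (eval M v) ts = map (eval M w) ts"
    by (intro map_cong refl Fn.IH) (use Fn.prems in force)+
  then show ?case by (simp only: eval.simps)
qed simp

lemma sat_cong: "(\<And>x. x \<in> fv \<phi> \<Longrightarrow> v x = w x) \<Longrightarrow> sat M v \<phi> = sat M w \<phi>"
proof (induction \<phi> arbitrary: v w)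
  case (Eq t u)
  have "eval M v t = eval M w t" "eval M v u = eval M w u"
    by (rule eval_cong; use Eq in simp)+
  then show ?case by simp
next
  case (Rel r ts)
  then have "map (eval M v) ts = map (eval M w) ts"
    by (intro map_cong refl eval_cong) force
  then show ?case by (simp only: sat.simps)
next
  case (Ex x \<phi>)
  have "sat M (v(x := b)) \<phi> = sat M (w(x := b)) \<phi>" for b
    by (rule Ex.IH) (use Ex.prems in auto)
  then show ?case by simp
next
  case (Neg \<phi>)
  have "sat M v \<phi> = sat M w \<phi>" by (rule Neg.IH) (use Neg.prems in simp)
  then show ?case by simp
next
  case (Conj \<phi> \<psi>)
  have "sat M v \<phi> = sat M w \<phi>" by (rule Conj.IH(1)) (use Conj.prems in simp)
  moreover have "sat M v \<psi> = sat M w \<psi>" by (rule Conj.IH(2)) (use Conj.prems in simp)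
  ultimately show ?case by simp
qed

lemma eval_in_Dom:
  assumes "is_struc L M"
  shows "wf_tm L t \<Longrightarrow> (\<And>x. x \<in> tm_vars t \<Longrightarrow> v x \<in> Dom M (fst x)) \<Longrightarrow>
    eval M v t \<in> Dom M (sort_of L t)"
proof (induction t)
  case (Fn f ts)
  have "list_all2 (\<lambda>x s. x \<in> Dom M s) (map (eval M v) ts) (map (sort_of L) ts)"
    unfolding list_all2_map1 list_all2_map2 list_all2_same
  proof
    fix t assume "t \<in> set ts"
    then show "eval M v t \<in> Dom M (sort_of L t)"
      using Fn.prems by (intro Fn.IH) (force simp: list_all_iff)+
  qed
  then show ?case
    using Fn.prems(1) assms by (simp add: is_struc_def del: map_map)
qed simp

text \<open>Simultaneous substitution of variables for variables in a term.\<close>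

primrec rename_tm :: "('s var \<Rightarrow> 's var) \<Rightarrow> ('s, 'f) tm \<Rightarrow> ('s, 'f) tm" where
  "rename_tm \<rho> (Var x) = Var (\<rho> x)"
| "rename_tm \<rho> (Fn f ts) = Fn f (map (rename_tm \<rho>) ts)"

lemma eval_rename_tm: "eval M v (rename_tm \<rho> t) = eval M (v \<circ> \<rho>) t"
proof (induction t)
  case (Fn f ts)
  have "map (\<lambda>t. eval M v (rename_tm \<rho> t)) ts = map (eval M (v \<circ> \<rho>)) ts"
    by (intro map_cong refl Fn.IH)
  then show ?case by (simp del: map_eq_conv add: comp_def)
qed simp

lemma tm_vars_rename_tm: "tm_vars (rename_tm \<rho> t) = \<rho> ` tm_vars t"
  by (induction t) auto

lemma sort_of_rename_tm: "(\<And>x. fst (\<rho> x) = fst x) \<Longrightarrow> sort_of L (rename_tm \<rho> t) = sort_of L t"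
  by (cases t) auto

lemma wf_tm_rename_tm:
  assumes "\<And>x. fst (\<rho> x) = fst x"
  shows "wf_tm L t \<Longrightarrow> wf_tm L (rename_tm \<rho> t)"
proof (induction t)
  case (Fn f ts)
  have "map (sort_of L \<circ> rename_tm \<rho>) ts = map (sort_of L) ts"
    using sort_of_rename_tm[OF assms] by auto
  then show ?case using Fn by (simp add: list_all_iff del: map_eq_conv)
qed (use assms in simp)

text \<open>
  Variables of a formula may be replaced by other variables, and some of them identified. A bound
  variable is renamed away from the image of \<open>\<rho>\<close>. Only the meaning and the free variables of the
  resulting formula matter, so that no substitution function on formulas is defined.
\<close>

lemma ex_substitution:
  fixes \<phi> :: "('s, 'f, 'r) fm"
  assumes "wf_fm L \<phi>" "\<And>x. fst (\<rho> x) = fst x"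
  shows "\<exists>\<phi>'. wf_fm L \<phi>' \<and> fv \<phi>' \<subseteq> \<rho> ` fv \<phi> \<and>
    (\<forall>(M :: ('s, 'f, 'r, 'a) struc) v. sat M v \<phi>' \<longleftrightarrow> sat M (v \<circ> \<rho>) \<phi>)"
  using assms
proof (induction \<phi> arbitrary: \<rho>)
  case (Eq t u)
  show ?case
    by (rule exI[of _ "Eq (rename_tm \<rho> t) (rename_tm \<rho> u)"])
      (use Eq in \<open>simp add: eval_rename_tm tm_vars_rename_tm sort_of_rename_tm wf_tm_rename_tm image_Un comp_def\<close>)
next
  case (Rel r ts)
  have 1: "map (sort_of L \<circ> rename_tm \<rho>) ts = map (sort_of L) ts"
    using sort_of_rename_tm[OF Rel.prems(2)] by auto
  have 2: "map (eval M v \<circ> rename_tm \<rho>) ts = map (eval M (v \<circ> \<rho>)) ts"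
    for M :: "('s, 'f, 'r, 'a) struc" and v
    by (simp add: eval_rename_tm)
  show ?case
    by (rule exI[of _ "Rel r (map (rename_tm \<rho>) ts)"])
      (use Rel 1 2 in \<open>simp add: comp_def del: map_eq_conv add: tm_vars_rename_tm list_all_iff wf_tm_rename_tm image_UN\<close>)
next
  case (Neg \<phi>)
  obtain \<phi>' where "wf_fm L \<phi>'" "fv \<phi>' \<subseteq> \<rho> ` fv \<phi>"
    "\<forall>(M :: ('s, 'f, 'r, 'a) struc) v. sat M v \<phi>' \<longleftrightarrow> sat M (v \<circ> \<rho>) \<phi>"
    using Neg.IH[OF _ Neg.prems(2)] Neg.prems(1) unfolding wf_fm.simps by blast
  then show ?case by (intro exI[of _ "Neg \<phi>'"]) (simp add: comp_def)
next
  case (Conj \<phi> \<psi>)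
  obtain \<phi>' where "wf_fm L \<phi>'" "fv \<phi>' \<subseteq> \<rho> ` fv \<phi>"
    "\<forall>(M :: ('s, 'f, 'r, 'a) struc) v. sat M v \<phi>' \<longleftrightarrow> sat M (v \<circ> \<rho>) \<phi>"
    using Conj.IH(1)[OF _ Conj.prems(2)] Conj.prems(1) unfolding wf_fm.simps by blast
  moreover obtain \<psi>' where "wf_fm L \<psi>'" "fv \<psi>' \<subseteq> \<rho> ` fv \<psi>"
    "\<forall>(M :: ('s, 'f, 'r, 'a) struc) v. sat M v \<psi>' \<longleftrightarrow> sat M (v \<circ> \<rho>) \<psi>"
    using Conj.IH(2)[OF _ Conj.prems(2)] Conj.prems(1) unfolding wf_fm.simps by blast
  ultimately show ?case using Conj.prems(1)
    by (intro exI[of _ "Conj \<phi>' \<psi>'"]) (simp add: comp_def image_Un le_supI1 le_supI2)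
next
  case (Ex x \<phi>)
  have "finite (snd ` \<rho> ` fv \<phi>)" by (simp add: finite_fv)
  then obtain k where k: "k \<notin> snd ` \<rho> ` fv \<phi>" using ex_new_if_finite infinite_UNIV_nat by blast
  define z where "z = (fst x, k)"
  have z: "z \<notin> \<rho> ` fv \<phi>" using k by (metis image_eqI snd_conv z_def)
  have sorts: "fst ((\<rho>(x := z)) y) = fst y" for y using Ex.prems by (simp add: z_def)
  obtain \<phi>' where \<phi>': "wf_fm L \<phi>'" "fv \<phi>' \<subseteq> (\<rho>(x := z)) ` fv \<phi>"
    "\<forall>(M :: ('s, 'f, 'r, 'a) struc) v. sat M v \<phi>' \<longleftrightarrow> sat M (v \<circ> \<rho>(x := z)) \<phi>"
    using Ex.IH[OF _ sorts] Ex.prems(1) unfolding wf_fm.simps by blast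
  have step: "sat M (v(z := b)) \<phi>' \<longleftrightarrow> sat M ((v \<circ> \<rho>)(x := b)) \<phi>"
    for M :: "('s, 'f, 'r, 'a) struc" and v b
  proof -
    have "sat M (v(z := b) \<circ> \<rho>(x := z)) \<phi> \<longleftrightarrow> sat M ((v \<circ> \<rho>)(x := b)) \<phi>"
      by (rule sat_cong) (use z in auto)
    then show ?thesis using \<phi>'(3) by blast
  qed
  have "fv (Ex z \<phi>') \<subseteq> \<rho> ` fv (Ex x \<phi>)" using \<phi>'(2) by auto
  moreover have "wf_fm L (Ex z \<phi>')" using Ex.prems(1) \<phi>'(1) by (simp add: z_def)
  moreover have "sat M v (Ex z \<phi>') \<longleftrightarrow> sat M (v \<circ> \<rho>) (Ex x \<phi>)"
    for M :: "('s, 'f, 'r, 'a) struc" and v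
    unfolding sat.simps step by (simp add: z_def)
  ultimately show ?case by blast
qed


section \<open>Definable predicates of finite tuples\<close>

text \<open>
  In a one-sorted structure, \<^term>\<open>val k g v\<close> gives the first \<open>k\<close> variables their values by \<open>g\<close> and
  the remaining ones, the parameters, by \<open>v\<close>.
\<close>

definition val :: "nat \<Rightarrow> (nat \<Rightarrow> 'a) \<Rightarrow> (unit var \<Rightarrow> 'a) \<Rightarrow> unit var \<Rightarrow> 'a" where
  "val k g v x = (if snd x < k then g (snd x) else v x)"

text \<open>
  A \<open>k\<close>-ary predicate definable over \<open>B\<close>. Its argument is a sequence of which only the first
  \<open>k\<close> entries matter; nothing is said about sequences whose first \<open>k\<close> entries are not all in \<open>C\<close>.
\<close>

definition definable ::
  "(unit, 'f, 'r) lang \<Rightarrow> (unit, 'f, 'r, 'a) struc \<Rightarrow> 'a set \<Rightarrow> nat \<Rightarrow>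
   ((nat \<Rightarrow> 'a) \<Rightarrow> bool) \<Rightarrow> bool" where
  "definable L C B k D \<longleftrightarrow>
     (\<exists>\<phi> v. wf_fm L \<phi> \<and> (\<forall>x\<in>fv \<phi>. k \<le> snd x \<longrightarrow> v x \<in> B) \<and>
        (\<forall>g. (\<forall>i<k. g i \<in> Univ C) \<longrightarrow> (D g \<longleftrightarrow> sat C (val k g v) \<phi>)))"

lemma definableE:
  assumes "definable L C B k D"
  obtains \<phi> v where "wf_fm L \<phi>" "\<forall>x\<in>fv \<phi>. k \<le> snd x \<longrightarrow> v x \<in> B"
    "\<forall>g. (\<forall>i<k. g i \<in> Univ C) \<longrightarrow> (D g \<longleftrightarrow> sat C (val k g v) \<phi>)"
  using assms unfolding definable_def by blast

lemma definable_mono: "definable L C B k D \<Longrightarrow> B \<subseteq> B' \<Longrightarrow> definable L C B' k D"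
  unfolding definable_def by blast

lemma definable_cong:
  assumes "definable L C B k D" "\<And>g. (\<And>i. i < k \<Longrightarrow> g i \<in> Univ C) \<Longrightarrow> D' g \<longleftrightarrow> D g"
  shows "definable L C B k D'"
proof -
  obtain \<phi> v where "wf_fm L \<phi>" "\<forall>x\<in>fv \<phi>. k \<le> snd x \<longrightarrow> v x \<in> B"
    "\<forall>g. (\<forall>i<k. g i \<in> Univ C) \<longrightarrow> (D g \<longleftrightarrow> sat C (val k g v) \<phi>)"
    by (rule definableE[OF assms(1)])
  then show ?thesis using assms(2) unfolding definable_def
    by (intro exI[of _ \<phi>] exI[of _ v]) simp
qed

lemma definable_agree:
  assumes "definable L C B k D" "\<And>i. i < k \<Longrightarrow> g i = h i" "\<And>i. i < k \<Longrightarrow> g i \<in> Univ C"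
  shows "D g \<longleftrightarrow> D h"
proof -
  obtain \<phi> v where "\<forall>g. (\<forall>i<k. g i \<in> Univ C) \<longrightarrow> (D g \<longleftrightarrow> sat C (val k g v) \<phi>)"
    by (rule definableE[OF assms(1)])
  moreover have "val k g v = val k h v" using assms(2) by (auto simp: val_def fun_eq_iff)
  moreover have "\<forall>i<k. h i \<in> Univ C" using assms(2,3) by metis
  ultimately show ?thesis using assms(3) by metis
qed

lemma definable_Not: "definable L C B k D \<Longrightarrow> definable L C B k (\<lambda>g. \<not> D g)"
proof (elim definableE)
  fix \<phi> v assume "wf_fm L \<phi>" "\<forall>x\<in>fv \<phi>. k \<le> snd x \<longrightarrow> v x \<in> B"
    "\<forall>g. (\<forall>i<k. g i \<in> Univ C) \<longrightarrow> (D g \<longleftrightarrow> sat C (val k g v) \<phi>)"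
  then show ?thesis unfolding definable_def
    by (intro exI[of _ "Neg \<phi>"] exI[of _ v]) simp
qed

text \<open>The parameters of \<open>\<phi>\<close> are moved to even places and those of \<open>\<psi>\<close> to odd places.\<close>

lemma definable_conj:
  fixes C :: "(unit, 'f, 'r, 'a) struc"
  assumes "definable L C B k D" "definable L C B k D'"
  shows "definable L C B k (\<lambda>g. D g \<and> D' g)"
proof -
  obtain \<phi> v where \<phi>0: "wf_fm L \<phi>"
    "\<forall>x\<in>fv \<phi>. k \<le> snd x \<longrightarrow> v x \<in> B"
    "\<forall>g. (\<forall>i<k. g i \<in> Univ C) \<longrightarrow> (D g \<longleftrightarrow> sat C (val k g v) \<phi>)"
    by (rule definableE[OF assms(1)])
  note \<phi> = \<phi>0(1) \<phi>0(2,3)[rule_format]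
  obtain \<psi> w where \<psi>0: "wf_fm L \<psi>"
    "\<forall>x\<in>fv \<psi>. k \<le> snd x \<longrightarrow> w x \<in> B"
    "\<forall>g. (\<forall>i<k. g i \<in> Univ C) \<longrightarrow> (D' g \<longleftrightarrow> sat C (val k g w) \<psi>)"
    by (rule definableE[OF assms(2)])
  note \<psi> = \<psi>0(1) \<psi>0(2,3)[rule_format]
  define \<rho> where "\<rho> j x = ((), if snd x < k then snd x else 2 * snd x + j)" for j :: nat and x :: "unit var"
  obtain \<phi>' where \<phi>': "wf_fm L \<phi>'" "fv \<phi>' \<subseteq> \<rho> 0 ` fv \<phi>"
    "\<And>(M :: (unit, 'f, 'r, 'a) struc) v. sat M v \<phi>' \<longleftrightarrow> sat M (v \<circ> \<rho> 0) \<phi>"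
    using ex_substitution[OF \<phi>(1), where \<rho>="\<rho> 0"] by auto
  obtain \<psi>' where \<psi>': "wf_fm L \<psi>'" "fv \<psi>' \<subseteq> \<rho> 1 ` fv \<psi>"
    "\<And>(M :: (unit, 'f, 'r, 'a) struc) v. sat M v \<psi>' \<longleftrightarrow> sat M (v \<circ> \<rho> 1) \<psi>"
    using ex_substitution[OF \<psi>(1), where \<rho>="\<rho> 1"] by auto
  define u where "u x = (if even (snd x) then v ((), snd x div 2) else w ((), snd x div 2))"
    for x :: "unit var"
  have "val k g u \<circ> \<rho> 0 = val k g v" "val k g u \<circ> \<rho> 1 = val k g w" for g
    by (auto simp: val_def \<rho>_def u_def fun_eq_iff)
  then have "D g \<and> D' g \<longleftrightarrow> sat C (val k g u) (Conj \<phi>' \<psi>')" if "\<And>i. i < k \<Longrightarrow> g i \<in> Univ C" for g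
    using \<phi>(3)[OF that] \<psi>(3)[OF that] \<phi>'(3) \<psi>'(3) by simp
  moreover have "u x \<in> B" if x: "x \<in> fv (Conj \<phi>' \<psi>')" "k \<le> snd x" for x
  proof -
    consider y where "y \<in> fv \<phi>" "x = \<rho> 0 y" | y where "y \<in> fv \<psi>" "x = \<rho> 1 y"
      using x(1) \<phi>'(2) \<psi>'(2) by auto
    then show ?thesis
    proof cases
      case (1 y)
      then show ?thesis using \<phi>(2)[of y] x(2) by (cases y) (auto simp: u_def \<rho>_def split: if_splits)
    next
      case (2 y)
      then show ?thesis using \<psi>(2)[of y] x(2) by (cases y) (auto simp: u_def \<rho>_def split: if_splits)
    qed
  qed
  ultimately show ?thesis unfolding definable_def
    using \<phi>'(1) \<psi>'(1) by (intro exI[of _ "Conj \<phi>' \<psi>'"] exI[of _ u]) auto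
qed

lemma definable_substitute:
  fixes C :: "(unit, 'f, 'r, 'a) struc"
  assumes "definable L C B n D" "\<And>i. i < n \<Longrightarrow> \<rho> i < k"
  shows "definable L C B k (\<lambda>g. D (\<lambda>i. g (\<rho> i)))"
proof -
  obtain \<phi> v where \<phi>0: "wf_fm L \<phi>"
    "\<forall>x\<in>fv \<phi>. n \<le> snd x \<longrightarrow> v x \<in> B"
    "\<forall>g. (\<forall>i<n. g i \<in> Univ C) \<longrightarrow> (D g \<longleftrightarrow> sat C (val n g v) \<phi>)"
    by (rule definableE[OF assms(1)])
  note \<phi> = \<phi>0(1) \<phi>0(2,3)[rule_format]
  define \<sigma> where "\<sigma> x = ((), if snd x < n then \<rho> (snd x) else snd x - n + k)" for x :: "unit var"
  obtain \<phi>' where \<phi>': "wf_fm L \<phi>'" "fv \<phi>' \<subseteq> \<sigma> ` fv \<phi>"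
    "\<And>(M :: (unit, 'f, 'r, 'a) struc) v. sat M v \<phi>' \<longleftrightarrow> sat M (v \<circ> \<sigma>) \<phi>"
    using ex_substitution[OF \<phi>(1), where \<rho>=\<sigma>] by auto
  define u where "u x = v ((), snd x - k + n)" for x :: "unit var"
  have "val k g u \<circ> \<sigma> = val n (\<lambda>i. g (\<rho> i)) v" for g
    using assms(2) by (auto simp: val_def \<sigma>_def u_def fun_eq_iff)
  then have "D (\<lambda>i. g (\<rho> i)) \<longleftrightarrow> sat C (val k g u) \<phi>'" if "\<And>i. i < k \<Longrightarrow> g i \<in> Univ C" for g
    using \<phi>(3)[of "\<lambda>i. g (\<rho> i)"] that assms(2) \<phi>'(3) by simp
  moreover have "u x \<in> B" if x: "x \<in> fv \<phi>'" "k \<le> snd x" for x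
  proof -
    obtain y where y: "y \<in> fv \<phi>" "x = \<sigma> y" using \<phi>'(2) x(1) by blast
    then have "n \<le> snd y" using x(2) assms(2) by (auto simp: \<sigma>_def not_less[symmetric])
    then show ?thesis using \<phi>(2)[of y] y by (cases y) (auto simp: u_def \<sigma>_def)
  qed
  ultimately show ?thesis unfolding definable_def
    using \<phi>'(1) by (intro exI[of _ \<phi>'] exI[of _ u]) auto
qed

lemma definable_Ex:
  assumes "one_sorted L" "definable L C B (Suc k) D"
  shows "definable L C B k (\<lambda>g. \<exists>b\<in>Univ C. D (g(k := b)))"
proof -
  obtain \<phi> v where \<phi>0: "wf_fm L \<phi>"
    "\<forall>x\<in>fv \<phi>. Suc k \<le> snd x \<longrightarrow> v x \<in> B"
    "\<forall>g. (\<forall>i<Suc k. g i \<in> Univ C) \<longrightarrow> (D g \<longleftrightarrow> sat C (val (Suc k) g v) \<phi>)"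
    by (rule definableE[OF assms(2)])
  note \<phi> = \<phi>0(1) \<phi>0(2,3)[rule_format]
  have "(val k g v)(((), k) := b) = val (Suc k) (g(k := b)) v" for g b
    by (auto simp: val_def fun_eq_iff)
  then have "(\<exists>b\<in>Univ C. D (g(k := b))) \<longleftrightarrow> sat C (val k g v) (Ex ((), k) \<phi>)"
    if "\<And>i. i < k \<Longrightarrow> g i \<in> Univ C" for g
    using that by (auto simp: \<phi>(3) less_Suc_eq)
  moreover have "v x \<in> B" if "x \<in> fv \<phi> - {((), k)}" "k \<le> snd x" for x
    using that \<phi>(2)[of x] by (cases x) auto
  ultimately show ?thesis unfolding definable_def
    using \<phi>(1) assms(1) by (intro exI[of _ "Ex ((), k) \<phi>"] exI[of _ v]) (auto simp: one_sorted_def)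
qed

lemma definable_section:
  fixes C :: "(unit, 'f, 'r, 'a) struc"
  assumes "definable L C B (Suc k) D" "\<And>i. i < k \<Longrightarrow> g i \<in> Univ C"
  shows "definable L C (B \<union> g ` {..<k}) 1 (\<lambda>h. D (g(k := h 0)))"
proof -
  obtain \<phi> v where \<phi>0: "wf_fm L \<phi>"
    "\<forall>x\<in>fv \<phi>. Suc k \<le> snd x \<longrightarrow> v x \<in> B"
    "\<forall>g. (\<forall>i<Suc k. g i \<in> Univ C) \<longrightarrow> (D g \<longleftrightarrow> sat C (val (Suc k) g v) \<phi>)"
    by (rule definableE[OF assms(1)])
  note \<phi> = \<phi>0(1) \<phi>0(2,3)[rule_format]
  define \<sigma> where "\<sigma> x = ((), if snd x = k then 0 else Suc (snd x))" for x :: "unit var"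
  obtain \<phi>' where \<phi>': "wf_fm L \<phi>'" "fv \<phi>' \<subseteq> \<sigma> ` fv \<phi>"
    "\<And>(M :: (unit, 'f, 'r, 'a) struc) v. sat M v \<phi>' \<longleftrightarrow> sat M (v \<circ> \<sigma>) \<phi>"
    using ex_substitution[OF \<phi>(1), where \<rho>=\<sigma>] by auto
  define u where "u x = val k g v ((), snd x - 1)" for x :: "unit var"
  have *: "val 1 h u \<circ> \<sigma> = val (Suc k) (g(k := h 0)) v" for h
    by (auto simp: val_def \<sigma>_def u_def fun_eq_iff)
  have "D (g(k := h 0)) \<longleftrightarrow> sat C (val 1 h u) \<phi>'" if "\<And>i. i < 1 \<Longrightarrow> h i \<in> Univ C" for h
  proof -
    have "(g(k := h 0)) i \<in> Univ C" if "i < Suc k" for i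
      using that \<open>\<And>i. i < 1 \<Longrightarrow> h i \<in> Univ C\<close> assms(2) by (auto simp: less_Suc_eq)
    then show ?thesis using * \<phi>(3)[of "g(k := h 0)"] \<phi>'(3)[of C] by metis
  qed
  moreover have "u x \<in> B \<union> g ` {..<k}" if x: "x \<in> fv \<phi>'" "1 \<le> snd x" for x
  proof -
    obtain y where y: "y \<in> fv \<phi>" "x = \<sigma> y" using \<phi>'(2) x(1) by blast
    then show ?thesis using \<phi>(2)[of y] x(2) by (cases y) (auto simp: u_def \<sigma>_def val_def split: if_splits)
  qed
  ultimately show ?thesis unfolding definable_def
    using \<phi>'(1) by (intro exI[of _ \<phi>'] exI[of _ u]) auto
qed

lemma definable_finite_Ball:
  assumes "finite I" "\<And>i. i \<in> I \<Longrightarrow> definable L C B k (D i)" "definable L C B k D0"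
  shows "definable L C B k (\<lambda>g. D0 g \<and> (\<forall>i\<in>I. D i g))"
  using assms(1,2)
proof (induction I)
  case (insert i I)
  have "definable L C B k (\<lambda>g. (D0 g \<and> (\<forall>i\<in>I. D i g)) \<and> D i g)"
    by (rule definable_conj) (use insert in auto)
  then show ?case by (rule definable_cong) auto
qed (use assms in simp)


section \<open>Realizing types of finite tuples in a saturated structure\<close>

text \<open>A maximal finitely realizable set of formulas over \<open>A\<close> is complete.\<close>

lemma extend_to_complete_type:
  assumes q0: "q0 \<subseteq> param_fms L M s A"
    and fin: "\<And>q1. q1 \<subseteq> q0 \<Longrightarrow> finite q1 \<Longrightarrow> \<exists>b. realizes M s b q1"
  shows "\<exists>q\<in>complete_types L M s A. q0 \<subseteq> q"
proof -
  define Q where "Q = {q. q0 \<subseteq> q \<and> q \<subseteq> param_fms L M s A \<and>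
    (\<forall>q1\<subseteq>q. finite q1 \<longrightarrow> (\<exists>b. realizes M s b q1))}"
  have "\<exists>q\<in>Q. \<forall>X\<in>Q. q \<subseteq> X \<longrightarrow> X = q"
  proof (rule subset_Zorn_nonempty)
    have "q0 \<in> Q" unfolding Q_def using q0 fin by simp
    then show "Q \<noteq> {}" by blast
    fix K assume K: "K \<noteq> {}" "subset.chain Q K"
    then have KQ: "K \<subseteq> Q" by (simp add: subset_chain_def)
    have "\<exists>b. realizes M s b q1" if q1: "q1 \<subseteq> \<Union>K" "finite q1" for q1
    proof -
      obtain q where "q \<in> K" "q1 \<subseteq> q"
        by (rule finite_subset_Union_chain[OF q1(2,1) K])
      then show ?thesis using KQ q1(2) by (auto simp: Q_def)
    qed
    moreover have "q0 \<subseteq> \<Union>K" "\<Union>K \<subseteq> param_fms L M s A"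
      using KQ K(1) unfolding Q_def by blast+
    ultimately show "\<Union>K \<in> Q" by (simp add: Q_def)
  qed
  then obtain q where q: "q \<in> Q" and max: "\<And>X. X \<in> Q \<Longrightarrow> q \<subseteq> X \<Longrightarrow> X = q" by blast
  have *: "\<exists>q1\<subseteq>q. finite q1 \<and> (\<nexists>b. realizes M s b (insert \<phi>v q1))"
    if "\<phi>v \<in> param_fms L M s A" "\<phi>v \<notin> q" for \<phi>v
  proof (rule ccontr)
    assume neg: "\<not> ?thesis"
    have "\<exists>b. realizes M s b q1" if q1: "q1 \<subseteq> insert \<phi>v q" "finite q1" for q1
    proof -
      have "q1 - {\<phi>v} \<subseteq> q" "finite (q1 - {\<phi>v})" using q1 by auto
      then have "\<exists>b. realizes M s b (insert \<phi>v (q1 - {\<phi>v}))"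
        using neg by blast
      then show ?thesis by (auto simp: realizes_def)
    qed
    then have "insert \<phi>v q \<in> Q" using q that by (auto simp: Q_def)
    then show False using max[of "insert \<phi>v q"] that(2) by auto
  qed
  have "(\<phi>, v) \<in> q \<or> (Neg \<phi>, v) \<in> q" if \<phi>v: "(\<phi>, v) \<in> param_fms L M s A" for \<phi> v
  proof (rule ccontr)
    assume n: "\<not> ?thesis"
    have "(Neg \<phi>, v) \<in> param_fms L M s A" using that by (simp add: param_fms_def)
    then obtain q1 q2 where qs: "q1 \<subseteq> q" "finite q1" "\<nexists>b. realizes M s b (insert (\<phi>, v) q1)"
      "q2 \<subseteq> q" "finite q2" "\<nexists>b. realizes M s b (insert (Neg \<phi>, v) q2)"
      using *[OF \<phi>v] *[of "(Neg \<phi>, v)"] n by blast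
    have "q1 \<union> q2 \<subseteq> q" "finite (q1 \<union> q2)" using qs by auto
    moreover have "\<forall>q1\<subseteq>q. finite q1 \<longrightarrow> (\<exists>b. realizes M s b q1)"
      using q by (simp add: Q_def)
    ultimately obtain b where "realizes M s b (q1 \<union> q2)" by blast
    then show False using qs(3,6) by (auto simp: realizes_def solves_def)
  qed
  then have "q \<in> complete_types L M s A" using q by (auto simp: complete_types_def Q_def)
  then show ?thesis using q by (auto simp: Q_def)
qed

text \<open>Unary definable predicates are given by formulas in the sense of \<^const>\<open>param_fms\<close>.\<close>

lemma definable_param_fms:
  assumes "definable L C B 1 D" "B \<subseteq> Univ C"
  shows "\<exists>\<phi>v\<in>param_fms L C () B. \<forall>b\<in>Univ C. solves C () b \<phi>v \<longleftrightarrow> D (\<lambda>_. b)"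
proof -
  obtain \<phi> v where \<phi>0: "wf_fm L \<phi>"
    "\<forall>x\<in>fv \<phi>. 1 \<le> snd x \<longrightarrow> v x \<in> B"
    "\<forall>g. (\<forall>i<1. g i \<in> Univ C) \<longrightarrow> (D g \<longleftrightarrow> sat C (val 1 g v) \<phi>)"
    by (rule definableE[OF assms(1)])
  note \<phi> = \<phi>0(1) \<phi>0(2,3)[rule_format]
  have "v x \<in> B" if "x \<in> fv \<phi>" "x \<noteq> ((), 0)" for x
    using \<phi>(2)[of x] that by (cases x) auto
  then have "(\<phi>, v) \<in> param_fms L C () B"
    using \<phi>(1) assms(2) by (auto simp: param_fms_def)
  moreover have "v(((), 0) := b) = val 1 (\<lambda>_. b) v" for b
    by (auto simp: val_def fun_eq_iff)
  then have "solves C () b (\<phi>, v) \<longleftrightarrow> D (\<lambda>_. b)" if "b \<in> Univ C" for b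
    using \<phi>(3)[of "\<lambda>_. b"] that by (simp add: solves_def)
  ultimately show ?thesis by blast
qed

lemma saturated_directed_1:
  assumes "one_sorted L" "saturated L C \<mu>" "B \<subseteq> Univ C" "|B| <o \<mu>"
    and def: "\<And>D. D \<in> \<F> \<Longrightarrow> definable L C B 1 D"
    and sat: "\<And>D. D \<in> \<F> \<Longrightarrow> \<exists>b\<in>Univ C. D (\<lambda>_. b)"
    and "\<F> \<noteq> {}"
    and dir: "\<And>D D'. D \<in> \<F> \<Longrightarrow> D' \<in> \<F> \<Longrightarrow>
      \<exists>D''\<in>\<F>. \<forall>b\<in>Univ C. D'' (\<lambda>_. b) \<longrightarrow> D (\<lambda>_. b) \<and> D' (\<lambda>_. b)"
  shows "\<exists>b\<in>Univ C. \<forall>D\<in>\<F>. D (\<lambda>_. b)"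
proof -
  define q0 where "q0 = {\<phi>v \<in> param_fms L C () B. \<exists>D\<in>\<F>. \<forall>b\<in>Univ C. D (\<lambda>_. b) \<longrightarrow> solves C () b \<phi>v}"
  have *: "\<exists>D\<in>\<F>. \<forall>b\<in>Univ C. D (\<lambda>_. b) \<longrightarrow> (\<forall>\<phi>v\<in>q1. solves C () b \<phi>v)"
    if "finite q1" "q1 \<subseteq> q0" for q1
    using that
  proof (induction q1)
    case (insert \<phi>v q1)
    then obtain D where "D \<in> \<F>" "\<forall>b\<in>Univ C. D (\<lambda>_. b) \<longrightarrow> (\<forall>\<phi>v\<in>q1. solves C () b \<phi>v)" by auto
    moreover obtain D' where "D' \<in> \<F>" "\<forall>b\<in>Univ C. D' (\<lambda>_. b) \<longrightarrow> solves C () b \<phi>v"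
      using insert.prems by (auto simp: q0_def)
    ultimately show ?case using dir[of D D'] by (metis insert_iff)
  qed (use \<open>\<F> \<noteq> {}\<close> in auto)
  have "\<exists>b. realizes C () b q1" if "q1 \<subseteq> q0" "finite q1" for q1
    using *[OF that(2,1)] sat unfolding realizes_def by blast
  then obtain q where q: "q \<in> complete_types L C () B" "q0 \<subseteq> q"
    using extend_to_complete_type[of q0 L C "()" B] by (auto simp: q0_def)
  have "\<exists>b. realizes C () b q"
    using assms(1-4) q(1) unfolding saturated_def one_sorted_def by simp
  then obtain b where b: "realizes C () b q" ..
  have "D (\<lambda>_. b)" if D: "D \<in> \<F>" for D
  proof -
    obtain \<phi>v where "\<phi>v \<in> param_fms L C () B"
      "\<forall>b\<in>Univ C. solves C () b \<phi>v \<longleftrightarrow> D (\<lambda>_. b)"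
      using definable_param_fms[OF def[OF D] assms(3)] by auto
    moreover from this have "\<phi>v \<in> q" using q(2) D by (auto simp: q0_def)
    ultimately show ?thesis using b by (auto simp: realizes_def)
  qed
  then show ?thesis using b by (auto simp: realizes_def)
qed

text \<open>
  Compactness for \<open>k\<close>-tuples: a directed family of satisfiable predicates over a small set has a
  common solution. The first \<open>k\<close> entries are found from the projections of the family, and the
  last one from its sections.
\<close>

lemma saturated_directed:
  fixes C :: "(unit, 'f, 'r, 'a) struc" and \<mu> :: "'k rel"
  assumes "one_sorted L" "saturated L C \<mu>" "Cinfinite \<mu>" "B \<subseteq> Univ C" "|B| <o \<mu>"
  assumes "\<And>D. D \<in> \<F> \<Longrightarrow> definable L C B k D"
    and "\<And>D. D \<in> \<F> \<Longrightarrow> \<exists>g. (\<forall>i<k. g i \<in> Univ C) \<and> D g"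
    and "\<F> \<noteq> {}"
    and "\<And>D D'. D \<in> \<F> \<Longrightarrow> D' \<in> \<F> \<Longrightarrow>
      \<exists>D''\<in>\<F>. \<forall>g. (\<forall>i<k. g i \<in> Univ C) \<longrightarrow> D'' g \<longrightarrow> D g \<and> D' g"
  shows "\<exists>g. (\<forall>i<k. g i \<in> Univ C) \<and> (\<forall>D\<in>\<F>. D g)"
  using assms(6-)
proof (induction k arbitrary: \<F>)
  case 0
  have "D g" if D: "D \<in> \<F>" for D g
  proof -
    obtain h where "D h" using 0(2)[OF D] by auto
    then show ?thesis using definable_agree[OF 0(1)[OF D], of h g] by simp
  qed
  then show ?case by auto
next
  case (Suc k)
  define \<F>' where "\<F>' = (\<lambda>D g. \<exists>b\<in>Univ C. D (g(k := b))) ` \<F>"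
  have "\<exists>g. (\<forall>i<k. g i \<in> Univ C) \<and> (\<forall>D\<in>\<F>'. D g)"
  proof (rule Suc.IH)
    show "definable L C B k D'" if "D' \<in> \<F>'" for D'
      using that definable_Ex[OF assms(1) Suc.prems(1)] unfolding \<F>'_def by blast
    show "\<exists>g. (\<forall>i<k. g i \<in> Univ C) \<and> D' g" if D': "D' \<in> \<F>'" for D'
    proof -
      obtain D where D: "D \<in> \<F>" "D' = (\<lambda>g. \<exists>b\<in>Univ C. D (g(k := b)))"
        using D' by (auto simp: \<F>'_def)
      obtain g where "\<forall>i<Suc k. g i \<in> Univ C" "D g" using Suc.prems(2)[OF D(1)] by auto
      then show ?thesis using D(2) by (intro exI[of _ g]) (auto intro!: bexI[of _ "g k"])
    qed
    show "\<F>' \<noteq> {}" using Suc.prems(3) by (simp add: \<F>'_def)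
    show "\<exists>D''\<in>\<F>'. \<forall>g. (\<forall>i<k. g i \<in> Univ C) \<longrightarrow> D'' g \<longrightarrow> D g \<and> D' g"
      if DD: "D \<in> \<F>'" "D' \<in> \<F>'" for D D'
    proof -
      obtain E where E: "E \<in> \<F>" "D = (\<lambda>g. \<exists>b\<in>Univ C. E (g(k := b)))"
        using DD(1) by (auto simp: \<F>'_def)
      obtain E' where E': "E' \<in> \<F>" "D' = (\<lambda>g. \<exists>b\<in>Univ C. E' (g(k := b)))"
        using DD(2) by (auto simp: \<F>'_def)
      obtain E'' where E'': "E'' \<in> \<F>"
        and dom: "\<And>g. (\<forall>i<Suc k. g i \<in> Univ C) \<Longrightarrow> E'' g \<Longrightarrow> E g \<and> E' g"
        using Suc.prems(4)[OF E(1) E'(1)] by blast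
      have "D g \<and> D' g" if g: "\<forall>i<k. g i \<in> Univ C" "\<exists>b\<in>Univ C. E'' (g(k := b))" for g
      proof -
        obtain b where "b \<in> Univ C" "E'' (g(k := b))" using g(2) by auto
        then show ?thesis using dom[of "g(k := b)"] g(1) E(2) E'(2) by (auto simp: less_Suc_eq)
      qed
      then show ?thesis using E''
        by (intro bexI[of _ "\<lambda>g. \<exists>b\<in>Univ C. E'' (g(k := b))"]) (auto simp: \<F>'_def)
    qed
  qed
  then obtain g where g: "\<And>i. i < k \<Longrightarrow> g i \<in> Univ C"
    and proj: "\<And>D. D \<in> \<F> \<Longrightarrow> \<exists>b\<in>Univ C. D (g(k := b))"
    by (auto simp: \<F>'_def)
  define \<G> where "\<G> = (\<lambda>D (h :: nat \<Rightarrow> 'a). D (g(k := h 0))) ` \<F>"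
  have "\<exists>b\<in>Univ C. \<forall>D\<in>\<G>. D (\<lambda>_. b)"
  proof (rule saturated_directed_1[where L=L and C=C and \<mu>=\<mu> and B="B \<union> g ` {..<k}" and \<F>=\<G>, OF assms(1,2)])
    show "B \<union> g ` {..<k} \<subseteq> Univ C" using assms(4) g by auto
    have "|g ` {..<k}| <o \<mu>"
      using assms(3) by (intro finite_ordLess_infinite)
        (auto simp: cinfinite_def Field_card_of card_order_on_def intro: card_of_well_order_on)
    then show "|B \<union> g ` {..<k}| <o \<mu>" using Un_Cinfinite_bound_strict assms(3,5) by blast
    show "definable L C (B \<union> g ` {..<k}) 1 D" if "D \<in> \<G>" for D
      using that by (auto simp only: \<G>_def intro!: definable_section Suc.prems(1) g)
    show "\<exists>b\<in>Univ C. D (\<lambda>_. b)" if "D \<in> \<G>" for D using that proj by (auto simp: \<G>_def)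
    show "\<G> \<noteq> {}" using Suc.prems(3) by (simp add: \<G>_def)
    show "\<exists>D''\<in>\<G>. \<forall>b\<in>Univ C. D'' (\<lambda>_. b) \<longrightarrow> D (\<lambda>_. b) \<and> D' (\<lambda>_. b)"
      if DD: "D \<in> \<G>" "D' \<in> \<G>" for D D'
    proof -
      obtain E where E: "E \<in> \<F>" "D = (\<lambda>h. E (g(k := h 0)))" using DD(1) by (auto simp: \<G>_def)
      obtain E' where E': "E' \<in> \<F>" "D' = (\<lambda>h. E' (g(k := h 0)))" using DD(2) by (auto simp: \<G>_def)
      obtain E'' where E'': "E'' \<in> \<F>"
        and dom: "\<And>g. (\<forall>i<Suc k. g i \<in> Univ C) \<Longrightarrow> E'' g \<Longrightarrow> E g \<and> E' g"
        using Suc.prems(4)[OF E(1) E'(1)] by blast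
      have "E (g(k := b)) \<and> E' (g(k := b))" if "b \<in> Univ C" "E'' (g(k := b))" for b
        using dom[of "g(k := b)"] g that by (auto simp: less_Suc_eq)
      then show ?thesis using E'' E(2) E'(2)
        by (intro bexI[of _ "\<lambda>h. E'' (g(k := h 0))"]) (auto simp: \<G>_def)
    qed
  qed
  then obtain b where "b \<in> Univ C" "\<And>D. D \<in> \<F> \<Longrightarrow> D (g(k := b))" by (auto simp: \<G>_def)
  moreover from this have "\<forall>i<Suc k. (g(k := b)) i \<in> Univ C" using g by (auto simp: less_Suc_eq)
  ultimately show ?case by blast
qed


section \<open>Elementary relations\<close>

text \<open>
  A relation is elementary if \<open>R\<close>-related tuples have the same type. Such a relation is the graph
  of a partial elementary injection; as a set of pairs it is easily inverted, composed and
  extended. In particular, for \<open>B \<subseteq> C\<close> and tuples \<open>xs\<close>, \<open>ys\<close> of \<open>C\<close> of the same length,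
  \<open>Id_on B \<union> set (zip xs ys)\<close> is elementary iff \<open>xs\<close> and \<open>ys\<close> have the same type over \<open>B\<close>.
\<close>

definition elem_rel ::
  "(unit, 'f, 'r) lang \<Rightarrow> (unit, 'f, 'r, 'a) struc \<Rightarrow> 'a rel \<Rightarrow> bool" where
  "elem_rel L C R \<longleftrightarrow> R \<subseteq> Univ C \<times> Univ C \<and>
     (\<forall>\<phi> v w. wf_fm L \<phi> \<longrightarrow> (\<forall>x\<in>fv \<phi>. (v x, w x) \<in> R) \<longrightarrow> (sat C v \<phi> \<longleftrightarrow> sat C w \<phi>))"

lemma elem_relI:
  assumes "R \<subseteq> Univ C \<times> Univ C"
    and "\<And>\<phi> v w. wf_fm L \<phi> \<Longrightarrow> \<forall>x\<in>fv \<phi>. (v x, w x) \<in> R \<Longrightarrow> sat C v \<phi> \<longleftrightarrow> sat C w \<phi>"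
  shows "elem_rel L C R"
  using assms unfolding elem_rel_def by blast

lemma elem_relD:
  assumes "elem_rel L C R" "wf_fm L \<phi>" "\<And>x. x \<in> fv \<phi> \<Longrightarrow> (v x, w x) \<in> R"
  shows "sat C v \<phi> \<longleftrightarrow> sat C w \<phi>"
  using assms unfolding elem_rel_def by blast

lemma elem_rel_Univ: "elem_rel L C R \<Longrightarrow> (a, b) \<in> R \<Longrightarrow> a \<in> Univ C \<and> b \<in> Univ C"
  unfolding elem_rel_def by blast

lemma elem_rel_subset: "elem_rel L C R \<Longrightarrow> S \<subseteq> R \<Longrightarrow> elem_rel L C S"
  unfolding elem_rel_def by blast

lemma elem_rel_converse:
  assumes "elem_rel L C R"
  shows "elem_rel L C (R\<inverse>)"
proof (rule elem_relI)
  show "R\<inverse> \<subseteq> Univ C \<times> Univ C" using elem_rel_Univ[OF assms] by auto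
  show "sat C v \<phi> \<longleftrightarrow> sat C w \<phi>" if "wf_fm L \<phi>" "\<forall>x\<in>fv \<phi>. (v x, w x) \<in> R\<inverse>" for \<phi> v w
    using elem_relD[OF assms that(1), of w v] that(2) by simp
qed

lemma elem_rel_relcomp:
  assumes "elem_rel L C R" "elem_rel L C S"
  shows "elem_rel L C (R O S)"
proof (rule elem_relI)
  show "R O S \<subseteq> Univ C \<times> Univ C"
    using elem_rel_Univ[OF assms(1)] elem_rel_Univ[OF assms(2)] by auto
  fix \<phi> v w assume \<phi>: "wf_fm L \<phi>" "\<forall>x\<in>fv \<phi>. (v x, w x) \<in> R O S"
  then have "\<forall>x\<in>fv \<phi>. \<exists>b. (v x, b) \<in> R \<and> (b, w x) \<in> S" by blast
  then obtain u where "\<forall>x\<in>fv \<phi>. (v x, u x) \<in> R \<and> (u x, w x) \<in> S" by metis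
  then show "sat C v \<phi> \<longleftrightarrow> sat C w \<phi>"
    using elem_relD[OF assms(1) \<phi>(1), of v u] elem_relD[OF assms(2) \<phi>(1), of u w] by simp
qed

lemma elem_rel_functional:
  assumes "one_sorted L" "elem_rel L C R" "(a, b) \<in> R" "(a, b') \<in> R"
  shows "b = b'"
proof -
  have "sat C (\<lambda>_. a) (Eq (Var ((), 0)) (Var ((), 1))) \<longleftrightarrow>
    sat C (\<lambda>x. if snd x = 0 then b else b') (Eq (Var ((), 0)) (Var ((), 1)))"
    by (rule elem_relD[OF assms(2)]) (use assms in \<open>auto simp: one_sorted_def\<close>)
  then show ?thesis by simp
qed

lemma elem_rel_Union_chain:
  assumes "K \<noteq> {}" "subset.chain \<A> K" "\<And>R. R \<in> K \<Longrightarrow> elem_rel L C R"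
  shows "elem_rel L C (\<Union>K)"
proof (rule elem_relI)
  show "\<Union>K \<subseteq> Univ C \<times> Univ C" using assms(3) unfolding elem_rel_def by blast
  fix \<phi> v w assume \<phi>: "wf_fm L \<phi>" "\<forall>x\<in>fv \<phi>. (v x, w x) \<in> \<Union>K"
  have "finite ((\<lambda>x. (v x, w x)) ` fv \<phi>)" "(\<lambda>x. (v x, w x)) ` fv \<phi> \<subseteq> \<Union>K"
    using \<phi>(2) finite_fv by auto
  then obtain R where R: "R \<in> K" "(\<lambda>x. (v x, w x)) ` fv \<phi> \<subseteq> R"
    by (rule finite_subset_Union_chain[OF _ _ assms(1,2)])
  show "sat C v \<phi> \<longleftrightarrow> sat C w \<phi>"
    by (rule elem_relD[OF assms(3)[OF R(1)] \<phi>(1)]) (use R(2) in auto)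
qed

lemma automorphism_eval:
  assumes "one_sorted L" "is_struc L C" "automorphism L C \<sigma>"
  shows "wf_tm L t \<Longrightarrow> (\<And>x. x \<in> tm_vars t \<Longrightarrow> v x \<in> Univ C) \<Longrightarrow>
    \<sigma> (eval C v t) = eval C (\<sigma> \<circ> v) t"
proof (induction t)
  case (Fn f ts)
  have in_Univ: "eval C v t \<in> Univ C" if "t \<in> set ts" for t
    using eval_in_Dom[OF assms(2), of t v] that Fn.prems by (force simp: list_all_iff)
  have "length ts = length (fdom L f)" using Fn.prems(1) by (metis length_map wf_tm.simps(2))
  then have "\<sigma> (Fint C f (map (eval C v) ts)) = Fint C f (map \<sigma> (map (eval C v) ts))"
    using assms(3) Fn.prems(1) in_Univ by (simp add: automorphism_def image_subset_iff del: map_map)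
  moreover have "map (\<lambda>t. \<sigma> (eval C v t)) ts = map (eval C (\<sigma> \<circ> v)) ts"
    by (intro map_cong refl Fn.IH) (use Fn.prems in \<open>force simp: list_all_iff\<close>)+
  ultimately show ?case by (simp add: comp_def del: map_eq_conv)
qed simp

lemma automorphism_sat:
  assumes "one_sorted L" "is_struc L C" "automorphism L C \<sigma>"
  shows "wf_fm L \<phi> \<Longrightarrow> (\<And>x. x \<in> fv \<phi> \<Longrightarrow> v x \<in> Univ C) \<Longrightarrow> sat C (\<sigma> \<circ> v) \<phi> \<longleftrightarrow> sat C v \<phi>"
proof (induction \<phi> arbitrary: v)
  case (Eq t u)
  have "inj_on \<sigma> (Univ C)" using assms(3) by (simp add: automorphism_def bij_betw_def)
  moreover have "eval C v t \<in> Univ C" "eval C v u \<in> Univ C"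
    using eval_in_Dom[OF assms(2), of _ v] Eq by auto
  moreover have "\<sigma> (eval C v t) = eval C (\<sigma> \<circ> v) t" "\<sigma> (eval C v u) = eval C (\<sigma> \<circ> v) u"
    by (rule automorphism_eval[OF assms]; use Eq in simp)+
  ultimately show ?case by (metis inj_on_eq_iff sat.simps(1))
next
  case (Rel r ts)
  have in_Univ: "eval C v t \<in> Univ C" if "t \<in> set ts" for t
    using eval_in_Dom[OF assms(2), of t v] that Rel.prems by (force simp: list_all_iff)
  have "length ts = length (rdom L r)" using Rel.prems(1) by (metis length_map wf_fm.simps(2))
  then have "Rint C r (map (eval C v) ts) \<longleftrightarrow> Rint C r (map \<sigma> (map (eval C v) ts))"
    using assms(3) Rel.prems(1) in_Univ by (simp add: automorphism_def image_subset_iff del: map_map)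
  moreover have "map (\<lambda>t. \<sigma> (eval C v t)) ts = map (eval C (\<sigma> \<circ> v)) ts"
    by (intro map_cong refl automorphism_eval[OF assms]) (use Rel.prems in \<open>force simp: list_all_iff\<close>)+
  ultimately show ?case by (simp add: comp_def del: map_eq_conv)
next
  case (Neg \<phi>)
  then show ?case by simp
next
  case (Conj \<phi> \<psi>)
  have "sat C (\<sigma> \<circ> v) \<phi> \<longleftrightarrow> sat C v \<phi>" by (rule Conj.IH(1)) (use Conj.prems in simp_all)
  moreover have "sat C (\<sigma> \<circ> v) \<psi> \<longleftrightarrow> sat C v \<psi>" by (rule Conj.IH(2)) (use Conj.prems in simp_all)
  ultimately show ?case unfolding sat.simps by blast
next
  case (Ex x \<phi>)
  have img: "\<sigma> ` Univ C = Univ C" using assms(3) by (simp add: automorphism_def bij_betw_def)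
  have "sat C ((\<sigma> \<circ> v)(x := \<sigma> b)) \<phi> \<longleftrightarrow> sat C (v(x := b)) \<phi>" if "b \<in> Univ C" for b
  proof -
    have "(\<sigma> \<circ> v)(x := \<sigma> b) = \<sigma> \<circ> v(x := b)" by (simp add: fun_eq_iff)
    moreover have "sat C (\<sigma> \<circ> v(x := b)) \<phi> \<longleftrightarrow> sat C (v(x := b)) \<phi>"
      by (rule Ex.IH) (use Ex.prems that in auto)
    ultimately show ?thesis by simp
  qed
  then have "(\<exists>b\<in>\<sigma> ` Univ C. sat C ((\<sigma> \<circ> v)(x := b)) \<phi>) \<longleftrightarrow> (\<exists>b\<in>Univ C. sat C (v(x := b)) \<phi>)"
    by simp
  then show ?case unfolding img sat.simps by (cases x) simp
qed

lemma elem_rel_automorphism: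
  assumes "one_sorted L" "is_struc L C" "automorphism L C \<sigma>" "A \<subseteq> Univ C"
  shows "elem_rel L C ((\<lambda>a. (a, \<sigma> a)) ` A)"
proof (rule elem_relI)
  have "\<sigma> ` Univ C = Univ C" using assms(3) by (simp add: automorphism_def bij_betw_def)
  then show "(\<lambda>a. (a, \<sigma> a)) ` A \<subseteq> Univ C \<times> Univ C" using assms(4) by blast
  fix \<phi> v w assume \<phi>: "wf_fm L \<phi>" "\<forall>x\<in>fv \<phi>. (v x, w x) \<in> (\<lambda>a. (a, \<sigma> a)) ` A"
  have "sat C w \<phi> \<longleftrightarrow> sat C (\<sigma> \<circ> v) \<phi>" by (rule sat_cong) (use \<phi>(2) in force)
  also have "\<dots> \<longleftrightarrow> sat C v \<phi>"
    by (rule automorphism_sat[OF assms(1-3) \<phi>(1)]) (use \<phi>(2) assms(4) in blast)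
  finally show "sat C v \<phi> \<longleftrightarrow> sat C w \<phi>" by simp
qed

text \<open>Strong homogeneity, for relations.\<close>

lemma elem_rel_extend:
  assumes "one_sorted L" "strongly_homogeneous L C \<mu>" "elem_rel L C R" "|Domain R| <o \<mu>"
  shows "\<exists>\<sigma>. automorphism L C \<sigma> \<and> (\<forall>a b. (a, b) \<in> R \<longrightarrow> \<sigma> a = b)"
proof -
  define f where "f a = (THE b. (a, b) \<in> R)" for a
  have f: "f a = b" if "(a, b) \<in> R" for a b
    unfolding f_def using elem_rel_functional[OF assms(1,3)] that by blast
  have fR: "(a, f a) \<in> R" if "a \<in> Domain R" for a using that f by auto
  have "elementary_map L C (Domain R) f"
    unfolding elementary_map_def
  proof (intro conjI allI impI)
    show "Domain R \<subseteq> Univ C" "f ` Domain R \<subseteq> Univ C"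
      using elem_rel_Univ[OF assms(3)] fR by blast+
    show "sat C v \<phi> \<longleftrightarrow> sat C (f \<circ> v) \<phi>" if "wf_fm L \<phi>" "\<forall>x\<in>fv \<phi>. v x \<in> Domain R" for \<phi> v
      by (rule elem_relD[OF assms(3) that(1)]) (use that(2) fR in auto)
  qed
  then obtain \<sigma> where "automorphism L C \<sigma>" "\<forall>a\<in>Domain R. \<sigma> a = f a"
    using assms(2,4) unfolding strongly_homogeneous_def by blast
  then show ?thesis using f by (metis Domain.DomainI)
qed

text \<open>
  Tuples satisfying the same predicates definable over \<open>B\<close> have the same type over \<open>B\<close>. The
  valuations in the definition of \<^const>\<open>elem_rel\<close> may use an entry of the tuple for several
  variables, whence the non-injective substitution.
\<close>

lemma elem_rel_zipI:
  fixes C :: "(unit, 'f, 'r, 'a) struc"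
  assumes "B \<subseteq> Univ C" "length xs = n" "length ys = n" "set xs \<subseteq> Univ C" "set ys \<subseteq> Univ C"
    and types: "\<And>D. definable L C B n D \<Longrightarrow> D ((!) xs) \<Longrightarrow> D ((!) ys)"
  shows "elem_rel L C (Id_on B \<union> set (zip xs ys))"
proof (rule elem_relI)
  show "Id_on B \<union> set (zip xs ys) \<subseteq> Univ C \<times> Univ C"
    using assms(1,4,5) by (auto dest: set_zip_leftD set_zip_rightD)
  fix \<phi> and v w :: "unit var \<Rightarrow> 'a"
  assume \<phi>: "wf_fm L \<phi>" "\<forall>x\<in>fv \<phi>. (v x, w x) \<in> Id_on B \<union> set (zip xs ys)"
  have "\<exists>i<n. v x = xs ! i \<and> w x = ys ! i" if "x \<in> fv \<phi>" "(v x, w x) \<notin> Id_on B" for x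
  proof -
    have "(v x, w x) \<in> set (zip xs ys)" using \<phi>(2) that by auto
    then show ?thesis using assms(2,3) by (auto simp: in_set_conv_nth)
  qed
  then obtain p where p: "\<And>x. x \<in> fv \<phi> \<Longrightarrow> (v x, w x) \<notin> Id_on B \<Longrightarrow>
    p x < n \<and> v x = xs ! p x \<and> w x = ys ! p x" by metis
  \<comment> \<open>Variables denoting entries of the tuple are sent to the corresponding place.\<close>
  define \<rho> where "\<rho> x = ((), if (v x, w x) \<in> Id_on B then n + snd x else p x)" for x :: "unit var"
  obtain \<psi> where \<psi>: "wf_fm L \<psi>" "fv \<psi> \<subseteq> \<rho> ` fv \<phi>"
    "\<And>(M :: (unit, 'f, 'r, 'a) struc) v. sat M v \<psi> \<longleftrightarrow> sat M (v \<circ> \<rho>) \<phi>"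
    using ex_substitution[OF \<phi>(1), where \<rho>=\<rho>] by auto
  define u where "u x = v ((), snd x - n)" for x :: "unit var"
  have xs: "sat C (val n ((!) xs) u) \<psi> \<longleftrightarrow> sat C v \<phi>"
    unfolding \<psi>(3) by (rule sat_cong) (use p in \<open>auto simp: val_def \<rho>_def u_def\<close>)
  have ys: "sat C (val n ((!) ys) u) \<psi> \<longleftrightarrow> sat C w \<phi>"
    unfolding \<psi>(3) by (rule sat_cong) (use p in \<open>auto simp: val_def \<rho>_def u_def\<close>)
  have "u x \<in> B" if x: "x \<in> fv \<psi>" "n \<le> snd x" for x
  proof -
    obtain y where y: "y \<in> fv \<phi>" "x = \<rho> y" using \<psi>(2) x(1) by blast
    then show ?thesis using p[of y] x(2) by (cases y) (auto simp: u_def \<rho>_def split: if_splits)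
  qed
  then have D: "definable L C B n (\<lambda>g. sat C (val n g u) \<psi>)"
    unfolding definable_def using \<psi>(1) by blast
  show "sat C v \<phi> \<longleftrightarrow> sat C w \<phi>"
    using types[OF D] types[OF definable_Not[OF D]] xs ys by blast
qed

text \<open>The set in the next two lemmas is the complete type of \<open>b\<close> over \<open>A\<close>.\<close>

lemma type_of_element:
  assumes "b \<in> Univ C"
  shows "{\<phi>v \<in> param_fms L C () A. solves C () b \<phi>v} \<in> complete_types L C () A"
  using assms by (auto simp: complete_types_def realizes_def param_fms_def solves_def)

lemma realizes_type_of_element:
  assumes "b \<in> Univ C" "A \<subseteq> Univ C"
    and "realizes C () b' {\<phi>v \<in> param_fms L C () A. solves C () b \<phi>v}"
  shows "elem_rel L C (insert (b, b') (Id_on A))"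
proof -
  have b': "b' \<in> Univ C" using assms(3) by (simp add: realizes_def)
  have "elem_rel L C (Id_on A \<union> set (zip [b] [b']))"
  proof (rule elem_rel_zipI[where n=1])
    fix D assume D: "definable L C A 1 D" "D ((!) [b])"
    obtain \<phi>v where \<phi>v: "\<phi>v \<in> param_fms L C () A"
      "\<forall>b\<in>Univ C. solves C () b \<phi>v \<longleftrightarrow> D (\<lambda>_. b)"
      using definable_param_fms[OF D(1) assms(2)] by auto
    have eq: "D ((!) [x]) \<longleftrightarrow> D (\<lambda>_. x)" if "x \<in> Univ C" for x
      by (rule definable_agree[OF D(1)]) (use that in auto)
    have "solves C () b \<phi>v" using \<phi>v(2) assms(1) D(2) eq by simp
    then have "solves C () b' \<phi>v" using \<phi>v(1) assms(3) unfolding realizes_def by blast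
    then show "D ((!) [b'])" using \<phi>v(2) b' eq by simp
  qed (use assms b' in auto)
  then show ?thesis by simp
qed


section \<open>Related tuples\<close>

lemma zip_nth_mem:
  assumes "set (zip xs ys) \<subseteq> R" "length ys = length xs" "i < length xs"
  shows "(xs ! i, ys ! i) \<in> R"
  using assms by (force simp: set_zip)

lemma zip_append_nth_mem:
  assumes "set (zip xs ys) \<subseteq> R" "set (zip us ws) \<subseteq> R"
    and "length xs = n" "length ys = n" "length us = n" "length ws = n" "i < 2 * n"
  shows "((xs @ us) ! i, (ys @ ws) ! i) \<in> R"
  by (rule zip_nth_mem) (use assms in simp_all)

lemma zip_in_tuples:
  assumes "set (zip xs ys) \<subseteq> R" "R \<subseteq> A \<times> A" "length xs = n" "length ys = n"
  shows "xs \<in> tuples A n" "ys \<in> tuples A n"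
proof -
  have "xs ! i \<in> A \<and> ys ! i \<in> A" if "i < n" for i
    using zip_nth_mem[OF assms(1), of i] assms(2-4) that by blast
  then show "xs \<in> tuples A n" "ys \<in> tuples A n"
    using assms(3,4) by (auto simp: tuples_def in_set_conv_nth)
qed


section \<open>Bounded numbers of classes\<close>

text \<open>
  The relation \<open>E\<close> has at most \<open>m\<close> classes on \<open>X\<close>: finite sets of pairwise inequivalent elements
  of \<open>X\<close> have at most \<open>m\<close> elements.
\<close>

definition at_most_classes :: "'b rel \<Rightarrow> 'b set \<Rightarrow> nat \<Rightarrow> bool" where
  "at_most_classes E X m \<longleftrightarrow>
     (\<forall>Z\<subseteq>X. finite Z \<longrightarrow> pairwise (\<lambda>x y. (x, y) \<notin> E) Z \<longrightarrow> card Z \<le> m)"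

lemma at_most_classesD:
  "at_most_classes E X m \<Longrightarrow> Z \<subseteq> X \<Longrightarrow> finite Z \<Longrightarrow> pairwise (\<lambda>x y. (x, y) \<notin> E) Z \<Longrightarrow> card Z \<le> m"
  unfolding at_most_classes_def by blast

lemma not_at_most_classesE:
  assumes "\<not> at_most_classes E X m"
  obtains zs where "length zs = Suc m" "distinct zs" "set zs \<subseteq> X"
    "pairwise (\<lambda>x y. (x, y) \<notin> E) (set zs)"
proof -
  obtain Z where Z: "Z \<subseteq> X" "finite Z" "pairwise (\<lambda>x y. (x, y) \<notin> E) Z" "Suc m \<le> card Z"
    using assms by (auto simp: at_most_classes_def not_le)
  obtain Z' where Z': "Z' \<subseteq> Z" "card Z' = Suc m" "finite Z'"
    using obtain_subset_with_card_n[OF Z(4)] .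
  obtain zs where "set zs = Z'" "distinct zs" using finite_distinct_list[OF Z'(3)] by blast
  then show thesis
    using that[of zs] Z Z' by (metis distinct_card pairwise_subset subset_trans)
qed

text \<open>The realizations in \<open>C\<close> of the type of the tuple \<open>c\<close> over \<open>B\<close>.\<close>

definition conjugates ::
  "(unit, 'f, 'r) lang \<Rightarrow> (unit, 'f, 'r, 'a) struc \<Rightarrow> 'a set \<Rightarrow> 'a list \<Rightarrow> 'a list set" where
  "conjugates L C B c =
     {z. length z = length c \<and> elem_rel L C (Id_on B \<union> set (zip c z))}"

lemma conjugates_Univ: "z \<in> conjugates L C B c \<Longrightarrow> set z \<subseteq> Univ C"
proof
  fix b assume z: "z \<in> conjugates L C B c" and "b \<in> set z"
  then obtain a where "(a, b) \<in> set (zip c z)"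
    by (auto simp: conjugates_def in_set_conv_nth set_zip)
  then show "b \<in> Univ C" using z elem_rel_Univ[of L C _ a b] unfolding conjugates_def by blast
qed

text \<open>
  \<open>E\<close> is definable without parameters, as a predicate on the concatenation of two \<open>n\<close>-tuples.
\<close>

definition class_rel_definable ::
  "(unit, 'f, 'r) lang \<Rightarrow> (unit, 'f, 'r, 'a) struc \<Rightarrow> nat \<Rightarrow> 'a list rel \<Rightarrow> bool" where
  "class_rel_definable L C n E \<longleftrightarrow>
     definable L C {} (2 * n) (\<lambda>g. (map g [0..<n], map (\<lambda>l. g (n + l)) [0..<n]) \<in> E)"

text \<open>
  By compactness, a bound on the number of classes among the conjugates of \<open>c\<close> is enforced by a
  single formula of the type of \<open>c\<close>. Were there none, the formulas over \<open>B\<close> saying that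
  \<open>m + 1\<close> consecutive \<open>n\<close>-tuples satisfy \<open>D\<close> and are pairwise inequivalent would form a directed
  family of satisfiable formulas, with \<open>D\<close> ranging over the type of \<open>c\<close>; a common solution would
  consist of \<open>m + 1\<close> inequivalent conjugates.
\<close>

lemma at_most_classes_definable:
  fixes C :: "(unit, 'f, 'r, 'a) struc" and \<mu> :: "'k rel"
  assumes "one_sorted L" "saturated L C \<mu>" "Cinfinite \<mu>" "B \<subseteq> Univ C" "|B| <o \<mu>"
    and c: "length c = n" "set c \<subseteq> Univ C"
    and E: "class_rel_definable L C n E" "\<And>z. z \<in> tuples (Univ C) n \<Longrightarrow> (z, z) \<in> E"
    and bound: "at_most_classes E (conjugates L C B c) m"
  shows "\<exists>D. definable L C B n D \<and> D ((!) c) \<and>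
    at_most_classes E {z \<in> tuples (Univ C) n. D ((!) z)} m"
proof (rule ccontr)
  assume neg: "\<not> ?thesis"
  \<comment> \<open>A sequence of length \<open>(m + 1) * n\<close> is cut into blocks of length \<open>n\<close>.\<close>
  define blk where "blk g i = map (\<lambda>l. g (i * n + l)) [0..<n]" for g :: "nat \<Rightarrow> 'a" and i
  define \<Psi> where "\<Psi> D g \<longleftrightarrow> (\<forall>i\<in>{..m}. D (\<lambda>l. g (i * n + l))) \<and>
    (\<forall>(i, j)\<in>{..m} \<times> {..m} - Id. (blk g i, blk g j) \<notin> E)" for D and g :: "nat \<Rightarrow> 'a"
  define \<F> where "\<F> = \<Psi> ` {D. definable L C B n D \<and> D ((!) c)}"
  have place: "i * n + l < Suc m * n" if "i \<le> m" "l < n" for i l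
  proof -
    have "i * n + l < Suc i * n" using that by simp
    also have "\<dots> \<le> Suc m * n" using that by (intro mult_le_mono1) simp
    finally show ?thesis .
  qed
  have taut: "definable L C B k (\<lambda>_. True)" for k
    unfolding definable_def using assms(1)
    by (intro exI[of _ "let \<phi> = Ex ((), 0) (Eq (Var ((), 0)) (Var ((), 0))) in Neg (Conj \<phi> (Neg \<phi>))"])
      (simp add: one_sorted_def Let_def)
  have inequiv: "definable L C B (Suc m * n) (\<lambda>g. (blk g i, blk g j) \<notin> E)" if "i \<le> m" "j \<le> m" for i j
  proof -
    define \<rho> where "\<rho> p = (if p < n then i * n + p else j * n + (p - n))" for p
    have "definable L C B (2 * n) (\<lambda>g. (map g [0..<n], map (\<lambda>l. g (n + l)) [0..<n]) \<in> E)"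
      using E(1) unfolding class_rel_definable_def by (rule definable_mono) simp
    then have "definable L C B (Suc m * n)
      (\<lambda>g. (map (\<lambda>p. g (\<rho> p)) [0..<n], map (\<lambda>l. g (\<rho> (n + l))) [0..<n]) \<in> E)"
    proof (rule definable_substitute)
      show "\<rho> p < Suc m * n" if "p < 2 * n" for p
        using place[of i p] place[of j "p - n"] that \<open>i \<le> m\<close> \<open>j \<le> m\<close> by (auto simp: \<rho>_def)
    qed
    moreover have "map (\<lambda>p. g (\<rho> p)) [0..<n] = blk g i" "map (\<lambda>l. g (\<rho> (n + l))) [0..<n] = blk g j" for g
      by (auto simp: \<rho>_def blk_def)
    ultimately show ?thesis by (simp add: definable_Not)
  qed
  have "\<exists>g. (\<forall>i<Suc m * n. g i \<in> Univ C) \<and> (\<forall>D\<in>\<F>. D g)"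
  proof (rule saturated_directed[OF assms(1-5)])
    show "definable L C B (Suc m * n) D'" if D': "D' \<in> \<F>" for D'
    proof -
      obtain D where D: "definable L C B n D" "D' = \<Psi> D" using D' by (auto simp: \<F>_def)
      have 1: "definable L C B (Suc m * n) (\<lambda>g. True \<and> (\<forall>i\<in>{..m}. D (\<lambda>l. g (i * n + l))))"
        by (intro definable_finite_Ball taut definable_substitute[OF D(1)]) (use place in auto)
      have 2: "definable L C B (Suc m * n)
        (\<lambda>g. True \<and> (\<forall>ij\<in>{..m} \<times> {..m} - Id. (blk g (fst ij), blk g (snd ij)) \<notin> E))"
        by (intro definable_finite_Ball taut inequiv) auto
      show ?thesis unfolding D(2)
        by (rule definable_cong[OF definable_conj[OF 1 2]]) (simp add: \<Psi>_def split_def)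
    qed
    show "\<exists>g. (\<forall>i<Suc m * n. g i \<in> Univ C) \<and> D' g" if D': "D' \<in> \<F>" for D'
    proof -
      obtain D where D: "definable L C B n D" "D ((!) c)" "D' = \<Psi> D" using D' by (auto simp: \<F>_def)
      then have "\<not> at_most_classes E {z \<in> tuples (Univ C) n. D ((!) z)} m" using neg by blast
      then obtain zs where zs: "length zs = Suc m" "distinct zs"
        "set zs \<subseteq> {z \<in> tuples (Univ C) n. D ((!) z)}" "pairwise (\<lambda>x y. (x, y) \<notin> E) (set zs)"
        by (rule not_at_most_classesE)
      define g where "g p = zs ! (p div n) ! (p mod n)" for p
      have z: "zs ! i \<in> tuples (Univ C) n" "D ((!) (zs ! i))" if "i \<le> m" for i
      proof -
        have "zs ! i \<in> set zs" using zs(1) that by simp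
        then show "zs ! i \<in> tuples (Univ C) n" "D ((!) (zs ! i))" using zs(3) by auto
      qed
      have gz: "g (i * n + l) = zs ! i ! l" if "l < n" for i l using that by (simp add: g_def)
      then have blk: "blk g i = zs ! i" if "i \<le> m" for i
        using z(1)[OF that] by (auto simp: blk_def tuples_def intro: nth_equalityI)
      have "g p \<in> Univ C" if p: "p < Suc m * n" for p
      proof -
        have "n > 0" using p by (cases n) auto
        then have "p div n \<le> m" "p mod n < n" using p by (auto simp: less_mult_imp_div_less less_Suc_eq_le[symmetric])
        then show ?thesis using z(1)[of "p div n"] by (auto simp: g_def tuples_def)
      qed
      moreover have "D (\<lambda>l. g (i * n + l))" if "i \<le> m" for i
      proof -
        have "D (\<lambda>l. g (i * n + l)) \<longleftrightarrow> D ((!) (zs ! i))"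
          by (rule definable_agree[OF D(1)]) (use gz z(1)[OF that] in \<open>auto simp: tuples_def\<close>)
        then show ?thesis using z(2)[OF that] by simp
      qed
      moreover have "(blk g i, blk g j) \<notin> E" if "i \<le> m" "j \<le> m" "i \<noteq> j" for i j
        using that zs(1,2,4) blk by (auto simp: pairwise_def nth_eq_iff_index_eq)
      ultimately show ?thesis unfolding D(3) \<Psi>_def by (intro exI[of _ g]) auto
    qed
    show "\<F> \<noteq> {}" using taut by (auto simp: \<F>_def)
    show "\<exists>D''\<in>\<F>. \<forall>g. (\<forall>i<Suc m * n. g i \<in> Univ C) \<longrightarrow> D'' g \<longrightarrow> D g \<and> D' g"
      if DD: "D \<in> \<F>" "D' \<in> \<F>" for D D'
    proof -
      obtain D1 where D1: "definable L C B n D1" "D1 ((!) c)" "D = \<Psi> D1" using DD(1) by (auto simp: \<F>_def)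
      obtain D2 where D2: "definable L C B n D2" "D2 ((!) c)" "D' = \<Psi> D2" using DD(2) by (auto simp: \<F>_def)
      have "\<Psi> (\<lambda>g. D1 g \<and> D2 g) \<in> \<F>" unfolding \<F>_def
        using D1(2) D2(2) definable_conj[OF D1(1) D2(1)] by (intro imageI) simp
      then show ?thesis by (rule bexI[rotated]) (simp add: D1(3) D2(3) \<Psi>_def)
    qed
  qed
  then obtain g where g: "\<And>p. p < Suc m * n \<Longrightarrow> g p \<in> Univ C" "\<And>D. D \<in> \<F> \<Longrightarrow> D g" by blast
  have \<Psi>: "\<Psi> D g" if "definable L C B n D" "D ((!) c)" for D using g(2) that by (auto simp: \<F>_def)
  have tup: "blk g i \<in> tuples (Univ C) n" if "i \<le> m" for i
    using g(1) place that by (auto simp: blk_def tuples_def)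
  have "blk g i \<in> conjugates L C B c" if i: "i \<le> m" for i
  proof -
    have "elem_rel L C (Id_on B \<union> set (zip c (blk g i)))"
    proof (rule elem_rel_zipI[OF assms(4) c(1)])
      fix D assume D: "definable L C B n D" "D ((!) c)"
      have "D (\<lambda>l. g (i * n + l))" using \<Psi>[OF D] i by (simp add: \<Psi>_def)
      moreover have "D (\<lambda>l. g (i * n + l)) \<longleftrightarrow> D ((!) (blk g i))"
        by (rule definable_agree[OF D(1)]) (use g(1) place i in \<open>auto simp: blk_def\<close>)
      ultimately show "D ((!) (blk g i))" by simp
    qed (use tup[OF i] c(2) in \<open>auto simp: tuples_def\<close>)
    then show ?thesis using c(1) by (simp add: conjugates_def blk_def)
  qed
  moreover have sep: "(blk g i, blk g j) \<notin> E" if "i \<le> m" "j \<le> m" "i \<noteq> j" for i j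
    using \<Psi>[OF taut] that by (auto simp: \<Psi>_def)
  moreover have inj: "inj_on (blk g) {..m}"
  proof (rule inj_onI, rule ccontr)
    fix i j assume "i \<in> {..m}" "j \<in> {..m}" "blk g i = blk g j" "i \<noteq> j"
    then show False using sep[of i j] E(2)[OF tup, of i] by auto
  qed
  ultimately have "card (blk g ` {..m}) \<le> m"
    by (intro at_most_classesD[OF bound]) (auto simp: pairwise_def)
  then show False using card_image[OF inj] by simp
qed


section \<open>The calculus of independence\<close>

text \<open>
  A lovely pair in a saturated and strongly homogeneous structure \<open>C\<close>. Of \<open>\<kappa>\<^sub>0\<close> it is only required
  that it is infinite and that local character of finite sets holds with it.
\<close>

locale lovely =
  fixes L :: "(unit, 'f, 'r) lang" and C :: "(unit, 'f, 'r, 'a) struc"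
    and \<mu> \<kappa>\<^sub>0 \<kappa> :: "'k rel" and ind :: "'a set \<Rightarrow> 'a set \<Rightarrow> 'a set \<Rightarrow> bool"
    and M P :: "'a set"
  assumes one_sorted: "one_sorted L" and struc: "is_struc L C"
    and \<mu>: "Cinfinite \<mu>" and sat_C: "saturated L C \<mu>" and hom_C: "strongly_homogeneous L C \<mu>"
    and ind: "independence_relation L C \<mu> ind"
    and \<kappa>\<^sub>0: "Cinfinite \<kappa>\<^sub>0" "finitary_local_character C \<mu> ind \<kappa>\<^sub>0"
    and \<kappa>: "Card_order \<kappa>" "\<kappa> <o \<mu>" "\<kappa>\<^sub>0 <o \<kappa>"
    and pair: "lovely_pair L C \<mu> ind \<kappa> M P"
begin

abbreviation sm where "sm \<equiv> small C \<mu>"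

text \<open>The very small subsets of \<open>M\<close>.\<close>

definition very_small :: "'a set \<Rightarrow> bool" where
  "very_small A \<longleftrightarrow> A \<subseteq> M \<and> |A| <o \<kappa>"

lemma small_Un [intro]: "sm A \<Longrightarrow> sm B \<Longrightarrow> sm (A \<union> B)"
  using Un_Cinfinite_bound_strict \<mu> by (auto simp: small_def)

lemma small_subset: "sm A \<Longrightarrow> B \<subseteq> A \<Longrightarrow> sm B"
  using card_of_mono1 ordLeq_ordLess_trans unfolding small_def by blast

lemma finite_card_less: "finite A \<Longrightarrow> Cinfinite (r :: 'k rel) \<Longrightarrow> |A| <o r"
  by (intro finite_ordLess_infinite)
    (auto simp: cinfinite_def Field_card_of card_order_on_def intro: card_of_well_order_on)

lemma small_finite: "finite A \<Longrightarrow> A \<subseteq> Univ C \<Longrightarrow> sm A"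
  using finite_card_less \<mu> by (auto simp: small_def)

lemma small_image: "automorphism L C \<sigma> \<Longrightarrow> sm A \<Longrightarrow> sm (\<sigma> ` A)"
  using ordLeq_ordLess_trans[OF card_of_image] unfolding small_def automorphism_def bij_betw_def by blast

lemma small_M: "sm M" and P_M: "P \<subseteq> M" and M_C: "elementary_substructure L M C"
  and M_Univ: "M \<subseteq> Univ C"
  using pair by (auto simp: lovely_pair_def small_def)

lemma small_in_M [intro]: "A \<subseteq> M \<Longrightarrow> sm A"
  using small_subset small_M by blast

lemma small_P [intro]: "A \<subseteq> P \<Longrightarrow> sm A"
  using small_in_M P_M by blast

lemma \<kappa>_Cinfinite: "Cinfinite \<kappa>"
  using \<kappa> \<kappa>\<^sub>0 cinfinite_mono ordLess_imp_ordLeq by blast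

lemma very_small_M: "very_small A \<Longrightarrow> A \<subseteq> M" by (simp add: very_small_def)

lemma very_small_Un: "very_small A \<Longrightarrow> very_small B \<Longrightarrow> very_small (A \<union> B)"
  using Un_Cinfinite_bound_strict \<kappa>_Cinfinite by (auto simp: very_small_def)

lemma very_small_subset: "very_small A \<Longrightarrow> B \<subseteq> A \<Longrightarrow> very_small B"
  using card_of_mono1 ordLeq_ordLess_trans unfolding very_small_def by blast

lemma very_small_finite: "finite A \<Longrightarrow> A \<subseteq> M \<Longrightarrow> very_small A"
  using finite_card_less \<kappa>_Cinfinite by (auto simp: very_small_def)

lemma very_small_small: "very_small A \<Longrightarrow> sm A"
  using small_in_M by (auto simp: very_small_def)

lemma ind_invariant:
  assumes "automorphism L C \<sigma>" "ind A B D" "sm A" "sm B" "sm D"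
  shows "ind (\<sigma> ` A) (\<sigma> ` B) (\<sigma> ` D)"
  using ind[unfolded independence_relation_def, THEN conjunct1, rule_format] assms by simp

lemma ind_Un_base: "ind A B D \<Longrightarrow> sm A \<Longrightarrow> sm B \<Longrightarrow> sm D \<Longrightarrow> ind (A \<union> B) B D"
  using ind[unfolded independence_relation_def, THEN conjunct2, THEN conjunct1, rule_format] by simp

lemma ind_sym: "ind A B D \<Longrightarrow> sm A \<Longrightarrow> sm B \<Longrightarrow> sm D \<Longrightarrow> ind D B A"
  using ind[unfolded independence_relation_def, THEN conjunct2, THEN conjunct2, THEN conjunct1, rule_format] by simp

lemma ind_transitive:
  "sm A \<Longrightarrow> sm B \<Longrightarrow> sm D \<Longrightarrow> sm E \<Longrightarrow> B \<subseteq> D \<Longrightarrow> D \<subseteq> E \<Longrightarrow> ind A B E \<longleftrightarrow> ind A B D \<and> ind A D E"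
  by (rule ind[unfolded independence_relation_def, THEN conjunct2, THEN conjunct2, THEN conjunct2, THEN conjunct1, rule_format])

lemma ind_finite_character:
  "sm A \<Longrightarrow> sm B \<Longrightarrow> sm D \<Longrightarrow> ind A B D \<longleftrightarrow> (\<forall>A0\<subseteq>A. finite A0 \<longrightarrow> ind A0 B D)"
  by (rule ind[unfolded independence_relation_def, THEN conjunct2, THEN conjunct2, THEN conjunct2, THEN conjunct2, THEN conjunct1, rule_format])

lemma ind_extension:
  "sm A \<Longrightarrow> sm B \<Longrightarrow> sm D \<Longrightarrow> \<exists>A'. equiv_over L C B A' A \<and> ind A' B D"
  by (rule ind[unfolded independence_relation_def, THEN conjunct2, THEN conjunct2, THEN conjunct2, THEN conjunct2, THEN conjunct2, THEN conjunct1, rule_format])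

lemma ind_local:
  assumes "finite A" "A \<subseteq> Univ C" "sm B"
  obtains B0 where "B0 \<subseteq> B" "|B0| <o \<kappa>" "ind A B0 B"
  using assms \<kappa>\<^sub>0(2) \<kappa>(3) unfolding finitary_local_character_def
  by (meson ordLess_transitive)

lemma ind_mono_left:
  assumes "ind A B D" "A' \<subseteq> A" "sm A" "sm B" "sm D"
  shows "ind A' B D"
proof -
  have "sm A'" using assms small_subset by blast
  moreover have "ind A0 B D" if "A0 \<subseteq> A'" "finite A0" for A0
    using ind_finite_character[of A B D] assms that by blast
  ultimately show ?thesis using ind_finite_character[of A' B D] assms by blast
qed

lemma ind_mono:
  assumes "ind A B D" "A' \<subseteq> A \<union> B" "D' \<subseteq> D \<union> B" "sm A" "sm B" "sm D"
  shows "ind A' B D'"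
proof -
  have s: "sm A'" using small_subset[of "A \<union> B" A'] assms by blast
  have "ind A' B D"
    by (rule ind_mono_left[OF ind_Un_base[OF assms(1)] assms(2)]) (use assms in blast)+
  then have "ind D B A'" using ind_sym s assms by blast
  then have "ind D' B A'"
    by (rule ind_mono_left[OF ind_Un_base _ _]) (use assms s in blast)+
  then show ?thesis using ind_sym[of D' B A'] s assms small_subset[of "D \<union> B" D'] by blast
qed

lemma ind_base_mono:
  assumes "ind A B D" "B \<subseteq> B'" "B' \<subseteq> B \<union> D" "sm A" "sm B" "sm D"
  shows "ind A B' D"
proof -
  have s: "sm B'" using small_subset[of "B \<union> D" B'] assms by blast
  have "ind A B (B \<union> D)" by (rule ind_mono[OF assms(1)]) (use assms in auto)
  then have "ind A B' (B \<union> D)" using ind_transitive[of A B B' "B \<union> D"] assms s by blast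
  then show ?thesis by (rule ind_mono) (use assms s in auto)
qed

lemma ind_trans:
  assumes "ind A B D" "ind A (B \<union> D) E" "sm A" "sm B" "sm D" "sm E"
  shows "ind A B (D \<union> E)"
proof -
  have "ind A B (B \<union> D)" by (rule ind_mono[OF assms(1)]) (use assms in auto)
  moreover have "ind A (B \<union> D) (B \<union> D \<union> E)" by (rule ind_mono[OF assms(2)]) (use assms in auto)
  ultimately have "ind A B (B \<union> D \<union> E)"
    using ind_transitive[of A B "B \<union> D" "B \<union> D \<union> E"] assms by blast
  then show ?thesis by (rule ind_mono) (use assms in auto)
qed

lemma ind_trans_left:
  assumes "ind A B D" "ind E (B \<union> A) D" "sm A" "sm B" "sm D" "sm E"
  shows "ind (A \<union> E) B D"
proof -
  have "ind D B A" "ind D (B \<union> A) E" using ind_sym assms by blast+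
  then have "ind D B (A \<union> E)" using ind_trans assms by blast
  then show ?thesis using ind_sym[of D B "A \<union> E"] assms by blast
qed


section \<open>Density and extension for elementary relations\<close>

lemma extend_to_automorphism:
  assumes "elem_rel L C R" "sm (Domain R)"
  obtains \<sigma> where "automorphism L C \<sigma>" "\<And>a b. (a, b) \<in> R \<Longrightarrow> \<sigma> a = b" "\<sigma> ` Domain R = Range R"
proof -
  obtain \<sigma> where "automorphism L C \<sigma>" "\<forall>a b. (a, b) \<in> R \<longrightarrow> \<sigma> a = b"
    using elem_rel_extend[OF one_sorted hom_C assms(1)] assms(2) by (auto simp: small_def)
  moreover from this have "\<sigma> ` Domain R = Range R" by force
  ultimately show thesis using that by blast
qed

lemma automorphism_in_Univ: "automorphism L C \<sigma> \<Longrightarrow> a \<in> Univ C \<Longrightarrow> \<sigma> a \<in> Univ C"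
  unfolding automorphism_def bij_betw_def by blast

text \<open>
  An elementary relation \<open>R\<close> is extended in two steps: an automorphism \<open>\<sigma>\<close> extending \<open>R\<close> moves the new
  elements next to the range of \<open>R\<close>, and \<open>S\<close> then changes their images over that range.
\<close>

lemma elem_rel_via_automorphism:
  assumes "automorphism L C \<sigma>" "\<And>a b. (a, b) \<in> R \<Longrightarrow> \<sigma> a = b" "elem_rel L C S"
    and "Domain R \<subseteq> Univ C" "Id_on (Range R) \<subseteq> S" "Domain T \<subseteq> Univ C"
    and "\<And>a b. (a, b) \<in> T \<Longrightarrow> (\<sigma> a, b) \<in> S"
  shows "elem_rel L C (R \<union> T)"
proof (rule elem_rel_subset)
  show "elem_rel L C ((\<lambda>a. (a, \<sigma> a)) ` (Domain R \<union> Domain T) O S)"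
    using assms by (intro elem_rel_relcomp elem_rel_automorphism[OF one_sorted struc]) auto
  show "R \<union> T \<subseteq> (\<lambda>a. (a, \<sigma> a)) ` (Domain R \<union> Domain T) O S"
    using assms(2,5,7) by fastforce
qed

lemma elem_rel_Domain_Univ: "elem_rel L C R \<Longrightarrow> Domain R \<subseteq> Univ C"
  and elem_rel_Range_Univ: "elem_rel L C R \<Longrightarrow> Range R \<subseteq> Univ C"
  by (auto dest: elem_rel_Univ)

lemma density:
  assumes "very_small B" "c \<in> Univ C" "ind {c} (P \<inter> B) B"
  obtains b where "b \<in> P" "elem_rel L C (insert (c, b) (Id_on B))"
proof -
  let ?q = "{\<phi>v \<in> param_fms L C () B. solves C () c \<phi>v}"
  have "?q \<in> complete_types L C () B" using type_of_element[OF assms(2)] .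
  moreover have "\<exists>c. realizes C () c ?q \<and> ind {c} (P \<inter> B) B"
    using assms(2,3) by (intro exI[of _ c]) (simp add: realizes_def)
  moreover have "\<forall>A\<subseteq>M. |A| <o \<kappa> \<longrightarrow> (\<forall>q\<in>complete_types L C () A.
      (\<exists>c. realizes C () c q \<and> ind {c} (P \<inter> A) A) \<longrightarrow> (\<exists>b\<in>P. realizes C () b q))"
    using pair by (simp add: lovely_pair_def)
  ultimately obtain b where b: "b \<in> P" "realizes C () b ?q"
    using assms(1) unfolding very_small_def by blast
  have "B \<subseteq> Univ C" using very_small_M[OF assms(1)] M_Univ by simp
  then show thesis
    by (rule that[OF b(1) realizes_type_of_element[OF assms(2) _ b(2)]])
qed

lemma extension:
  assumes "very_small B" "c \<in> Univ C"
  obtains b where "b \<in> M" "ind {b} B P" "elem_rel L C (insert (c, b) (Id_on B))"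
proof -
  let ?q = "{\<phi>v \<in> param_fms L C () B. solves C () c \<phi>v}"
  have "?q \<in> complete_types L C () B" using type_of_element[OF assms(2)] .
  moreover have "\<forall>A\<subseteq>M. |A| <o \<kappa> \<longrightarrow> (\<forall>q\<in>complete_types L C () A.
      \<exists>b\<in>M. realizes C () b q \<and> ind {b} A P)"
    using pair by (simp add: lovely_pair_def)
  ultimately obtain b where b: "b \<in> M" "realizes C () b ?q" "ind {b} B P"
    using assms(1) unfolding very_small_def by blast
  have "B \<subseteq> Univ C" using very_small_M[OF assms(1)] M_Univ by simp
  then show thesis
    by (rule that[OF b(1,3) realizes_type_of_element[OF assms(2) _ b(2)]])
qed

text \<open>The extension property for tuples, one entry at a time.\<close>

lemma extension_tuple:
  assumes "very_small B" "set cs \<subseteq> Univ C"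
  shows "\<exists>ds. length ds = length cs \<and> set ds \<subseteq> M \<and> ind (set ds) B P \<and>
    elem_rel L C (Id_on B \<union> set (zip cs ds))"
  using assms(2)
proof (induction cs rule: rev_induct)
  case Nil
  obtain c where "c \<in> Univ C" using struc one_sorted by (auto simp: is_struc_def one_sorted_def)
  then obtain b where b: "b \<in> M" "ind {b} B P" "elem_rel L C (insert (c, b) (Id_on B))"
    using extension assms(1) by blast
  then have "ind {} B P" using ind_mono_left[OF b(2)] very_small_small[OF assms(1)] by blast
  moreover have "elem_rel L C (Id_on B)" using elem_rel_subset[OF b(3)] by blast
  ultimately show ?case by simp
next
  case (snoc c cs)
  obtain ds where ds: "length ds = length cs" "set ds \<subseteq> M" "ind (set ds) B P"
    "elem_rel L C (Id_on B \<union> set (zip cs ds))" (is "elem_rel L C ?R")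
    using snoc by auto
  have "Domain ?R \<subseteq> B \<union> set cs" by (auto dest: set_zip_leftD)
  moreover have "sm (B \<union> set cs)" using assms(1) snoc.prems small_finite very_small_small by auto
  ultimately have "sm (Domain ?R)" using small_subset by blast
  then obtain \<sigma> where \<sigma>: "automorphism L C \<sigma>" "\<And>a b. (a, b) \<in> ?R \<Longrightarrow> \<sigma> a = b"
    using extend_to_automorphism[OF ds(4)] by metis
  have B': "very_small (B \<union> set ds)" using very_small_Un very_small_finite assms(1) ds(2) by auto
  have "\<sigma> c \<in> Univ C" using automorphism_in_Univ[OF \<sigma>(1)] snoc.prems by simp
  then obtain d where d: "d \<in> M" "ind {d} (B \<union> set ds) P"
    "elem_rel L C (insert (\<sigma> c, d) (Id_on (B \<union> set ds)))"
    using extension[OF B'] by blast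
  have "Range ?R \<subseteq> B \<union> set ds" by (auto dest: set_zip_rightD)
  then have Id_R: "Id_on (Range ?R) \<subseteq> insert (\<sigma> c, d) (Id_on (B \<union> set ds))" by auto
  have "elem_rel L C (?R \<union> {(c, d)})"
    by (rule elem_rel_via_automorphism[OF \<sigma> d(3) elem_rel_Domain_Univ[OF ds(4)] Id_R])
      (use snoc.prems in auto)
  moreover have "set (zip (cs @ [c]) (ds @ [d])) = set (zip cs ds) \<union> {(c, d)}" using ds(1) by simp
  ultimately have "elem_rel L C (Id_on B \<union> set (zip (cs @ [c]) (ds @ [d])))"
    by (simp add: Un_assoc)
  moreover have "ind (set ds \<union> {d}) B P"
    by (rule ind_trans_left[OF ds(3) d(2)]) (use ds(2) d(1) very_small_small[OF assms(1)] in auto)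
  ultimately show ?case using ds(1,2) d(1) by (intro exI[of _ "ds @ [d]"]) simp
qed

text \<open>
  The density property for sets of arbitrary very small size. Partial maps into \<open>P\<close> are extended
  by Zorn's lemma: adding elements of \<open>P\<close> to the base preserves the independence hypothesis.
\<close>

lemma density_set:
  assumes B: "very_small B" and D: "sm D" "|D| <o \<kappa>" and ind_D: "ind D (P \<inter> B) B"
  obtains R where "elem_rel L C (Id_on B \<union> R)" "Domain R = D" "Range R \<subseteq> P"
proof -
  define Z where "Z = {R. elem_rel L C (Id_on B \<union> R) \<and> Domain R \<subseteq> D \<and> Range R \<subseteq> P}"
  have Id_B: "elem_rel L C (Id_on B)"
    using extension_tuple[OF B, of "[]"] by simp
  have "\<exists>R\<in>Z. \<forall>X\<in>Z. R \<subseteq> X \<longrightarrow> X = R"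
  proof (rule subset_Zorn_nonempty)
    have "{} \<in> Z" using Id_B by (simp add: Z_def)
    then show "Z \<noteq> {}" by blast
    fix K assume K: "K \<noteq> {}" "subset.chain Z K"
    then have KZ: "K \<subseteq> Z" by (simp add: subset_chain_def)
    have "subset.chain UNIV ((\<union>) (Id_on B) ` K)"
      using K(2) by (auto simp: subset_chain_def)
    then have "elem_rel L C (\<Union>((\<union>) (Id_on B) ` K))"
      by (rule elem_rel_Union_chain[rotated]) (use K(1) KZ in \<open>auto simp: Z_def\<close>)
    moreover have "\<Union>((\<union>) (Id_on B) ` K) = Id_on B \<union> \<Union>K" using K(1) by auto
    moreover have "Domain (\<Union>K) \<subseteq> D" "Range (\<Union>K) \<subseteq> P" using KZ by (auto simp: Z_def)
    ultimately show "\<Union>K \<in> Z" by (simp add: Z_def)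
  qed
  then obtain R where RZ: "R \<in> Z" and max: "\<And>X. X \<in> Z \<Longrightarrow> R \<subseteq> X \<Longrightarrow> X = R"
    by blast
  have R: "elem_rel L C (Id_on B \<union> R)" "Domain R \<subseteq> D" "Range R \<subseteq> P"
    using RZ by (auto simp: Z_def)
  have "d \<in> Domain R" if d: "d \<in> D" for d
  proof -
    have dom: "sm (B \<union> Domain R)" using very_small_small[OF B] small_subset[OF D(1) R(2)] by blast
    moreover have "Domain (Id_on B \<union> R) = B \<union> Domain R" by auto
    ultimately obtain \<sigma> where \<sigma>: "automorphism L C \<sigma>"
      "\<And>a b. (a, b) \<in> Id_on B \<union> R \<Longrightarrow> \<sigma> a = b"
      using extend_to_automorphism[OF R(1)] by metis
    have \<sigma>B: "\<sigma> ` X = X" if "X \<subseteq> B" for X using \<sigma>(2) that by force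
    have \<sigma>R: "\<sigma> ` Domain R = Range R" using \<sigma>(2) by force
    \<comment> \<open>The image of \<open>R\<close> is very small because \<open>R\<close> is a function on a subset of \<open>D\<close>.\<close>
    have "|Range R| <o \<kappa>"
      using \<sigma>R ordLeq_ordLess_trans[OF card_of_image] ordLeq_ordLess_trans[OF card_of_mono1[OF R(2)] D(2)]
      by metis
    then have B': "very_small (B \<union> Range R)" using very_small_Un[OF B] R(3) P_M by (auto simp: very_small_def)
    have s: "sm (\<sigma> ` D)" using small_image[OF \<sigma>(1) D(1)] .
    have sB: "sm B" "sm (P \<inter> B)" using very_small_small[OF B] by auto
    have sR: "sm (Range R)" using R(3) by blast
    have "ind (\<sigma> ` D) (P \<inter> B) B"
      using ind_invariant[OF \<sigma>(1) ind_D D(1)] sB \<sigma>B by simp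
    then have "ind B (P \<inter> B) (\<sigma> ` D)" using ind_sym s sB by blast
    then have "ind B ((P \<inter> B) \<union> Range R) (\<sigma> ` D)"
      by (rule ind_base_mono) (use sB s \<sigma>R R(2) in auto)
    then have "ind (\<sigma> ` D) ((P \<inter> B) \<union> Range R) B" using ind_sym s sB sR by blast
    then have "ind {\<sigma> d} ((P \<inter> B) \<union> Range R) (B \<union> Range R)"
      by (rule ind_mono) (use s sB sR d in auto)
    moreover have "(P \<inter> B) \<union> Range R = P \<inter> (B \<union> Range R)" using R(3) by auto
    moreover have "\<sigma> d \<in> Univ C" using s d by (auto simp: small_def)
    ultimately obtain b where b: "b \<in> P" "elem_rel L C (insert (\<sigma> d, b) (Id_on (B \<union> Range R)))"
      using density[OF B'] by metis
    have "elem_rel L C ((Id_on B \<union> R) \<union> {(d, b)})"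
    proof (rule elem_rel_via_automorphism[OF \<sigma> b(2)])
      show "Domain (Id_on B \<union> R) \<subseteq> Univ C" using elem_rel_Domain_Univ[OF R(1)] .
      show "Domain {(d, b)} \<subseteq> Univ C" using d D(1) by (auto simp: small_def)
    qed auto
    then have "insert (d, b) R \<in> Z" using R(2,3) b(1) d by (simp add: Z_def)
    then have "insert (d, b) R = R" using max by blast
    then show ?thesis by blast
  qed
  then show thesis using that[of R] R by blast
qed

section \<open>P-independent sets and the back-and-forth system\<close>

abbreviation Pind where "Pind \<equiv> P_independent ind P"

lemma Pind_Un_P:
  assumes "Pind B" "B \<subseteq> M" "D \<subseteq> P"
  shows "Pind (B \<union> D)"
proof -
  have "ind B (P \<inter> B) P" using assms(1) by (simp add: P_independent_def)
  then have "ind B ((P \<inter> B) \<union> D) P"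
    by (rule ind_base_mono) (use assms in auto)
  then have "ind (B \<union> D) ((P \<inter> B) \<union> D) P"
    by (rule ind_mono) (use assms in auto)
  moreover have "(P \<inter> B) \<union> D = P \<inter> (B \<union> D)" using assms(3) by auto
  ultimately show ?thesis by (simp add: P_independent_def)
qed

lemma ind_Un_Pind:
  assumes "Pind B" "B \<subseteq> M" "X \<subseteq> M" "ind X B P"
  shows "ind (B \<union> X) (P \<inter> B) P"
proof (rule ind_trans_left)
  show "ind B (P \<inter> B) P" using assms(1) by (simp add: P_independent_def)
  have "P \<inter> B \<union> B = B" by auto
  then show "ind X (P \<inter> B \<union> B) P" using assms(4) by simp
qed (use assms in auto)

lemma Pind_Un_ind:
  assumes "Pind B" "B \<subseteq> M" "X \<subseteq> M" "ind X B P"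
  shows "Pind (B \<union> X)"
  unfolding P_independent_def
  by (rule ind_base_mono[OF ind_Un_Pind[OF assms]]) (use assms in auto)

lemma image_P_Domain:
  assumes "\<And>a b. (a, b) \<in> R \<Longrightarrow> \<sigma> a = b" "\<And>x y. (x, y) \<in> R \<Longrightarrow> x \<in> P \<longleftrightarrow> y \<in> P"
  shows "\<sigma> ` (P \<inter> Domain R) = P \<inter> Range R"
proof
  show "\<sigma> ` (P \<inter> Domain R) \<subseteq> P \<inter> Range R" using assms by fastforce
  show "P \<inter> Range R \<subseteq> \<sigma> ` (P \<inter> Domain R)"
  proof
    fix y assume "y \<in> P \<inter> Range R"
    then obtain x where "(x, y) \<in> R" "y \<in> P" by auto
    then show "y \<in> \<sigma> ` (P \<inter> Domain R)" using assms(1)[of x y] assms(2)[of x y] by (auto simp: image_iff)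
  qed
qed

text \<open>
  An element \<open>b\<close> of \<open>M\<close> that is independent from itself over a very small subset \<open>D\<close> of \<open>P\<close> is in \<open>P\<close>:
  the type of \<open>b\<close> over \<open>D \<union> {b}\<close> is realized in \<open>P\<close>, by density, and \<open>b\<close> is the only realization.
\<close>

lemma mem_P_if_ind_self:
  assumes "b \<in> M" "D \<subseteq> P" "very_small D" "ind {b} D {b}"
  shows "b \<in> P"
proof (rule ccontr)
  assume "b \<notin> P"
  then have *: "P \<inter> (D \<union> {b}) = D" using assms(2) by auto
  have "ind {b} D (D \<union> {b})"
    by (rule ind_mono[OF assms(4)]) (use assms in auto)
  moreover have "very_small (D \<union> {b})" by (rule very_small_Un[OF assms(3) very_small_finite]) (use assms(1) in auto)
  ultimately obtain b' where b': "b' \<in> P" "elem_rel L C (insert (b, b') (Id_on (D \<union> {b})))"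
    using density[of "D \<union> {b}" b] * assms(1) M_Univ by auto
  have "b' = b" by (rule elem_rel_functional[OF one_sorted b'(2), of b]) auto
  then show False using b'(1) \<open>b \<notin> P\<close> by simp
qed

text \<open>
  If \<open>b' \<in> P\<close> is independent from \<open>P\<close> over a P-independent set, then it is independent from itself
  over the part of that set in \<open>P\<close>; by invariance so is a corresponding element \<open>b\<close>, which is
  therefore in \<open>P\<close>.
\<close>

lemma mem_P_transfer:
  assumes "elem_rel L C (insert (b, b') R)" "very_small (Domain R)" "Range R \<subseteq> M"
    and "Pind (Range R)" "\<And>x y. (x, y) \<in> R \<Longrightarrow> x \<in> P \<longleftrightarrow> y \<in> P"
    and "b \<in> M" "b' \<in> P" "ind {b'} (Range R) P"
  shows "b \<in> P"
proof -
  define B where "B = Range R"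
  have bM: "{b'} \<subseteq> M" using assms(7) P_M by auto
  have "ind (B \<union> {b'}) (P \<inter> B) P"
    using ind_Un_Pind[OF assms(4,3) bM assms(8)] by (simp add: B_def)
  then have self: "ind {b'} (P \<inter> B) {b'}"
    by (rule ind_mono) (use assms(3,7) bM B_def in auto)
  let ?S = "(insert (b, b') R)\<inverse>"
  have "Domain ?S \<subseteq> M" using bM assms(3) by auto
  then obtain \<sigma> where \<sigma>: "automorphism L C \<sigma>" "\<And>a c. (a, c) \<in> ?S \<Longrightarrow> \<sigma> a = c"
    using extend_to_automorphism[OF elem_rel_converse[OF assms(1)]] small_in_M by metis
  have "\<sigma> b' = b" using \<sigma>(2) by simp
  moreover have "\<sigma> ` (P \<inter> B) = P \<inter> Domain R"
    using image_P_Domain[of "R\<inverse>" \<sigma>] \<sigma>(2) assms(5) by (simp add: B_def)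
  ultimately have "ind {b} (P \<inter> Domain R) {b}"
    using ind_invariant[OF \<sigma>(1) self] bM small_P[of "P \<inter> B"] small_in_M by simp
  then show ?thesis
    by (rule mem_P_if_ind_self[OF assms(6), rotated 2]) (use very_small_subset[OF assms(2)] in auto)
qed

text \<open>
  The back-and-forth system: elementary relations, respecting \<open>P\<close>, between very small
  P-independent subsets of \<open>M\<close>.
\<close>

definition BF :: "'a rel set" where
  "BF = {R. elem_rel L C R \<and> very_small (Domain R) \<and> very_small (Range R) \<and> Pind (Domain R) \<and> Pind (Range R) \<and>
     (\<forall>x y. (x, y) \<in> R \<longrightarrow> (x \<in> P \<longleftrightarrow> y \<in> P))}"

lemma BF_converse: "R \<in> BF \<Longrightarrow> R\<inverse> \<in> BF"
  by (auto simp: BF_def elem_rel_converse)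

lemma very_small_Range: "elem_rel L C R \<Longrightarrow> very_small (Domain R) \<Longrightarrow> Range R \<subseteq> M \<Longrightarrow> very_small (Range R)"
proof -
  assume R: "elem_rel L C R" "very_small (Domain R)" "Range R \<subseteq> M"
  obtain \<sigma> where "\<sigma> ` Domain R = Range R"
    by (rule extend_to_automorphism[OF R(1) very_small_small[OF R(2)]])
  then have "|Range R| \<le>o |Domain R|" using card_of_image by metis
  then show ?thesis using R ordLeq_ordLess_trans by (auto simp: very_small_def)
qed

lemma BF_Un_free:
  assumes R: "R \<in> BF" and S: "elem_rel L C (R \<union> S)" "finite S" "Domain S \<subseteq> M" "Range S \<subseteq> M"
    and ind: "ind (Domain S) (Domain R) P" "ind (Range S) (Range R) P"
  shows "R \<union> S \<in> BF"
proof -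
  have R': "very_small (Domain R)" "very_small (Range R)" "Pind (Domain R)" "Pind (Range R)" "elem_rel L C R"
    "\<And>x y. (x, y) \<in> R \<Longrightarrow> x \<in> P \<longleftrightarrow> y \<in> P"
    using R by (auto simp: BF_def)
  have dom: "Domain (R \<union> S) = Domain R \<union> Domain S" "Range (R \<union> S) = Range R \<union> Range S" by auto
  have "finite (Domain S)" "finite (Range S)" using S(2) by (auto simp: finite_Domain finite_Range)
  then have "very_small (Domain (R \<union> S))" "very_small (Range (R \<union> S))"
    unfolding dom using R' S very_small_Un very_small_finite by auto
  moreover have "Pind (Domain (R \<union> S))" "Pind (Range (R \<union> S))"
    unfolding dom using Pind_Un_ind R' S ind very_small_M by auto
  moreover have "x \<in> P \<longleftrightarrow> y \<in> P" if xy: "(x, y) \<in> S" for x y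
  proof -
    have xM: "x \<in> M" "y \<in> M" using xy S by auto
    have e1: "elem_rel L C (insert (x, y) R)" by (rule elem_rel_subset[OF S(1)]) (use xy in auto)
    have e2: "elem_rel L C (insert (y, x) (R\<inverse>))"
      by (rule elem_rel_subset[OF elem_rel_converse[OF e1]]) auto
    have i1: "ind {x} (Domain R) P"
      by (rule ind_mono_left[OF ind(1)]) (use xy S very_small_small R' in auto)
    have i2: "ind {y} (Range R) P"
      by (rule ind_mono_left[OF ind(2)]) (use xy S very_small_small R' in auto)
    show ?thesis
    proof
      assume "y \<in> P"
      show "x \<in> P"
        by (rule mem_P_transfer[OF e1 R'(1) very_small_M[OF R'(2)] R'(4) R'(6) xM(1) \<open>y \<in> P\<close> i2])
    next
      assume "x \<in> P"
      show "y \<in> P"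
        by (rule mem_P_transfer[OF e2 _ _ _ _ xM(2) \<open>x \<in> P\<close>])
          (use R' very_small_M[OF R'(1)] i1 in auto)
    qed
  qed
  ultimately show ?thesis using S(1) R'(6) by (auto simp: BF_def)
qed

lemma BF_Un_P_subset:
  assumes R: "R \<in> BF" and S: "elem_rel L C (R \<union> S)" "Domain S \<subseteq> P" "very_small (Domain S)" "Range S \<subseteq> P"
  shows "R \<union> S \<in> BF"
proof -
  have R': "very_small (Domain R)" "very_small (Range R)" "Pind (Domain R)" "Pind (Range R)"
    "\<And>x y. (x, y) \<in> R \<Longrightarrow> x \<in> P \<longleftrightarrow> y \<in> P"
    using R by (auto simp: BF_def)
  have dom: "Domain (R \<union> S) = Domain R \<union> Domain S" "Range (R \<union> S) = Range R \<union> Range S" by auto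
  have "very_small (Domain (R \<union> S))" unfolding dom by (rule very_small_Un[OF R'(1) S(3)])
  moreover from this have "very_small (Range (R \<union> S))"
    by (rule very_small_Range[OF S(1)]) (use dom S(4) R'(2) P_M in \<open>auto simp: very_small_def\<close>)
  moreover have "Pind (Domain (R \<union> S))" "Pind (Range (R \<union> S))"
    unfolding dom using Pind_Un_P R' S very_small_M by auto
  moreover have "x \<in> P \<longleftrightarrow> y \<in> P" if "(x, y) \<in> R \<union> S" for x y
    using that R'(5) S(2,4) by blast
  ultimately show ?thesis using S(1) by (auto simp: BF_def)
qed

lemma BF_Un_P:
  assumes R: "R \<in> BF" and D: "D \<subseteq> P" "very_small D"
  obtains S where "R \<union> S \<in> BF" "Domain S = D" "Range S \<subseteq> P"
proof -
  define B where "B = Range R"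
  have R': "very_small (Domain R)" "very_small B" "Pind (Domain R)" "Pind B" "elem_rel L C R"
    "\<And>x y. (x, y) \<in> R \<Longrightarrow> x \<in> P \<longleftrightarrow> y \<in> P"
    using R by (auto simp: BF_def B_def)
  obtain \<sigma> where \<sigma>: "automorphism L C \<sigma>" "\<And>a b. (a, b) \<in> R \<Longrightarrow> \<sigma> a = b" "\<sigma> ` Domain R = Range R"
    by (rule extend_to_automorphism[OF R'(5) very_small_small[OF R'(1)]]) blast
  have sm: "sm (Domain R)" "sm D" "sm (P \<inter> Domain R)"
    using very_small_small[OF R'(1)] very_small_small[OF D(2)] by auto
  have "ind (Domain R) (P \<inter> Domain R) P" using R'(3) by (simp add: P_independent_def)
  then have "ind (Domain R) (P \<inter> Domain R) D"
    by (rule ind_mono) (use sm D in auto)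
  then have "ind D (P \<inter> Domain R) (Domain R)" using ind_sym sm by blast
  then have "ind (\<sigma> ` D) (\<sigma> ` (P \<inter> Domain R)) B"
    using ind_invariant[OF \<sigma>(1)] \<sigma>(3) sm by (metis B_def)
  moreover have "\<sigma> ` (P \<inter> Domain R) = P \<inter> B"
    using image_P_Domain[of R \<sigma>] \<sigma>(2) R'(6) by (simp add: B_def)
  moreover have "|\<sigma> ` D| <o \<kappa>" using D(2) ordLeq_ordLess_trans[OF card_of_image] by (auto simp: very_small_def)
  ultimately obtain S where S: "elem_rel L C (Id_on B \<union> S)" "Domain S = \<sigma> ` D" "Range S \<subseteq> P"
    using density_set[OF R'(2) small_image[OF \<sigma>(1) sm(2)]] by metis
  define S' where "S' = {(d, s). d \<in> D \<and> (\<sigma> d, s) \<in> S}"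
  have dom: "Domain S' = D" "Range S' \<subseteq> P" using S(2,3) by (auto simp: S'_def)
  have e: "elem_rel L C (R \<union> S')"
  proof (rule elem_rel_via_automorphism[OF \<sigma>(1,2) S(1)])
    show "Domain R \<subseteq> Univ C" "Domain S' \<subseteq> Univ C" using sm dom by (auto simp: small_def)
  qed (auto simp: B_def S'_def)
  have "R \<union> S' \<in> BF"
    by (rule BF_Un_P_subset[OF R e]) (use dom D in auto)
  then show thesis using that dom by blast
qed

text \<open>Only a very small part of \<open>P\<close> is needed to make a finite set independent from \<open>P\<close> over \<open>B\<close>.\<close>

lemma ex_base_in_P:
  assumes "very_small B" "finite X" "X \<subseteq> M"
  obtains D where "D \<subseteq> P" "very_small D" "ind X (B \<union> D) P"
proof -
  have BP: "B \<union> P \<subseteq> M" using very_small_M[OF assms(1)] P_M by auto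
  have "X \<subseteq> Univ C" using assms(3) M_Univ by blast
  then obtain B0 where B0: "B0 \<subseteq> B \<union> P" "|B0| <o \<kappa>" "ind X B0 (B \<union> P)"
    using ind_local[OF assms(2), of "B \<union> P"] small_in_M[OF BP] by metis
  define D where "D = B0 \<inter> P"
  have "very_small B0" using B0 BP by (auto simp: very_small_def)
  then have D: "D \<subseteq> P" "very_small D" using very_small_subset by (auto simp: D_def)
  have "ind X (B \<union> D) (B \<union> P)"
    by (rule ind_base_mono[OF B0(3)])
      (use B0(1) BP assms(3) small_in_M[OF subset_trans[OF B0(1) BP]] in \<open>auto simp: D_def\<close>)
  then have "ind X (B \<union> D) P"
    by (rule ind_mono) (use BP D assms(3) in auto)
  then show thesis using that D by blast
qed

text \<open>
  To add \<open>b\<close> to the domain, a very small part of \<open>P\<close> over which \<open>b\<close> is independent from \<open>P\<close> is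
  added by density; then \<open>b\<close> itself is added by extension.
\<close>

lemma BF_forth:
  assumes R: "R \<in> BF" and b: "b \<in> M"
  obtains R' where "R' \<in> BF" "R \<subseteq> R'" "b \<in> Domain R'"
proof -
  have "very_small (Domain R)" using R by (simp add: BF_def)
  then obtain D where D: "D \<subseteq> P" "very_small D" "ind {b} (Domain R \<union> D) P"
    using ex_base_in_P[of "Domain R" "{b}"] b by auto
  obtain S where S: "R \<union> S \<in> BF" "Domain S = D" by (rule BF_Un_P[OF R D(1,2)])
  let ?R = "R \<union> S"
  have e: "elem_rel L C ?R" "very_small (Domain ?R)" "very_small (Range ?R)" using S(1) by (auto simp: BF_def)
  obtain \<sigma> where \<sigma>: "automorphism L C \<sigma>" "\<And>a c. (a, c) \<in> ?R \<Longrightarrow> \<sigma> a = c"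
    by (rule extend_to_automorphism[OF e(1) very_small_small[OF e(2)]]) blast
  have "\<sigma> b \<in> Univ C" using automorphism_in_Univ[OF \<sigma>(1)] b M_Univ by blast
  then obtain c where c: "c \<in> M" "ind {c} (Range ?R) P"
    "elem_rel L C (insert (\<sigma> b, c) (Id_on (Range ?R)))"
    using extension[OF e(3)] by metis
  have "elem_rel L C (?R \<union> {(b, c)})"
    by (rule elem_rel_via_automorphism[OF \<sigma> c(3)]) (use elem_rel_Domain_Univ[OF e(1)] b M_Univ in auto)
  then have "?R \<union> {(b, c)} \<in> BF"
    by (rule BF_Un_free[OF S(1)])
      (use b c(1,2) D(3) S(2) in \<open>auto simp: Domain_Un_eq\<close>)
  then show thesis using that[of "?R \<union> {(b, c)}"] by auto
qed

lemma BF_forth_set: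
  assumes "R \<in> BF" "finite X" "X \<subseteq> M"
  obtains R' where "R' \<in> BF" "R \<subseteq> R'" "X \<subseteq> Domain R'"
proof -
  have "\<exists>R'\<in>BF. R \<subseteq> R' \<and> X \<subseteq> Domain R'"
    using assms(2,3)
  proof (induction X)
    case (insert b X)
    then obtain R1 where R1: "R1 \<in> BF" "R \<subseteq> R1" "X \<subseteq> Domain R1" by auto
    moreover obtain R2 where "R2 \<in> BF" "R1 \<subseteq> R2" "b \<in> Domain R2"
      using BF_forth[OF R1(1), of b] insert.prems by auto
    moreover from this have "Domain R1 \<subseteq> Domain R2" by (intro Domain_mono)
    ultimately show ?case by (intro bexI[of _ R2]) auto
  qed (use assms(1) in auto)
  then show thesis using that by blast
qed

end


section \<open>Expansions of structures\<close>

text \<open>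
  \<open>N'\<close> expands \<open>N\<close>, the relation symbols of \<open>N\<close> being renamed by \<^const>\<open>Some\<close>. The language of
  \<open>N'\<close> may also have new sorts and function symbols. The interpretations of sorts and function
  symbols are required to agree outright, as is the case for pairs and for their imaginaries.
\<close>

definition expansion ::
  "('s, 'f, 'r) lang \<Rightarrow> ('s, 'f, 'r, 'a) struc \<Rightarrow> ('s, 'f, 'r option) lang \<Rightarrow>
   ('s, 'f, 'r option, 'a) struc \<Rightarrow> bool" where
  "expansion K N K' N' \<longleftrightarrow> Sorts K \<subseteq> Sorts K' \<and> Funs K \<subseteq> Funs K' \<and> fdom K' = fdom K \<and> fcod K' = fcod K \<and>
     (\<forall>r\<in>Rels K. Some r \<in> Rels K' \<and> rdom K' (Some r) = rdom K r) \<and>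
     Dom N' = Dom N \<and> Fint N' = Fint N \<and> (\<forall>r. Rint N' (Some r) = Rint N r)"

lemma expansion_eval:
  assumes "Fint N' = Fint N"
  shows "eval N' v t = eval N v t"
proof (induction t)
  case (Fn f ts)
  then have "map (eval N' v) ts = map (eval N v) ts" by simp
  then show ?case using assms by (simp only: eval.simps)
qed simp

lemma expansion_sort_of: "fcod K' = fcod K \<Longrightarrow> sort_of K' t = sort_of K t"
  by (cases t) auto

lemma expansion_wf_tm:
  assumes "expansion K N K' N'"
  shows "wf_tm K t \<Longrightarrow> wf_tm K' t"
proof (induction t)
  case (Fn f ts)
  have "map (sort_of K') ts = map (sort_of K) ts"
    using assms expansion_sort_of by (auto simp: expansion_def)
  then show ?case using Fn assms by (auto simp: expansion_def list_all_iff simp del: map_eq_conv)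
qed (use assms in \<open>auto simp: expansion_def\<close>)

lemma expansion_fm:
  fixes \<phi> :: "('s, 'f, 'r) fm" and N :: "('s, 'f, 'r, 'a) struc"
  assumes "expansion K N K' N'"
  shows "wf_fm K \<phi> \<Longrightarrow> wf_fm K' (map_fm id id Some \<phi>)"
    and "fv (map_fm id id Some \<phi>) = fv \<phi>"
    and "sat N' v (map_fm id id Some \<phi>) \<longleftrightarrow> sat N v \<phi>"
proof -
  have sort: "sort_of K' = (sort_of K :: ('s, 'f) tm \<Rightarrow> 's)"
    using assms by (auto simp: expansion_def fun_eq_iff intro!: expansion_sort_of)
  show "wf_fm K \<phi> \<Longrightarrow> wf_fm K' (map_fm id id Some \<phi>)"
    by (induction \<phi>)
      (use assms expansion_wf_tm[OF assms] in \<open>auto simp: comp_def expansion_def sort tm.map_id tm.map_ident prod.map_id prod.map_ident list_all_iff\<close>)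
  show "fv (map_fm id id Some \<phi>) = fv \<phi>"
    by (induction \<phi>) (auto simp: tm.map_id tm.map_ident prod.map_id prod.map_ident)
  have eval: "eval N' = (eval N :: ('s var \<Rightarrow> 'a) \<Rightarrow> ('s, 'f) tm \<Rightarrow> 'a)"
    using assms expansion_eval[of N' N] by (simp add: expansion_def fun_eq_iff)
  show "sat N' v (map_fm id id Some \<phi>) \<longleftrightarrow> sat N v \<phi>"
    by (induction \<phi> arbitrary: v) (use assms in \<open>auto simp: comp_def expansion_def eval tm.map_id tm.map_ident prod.map_id prod.map_ident\<close>)
qed

lemma expansion_pair: "expansion L (restr C M) (lang2 L) (pair C M P)"
  by (auto simp: expansion_def lang2_def pair_def restr_def)

lemma eq_sorts_expansion:
  assumes "expansion L N L' N'"
  shows "eq_sorts L N \<subseteq> eq_sorts L' N'"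
proof -
  have "definable_equiv L' N' n E" if E: "definable_equiv L N n E" for n E
  proof -
    obtain \<phi> where \<phi>: "wf_fm L \<phi>" "fv \<phi> \<subseteq> UNIV \<times> {..<2 * n}"
      "E = {(xs, ys) \<in> tuples (Univ N) n \<times> tuples (Univ N) n. sat N (\<lambda>(_, i). (xs @ ys) ! i) \<phi>}"
      using E by (auto simp: definable_equiv_def)
    have "Univ N' = Univ N" using assms by (simp add: expansion_def)
    then show ?thesis
      using E \<phi> expansion_fm[OF assms, where \<phi>=\<phi>] unfolding definable_equiv_def
      by (intro conjI exI[of _ "map_fm id id Some \<phi>"]) simp_all
  qed
  then show ?thesis by (auto simp: eq_sorts_def)
qed

lemma expansion_eq:
  assumes "expansion L N L' N'"
  shows "expansion (lang_eq L N) (struc_eq N) (lang_eq L' N') (struc_eq N')"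
proof -
  have "Dom N' = Dom N" "Fint N' = Fint N" "Funs L \<subseteq> Funs L'" "fdom L' = fdom L"
    "\<forall>r\<in>Rels L. Some r \<in> Rels L' \<and> rdom L' (Some r) = rdom L r" "\<forall>r. Rint N' (Some r) = Rint N r"
    using assms by (auto simp: expansion_def)
  then show ?thesis
    using eq_sorts_expansion[OF assms] by (auto simp: expansion_def lang_eq_def struc_eq_def Let_def)
qed

lemma param_fms_expansion:
  assumes "expansion K N K' N'" "(\<phi>, v) \<in> param_fms K N s A"
  shows "(map_fm id id Some \<phi>, v) \<in> param_fms K' N' s A"
    and "solves N' s b (map_fm id id Some \<phi>, v) \<longleftrightarrow> solves N s b (\<phi>, v)"
proof -
  have "Dom N' = Dom N" using assms(1) by (simp add: expansion_def)
  then show "(map_fm id id Some \<phi>, v) \<in> param_fms K' N' s A"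
    and "solves N' s b (map_fm id id Some \<phi>, v) \<longleftrightarrow> solves N s b (\<phi>, v)"
    using assms expansion_fm[OF assms(1), where \<phi>=\<phi>] by (auto simp: param_fms_def solves_def)
qed

lemma acl_expansion:
  assumes "expansion K N K' N'"
  shows "acl K N A \<subseteq> acl K' N' A"
proof
  fix e assume "e \<in> acl K N A"
  then obtain s \<phi> v where "s \<in> Sorts K" "(\<phi>, v) \<in> param_fms K N s A"
    "solves N s e (\<phi>, v)" "finite {b. solves N s b (\<phi>, v)}"
    unfolding acl_def by auto
  moreover have "Sorts K \<subseteq> Sorts K'" using assms by (simp add: expansion_def)
  ultimately show "e \<in> acl K' N' A"
    using param_fms_expansion[OF assms] unfolding acl_def
    by (intro CollectI bexI[of _ s] bexI[of _ "(map_fm id id Some \<phi>, v)"]) auto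
qed

lemma dcl_expansion:
  assumes "expansion K N K' N'"
  shows "dcl K N A \<subseteq> dcl K' N' A"
proof
  fix e assume "e \<in> dcl K N A"
  then obtain s \<phi> v where "s \<in> Sorts K" "(\<phi>, v) \<in> param_fms K N s A"
    "{b. solves N s b (\<phi>, v)} = {e}"
    unfolding dcl_def by auto
  moreover have "Sorts K \<subseteq> Sorts K'" using assms by (simp add: expansion_def)
  ultimately show "e \<in> dcl K' N' A"
    using param_fms_expansion[OF assms] unfolding dcl_def
    by (intro CollectI bexI[of _ s] bexI[of _ "(map_fm id id Some \<phi>, v)"]) auto
qed

lemma sort_of_lang2: "sort_of (lang2 L) = sort_of L"
  by (rule ext, rule expansion_sort_of) (simp add: lang2_def)

lemma wf_tm_lang2: "wf_tm (lang2 L) t \<longleftrightarrow> wf_tm L t"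
proof (induction t)
  case (Fn f ts)
  then show ?case using sort_of_lang2[of L] by (auto simp: lang2_def list_all_iff)
qed (simp add: lang2_def)

section \<open>Imaginaries in a one-sorted structure\<close>

lemma home_sort_eq_sorts:
  assumes "one_sorted L"
  shows "home_sort (Univ N) \<in> eq_sorts L N"
proof -
  have "equiv (tuples (Univ N) 1) (Id_on (tuples (Univ N) 1))"
    by (auto simp: equiv_def refl_on_def sym_def trans_def)
  moreover have "Id_on (tuples (Univ N) 1) = {(xs, ys) \<in> tuples (Univ N) 1 \<times> tuples (Univ N) 1.
    sat N (\<lambda>(_, i). (xs @ ys) ! i) (Eq (Var ((), 0)) (Var ((), 1)))}"
    by (auto simp: tuples_def length_Suc_conv nth_append)
  ultimately show ?thesis
    using assms unfolding eq_sorts_def home_sort_def definable_equiv_def one_sorted_def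
    by (auto intro!: exI[of _ "Eq (Var ((), 0)) (Var ((), 1))"])
qed

lemma unhome_home [simp]: "unhome (home M a) = a"
  by (simp add: unhome_def home_def)

lemma home_sort_class: "a \<in> M \<Longrightarrow> Id_on (tuples M (Suc 0)) `` {[a]} = {[a]}"
  by (auto simp: tuples_def)

lemma Dom_home: "Dom (struc_eq N) (home_sort (Univ N)) = home (Univ N) ` Univ N"
proof -
  have "tuples (Univ N) 1 // Id_on (tuples (Univ N) 1) = (\<lambda>a. {[a]}) ` Univ N"
    by (auto simp: quotient_def tuples_def length_Suc_conv image_iff)
  then show ?thesis by (auto simp: struc_eq_def home_sort_def home_def image_iff)
qed

lemma Dom_eq: "Dom (struc_eq N) (n, E) = (\<lambda>xs. ((n, E), E `` {xs})) ` tuples (Univ N) n"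
  by (auto simp: struc_eq_def quotient_def)

lemma Univ_pair [simp]: "Univ (pair C M P) = M" and Univ_restr [simp]: "Univ (restr C M) = M"
  by (auto simp: pair_def restr_def)

section \<open>Preservation of formulas in the pair and in its imaginaries\<close>

context lovely begin

abbreviation N where "N \<equiv> pair C M P"
abbreviation L2 where "L2 \<equiv> lang2 L"

lemma BF_D: "R \<in> BF \<Longrightarrow> elem_rel L C R" "R \<in> BF \<Longrightarrow> (x, y) \<in> R \<Longrightarrow> x \<in> P \<longleftrightarrow> y \<in> P"
  "R \<in> BF \<Longrightarrow> (x, y) \<in> R \<Longrightarrow> x \<in> M \<and> y \<in> M"
  by (auto simp: BF_def very_small_def)

lemma eval_N: "eval N v t = eval C v t"
  by (rule expansion_eval) (simp add: pair_def)

lemma eval_in_M: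
  assumes "wf_tm L t" "\<And>x. x \<in> tm_vars t \<Longrightarrow> v x \<in> M"
  shows "eval C v t \<in> M"
proof -
  have "is_struc L (restr C M)" using M_C by (simp add: elementary_substructure_def)
  then have "eval (restr C M) v t \<in> Univ (restr C M)"
    using eval_in_Dom[of L "restr C M" t v] assms by simp
  moreover have "eval (restr C M) v t = eval C v t" by (rule expansion_eval) (simp add: restr_def)
  ultimately show ?thesis by simp
qed

lemma BF_eval:
  assumes R: "R \<in> BF" and t: "wf_tm L t" "\<And>x. x \<in> tm_vars t \<Longrightarrow> (v x, w x) \<in> R"
  obtains R' where "R' \<in> BF" "R \<subseteq> R'" "(eval C v t, eval C w t) \<in> R'"
proof -
  have "eval C v t \<in> M" by (rule eval_in_M[OF t(1)]) (use t(2) BF_D(3)[OF R] in blast)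
  then obtain R' where R': "R' \<in> BF" "R \<subseteq> R'" "eval C v t \<in> Domain R'"
    by (rule BF_forth[OF R])
  then obtain b where b: "(eval C v t, b) \<in> R'" by blast
  have "finite (snd ` tm_vars t)" by (simp add: finite_tm_vars)
  then obtain k where "k \<notin> snd ` tm_vars t" using ex_new_if_finite infinite_UNIV_nat by blast
  then have z: "((), k) \<notin> tm_vars t" by force
  let ?\<phi> = "Eq (Var ((), k)) t"
  have "sat C (v(((), k) := eval C v t)) ?\<phi> \<longleftrightarrow> sat C (w(((), k) := b)) ?\<phi>"
    by (rule elem_relD[OF BF_D(1)[OF R'(1)]])
      (use t one_sorted b R'(2) in \<open>auto simp: one_sorted_def\<close>)
  moreover have "eval C (v(((), k) := eval C v t)) t = eval C v t" "eval C (w(((), k) := b)) t = eval C w t"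
    by (rule eval_cong; use z in auto)+
  ultimately have "b = eval C w t" by simp
  then show thesis using that[OF R'(1,2)] b by simp
qed

text \<open>The back-and-forth system preserves the formulas of \<open>L\<^sup>2\<close>.\<close>

lemma BF_sat:
  "wf_fm L2 \<phi> \<Longrightarrow> R \<in> BF \<Longrightarrow> (\<And>x. x \<in> fv \<phi> \<Longrightarrow> (v x, w x) \<in> R) \<Longrightarrow> sat N v \<phi> \<longleftrightarrow> sat N w \<phi>"
proof (induction \<phi> arbitrary: v w R)
  case (Eq t u)
  have "sat C v (Eq t u) \<longleftrightarrow> sat C w (Eq t u)"
    by (rule elem_relD[OF BF_D(1)[OF Eq.prems(2)]]) (use Eq in \<open>simp_all add: wf_tm_lang2\<close>)
  then show ?case by (simp add: eval_N)
next
  case (Rel r ts)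
  show ?case
  proof (cases r)
    case None
    then have "length ts = 1" using Rel.prems(1) by (simp add: lang2_def) (metis length_map length_Cons list.size(3))
    then obtain t where t: "ts = [t]" by (auto simp: length_Suc_conv)
    have wf: "wf_tm L t" using Rel.prems(1) t by (simp add: wf_tm_lang2)
    have vars: "(v x, w x) \<in> R" if "x \<in> tm_vars t" for x using Rel.prems(3)[of x] that t by simp
    obtain R' where "R' \<in> BF" "(eval C v t, eval C w t) \<in> R'"
      by (rule BF_eval[OF Rel.prems(2) wf vars])
    then have "eval C v t \<in> P \<longleftrightarrow> eval C w t \<in> P" using BF_D(2) by blast
    moreover have "Rint N None [a] \<longleftrightarrow> a \<in> P" for a by (simp add: pair_def)
    ultimately show ?thesis by (simp add: None t eval_N)
  next
    case (Some r')
    have "r' \<in> Rels L" "rdom L2 r = rdom L r'" using Rel.prems(1) Some by (auto simp: lang2_def)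
    then have "wf_fm L (Rel r' ts)"
      using Rel.prems(1) by (simp add: list_all_iff wf_tm_lang2 sort_of_lang2)
    then have "sat C v (Rel r' ts) \<longleftrightarrow> sat C w (Rel r' ts)"
      by (rule elem_relD[OF BF_D(1)[OF Rel.prems(2)]]) (use Rel.prems(3) in simp)
    moreover have "eval N = eval C" by (simp add: fun_eq_iff eval_N)
    ultimately show ?thesis by (simp add: Some) (simp add: pair_def)
  qed
next
  case (Neg \<phi>)
  have "sat N v \<phi> \<longleftrightarrow> sat N w \<phi>" by (rule Neg.IH) (use Neg.prems in auto)
  then show ?case by simp
next
  case (Conj \<phi> \<psi>)
  have "sat N v \<phi> \<longleftrightarrow> sat N w \<phi>" by (rule Conj.IH(1)) (use Conj.prems in auto)
  moreover have "sat N v \<psi> \<longleftrightarrow> sat N w \<psi>" by (rule Conj.IH(2)) (use Conj.prems in auto)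
  ultimately show ?case by simp
next
  case (Ex x \<phi>)
  have *: "\<exists>c\<in>M. sat N (w(x := c)) \<phi>"
    if R: "R \<in> BF" "\<forall>y\<in>fv (Ex x \<phi>). (v y, w y) \<in> R" and b: "b \<in> M" "sat N (v(x := b)) \<phi>"
    for R v w b
  proof -
    obtain R' where R': "R' \<in> BF" "R \<subseteq> R'" "b \<in> Domain R'" by (rule BF_forth[OF R(1) b(1)])
    then obtain c where c: "(b, c) \<in> R'" by blast
    have "sat N (v(x := b)) \<phi> \<longleftrightarrow> sat N (w(x := c)) \<phi>"
      by (rule Ex.IH[OF _ R'(1)]) (use Ex.prems(1) R(2) R'(2) c in auto)
    then show ?thesis using b(2) c BF_D(3)[OF R'(1)] by blast
  qed
  have "(\<exists>b\<in>M. sat N (v(x := b)) \<phi>) \<longleftrightarrow> (\<exists>b\<in>M. sat N (w(x := b)) \<phi>)"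
  proof
    show "(\<exists>b\<in>M. sat N (v(x := b)) \<phi>) \<Longrightarrow> (\<exists>b\<in>M. sat N (w(x := b)) \<phi>)"
      using *[OF Ex.prems(2), of v w] Ex.prems(3) by blast
    show "(\<exists>b\<in>M. sat N (w(x := b)) \<phi>) \<Longrightarrow> (\<exists>b\<in>M. sat N (v(x := b)) \<phi>)"
      using *[OF BF_converse[OF Ex.prems(2)], of w v] Ex.prems(3) by blast
  qed
  then show ?case by (cases x) simp
qed

text \<open>The relation induced by \<open>R\<close> on imaginary elements.\<close>

definition req :: "'a rel \<Rightarrow> 'a imag \<Rightarrow> 'a imag \<Rightarrow> bool" where
  "req R e e' \<longleftrightarrow> (\<exists>n E xs ys. (n, E) \<in> eq_sorts L2 N \<and> length xs = n \<and> length ys = n \<and>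
     set (zip xs ys) \<subseteq> R \<and> e = ((n, E), E `` {xs}) \<and> e' = ((n, E), E `` {ys}))"

lemma req_mono: "req R e e' \<Longrightarrow> R \<subseteq> R' \<Longrightarrow> req R' e e'"
  unfolding req_def by blast

lemma req_fst: "req R e e' \<Longrightarrow> fst e' = fst e"
  unfolding req_def by auto

lemma req_converse: "req R e e' \<Longrightarrow> req (R\<inverse>) e' e"
proof -
  assume "req R e e'"
  then obtain n E xs ys where *: "(n, E) \<in> eq_sorts L2 N" "length xs = n" "length ys = n"
    "set (zip xs ys) \<subseteq> R" "e = ((n, E), E `` {xs})" "e' = ((n, E), E `` {ys})"
    unfolding req_def by blast
  have "set (zip ys xs) \<subseteq> R\<inverse>" using *(4) by (auto simp: zip_commute[of ys])
  then show ?thesis unfolding req_def using * by blast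
qed

lemma zip_in_M:
  assumes "R \<in> BF" "set (zip xs ys) \<subseteq> R" "length xs = n" "length ys = n"
  shows "xs \<in> tuples M n" "ys \<in> tuples M n"
proof -
  have "R \<subseteq> M \<times> M" using BF_D(3)[OF assms(1)] by auto
  then show "xs \<in> tuples M n" "ys \<in> tuples M n" using zip_in_tuples[OF assms(2) _ assms(3,4)] by auto
qed

lemma BF_equiv:
  assumes R: "R \<in> BF" and E: "(n, E) \<in> eq_sorts L2 N"
    and xs: "length xs = n" "length ys = n" "set (zip xs ys) \<subseteq> R"
    and us: "length us = n" "length ws = n" "set (zip us ws) \<subseteq> R"
  shows "(xs, us) \<in> E \<longleftrightarrow> (ys, ws) \<in> E"
proof -
  obtain \<phi> where \<phi>: "wf_fm L2 \<phi>" "fv \<phi> \<subseteq> UNIV \<times> {..<2 * n}"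
    "E = {(xs, ys) \<in> tuples M n \<times> tuples M n. sat N (\<lambda>(_, i). (xs @ ys) ! i) \<phi>}"
    using E by (auto simp: eq_sorts_def definable_equiv_def)
  have "sat N (\<lambda>(_, i). (xs @ us) ! i) \<phi> \<longleftrightarrow> sat N (\<lambda>(_, i). (ys @ ws) ! i) \<phi>"
  proof (rule BF_sat[OF \<phi>(1) R])
    fix x assume "x \<in> fv \<phi>"
    then obtain i where i: "x = ((), i)" "i < 2 * n" using \<phi>(2) by (cases x) auto
    show "((\<lambda>(_, i). (xs @ us) ! i) x, (\<lambda>(_, i). (ys @ ws) ! i) x) \<in> R"
      using zip_append_nth_mem[OF xs(3) us(3) xs(1,2) us(1,2) i(2)] i(1) by simp
  qed
  then show ?thesis
    using \<phi>(3) zip_in_M[OF R xs(3,1,2)] zip_in_M[OF R us(3,1,2)] by auto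
qed

lemma req_home:
  assumes "R \<in> BF" "(x, y) \<in> R"
  shows "req R (home M x) (home M y)"
proof -
  have "home_sort M \<in> eq_sorts L2 N"
    using home_sort_eq_sorts[of L2 N] one_sorted by (simp add: one_sorted_def lang2_def)
  moreover have "x \<in> M" "y \<in> M" using BF_D(3)[OF assms] by auto
  ultimately show ?thesis using assms(2) unfolding req_def home_sort_def home_def
    by (intro exI[of _ 1] exI[of _ "Id_on (tuples M 1)"] exI[of _ "[x]"] exI[of _ "[y]"])
      (simp add: home_sort_class del: Image_Id_on)
qed

lemma req_homeD:
  assumes "R \<in> BF" "req R e e'" "fst e = home_sort M"
  shows "(unhome e, unhome e') \<in> R"
proof -
  obtain xs ys where *: "length xs = 1" "length ys = 1" "set (zip xs ys) \<subseteq> R"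
    "e = (home_sort M, Id_on (tuples M 1) `` {xs})" "e' = (home_sort M, Id_on (tuples M 1) `` {ys})"
    using assms(2,3) unfolding req_def home_sort_def by auto
  obtain x y where xy: "xs = [x]" "ys = [y]" using *(1,2) by (auto simp: length_Suc_conv)
  then have "(x, y) \<in> R" using *(3) by simp
  moreover from this have "x \<in> M" "y \<in> M" using BF_D(3)[OF assms(1)] by auto
  ultimately show ?thesis using * xy by (simp add: unhome_def home_sort_class del: Image_Id_on)
qed

text \<open>Related values of terms of the home sort are homes of related elements of \<open>M\<close>.\<close>

lemma zip_unhome:
  assumes "R \<in> BF" "\<And>t. t \<in> set ts \<Longrightarrow> req R (f t) (g t) \<and> fst (f t) = sort_of K t"
    and "map (sort_of K) ts = map (\<lambda>_. home_sort M) us"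
  shows "set (zip (map (unhome \<circ> f) ts) (map (unhome \<circ> g) ts)) \<subseteq> R"
proof -
  have "(unhome (f t), unhome (g t)) \<in> R" if t: "t \<in> set ts" for t
  proof -
    have "sort_of K t \<in> set (map (sort_of K) ts)" using t by simp
    then have "sort_of K t = home_sort M" unfolding assms(3) by auto
    then show ?thesis using req_homeD[OF assms(1)] assms(2)[OF t] by simp
  qed
  then show ?thesis by (auto simp: set_zip)
qed

lemma unit_map_const: "length xs = length ys \<Longrightarrow> map (\<lambda>_. ()) xs = ys"
  by (rule nth_equalityI) auto

text \<open>
  \<open>R\<close>-related assignments of imaginaries give related values to the term \<open>t\<close>, after an extension of
  \<open>R\<close>: the value of a function of \<open>L\<close> need not be in the domain of \<open>R\<close>.
\<close>

definition lifts :: "('a eq_sort var \<Rightarrow> 'a imag) \<Rightarrow> ('a eq_sort var \<Rightarrow> 'a imag) \<Rightarrow>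
    ('a eq_sort, 'f + 'a eq_sort) tm \<Rightarrow> bool" where
  "lifts v w t \<longleftrightarrow> (\<forall>R\<in>BF. (\<forall>x\<in>tm_vars t. req R (v x) (w x) \<and> fst (v x) = fst x) \<longrightarrow>
     (\<exists>R'\<in>BF. R \<subseteq> R' \<and> req R' (eval (struc_eq N) v t) (eval (struc_eq N) w t) \<and>
       fst (eval (struc_eq N) v t) = sort_of (lang_eq L2 N) t))"

lemma lifts_list:
  assumes "R \<in> BF" "\<forall>t\<in>set ts. lifts v w t"
    and "\<forall>t\<in>set ts. \<forall>x\<in>tm_vars t. req R (v x) (w x) \<and> fst (v x) = fst x"
  shows "\<exists>R'\<in>BF. R \<subseteq> R' \<and> (\<forall>t\<in>set ts. req R' (eval (struc_eq N) v t) (eval (struc_eq N) w t) \<and>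
    fst (eval (struc_eq N) v t) = sort_of (lang_eq L2 N) t)"
  using assms(2,3)
proof (induction ts)
  case Nil
  then show ?case using assms(1) by auto
next
  case (Cons u us)
  let ?ev = "eval (struc_eq N) v" and ?ew = "eval (struc_eq N) w" and ?K = "lang_eq L2 N"
  have "\<exists>R'\<in>BF. R \<subseteq> R' \<and> (\<forall>t\<in>set us. req R' (?ev t) (?ew t) \<and> fst (?ev t) = sort_of ?K t)"
    by (rule Cons.IH) (use Cons.prems in simp_all)
  then obtain R1 where R1: "R1 \<in> BF" "R \<subseteq> R1"
    "\<forall>t\<in>set us. req R1 (?ev t) (?ew t) \<and> fst (?ev t) = sort_of ?K t"
    by blast
  have "\<forall>x\<in>tm_vars u. req R (v x) (w x) \<and> fst (v x) = fst x" using Cons.prems(2) by simp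
  then have "\<forall>x\<in>tm_vars u. req R1 (v x) (w x) \<and> fst (v x) = fst x"
    using req_mono[OF _ R1(2)] by blast
  moreover have "lifts v w u" using Cons.prems(1) by simp
  ultimately have "\<exists>R2\<in>BF. R1 \<subseteq> R2 \<and> req R2 (?ev u) (?ew u) \<and> fst (?ev u) = sort_of ?K u"
    using R1(1) unfolding lifts_def by simp
  then obtain R2 where R2: "R2 \<in> BF" "R1 \<subseteq> R2" "req R2 (?ev u) (?ew u)" "fst (?ev u) = sort_of ?K u"
    by blast
  have "\<forall>t\<in>set (u # us). req R2 (?ev t) (?ew t) \<and> fst (?ev t) = sort_of ?K t"
    using R1(3) R2(3,4) req_mono[OF _ R2(2)] by simp
  then show ?case using R1(2) R2(1,2) by blast
qed

lemma lifts: "wf_tm (lang_eq L2 N) t \<Longrightarrow> lifts v w t"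
proof (induction t)
  case (Var x)
  then show ?case by (auto simp: lifts_def)
next
  case (Fn f ts)
  let ?ev = "eval (struc_eq N) v" and ?ew = "eval (struc_eq N) w" and ?K = "lang_eq L2 N"
  show ?case unfolding lifts_def
  proof (intro ballI impI)
    fix R assume R: "R \<in> BF" "\<forall>x\<in>tm_vars (Fn f ts). req R (v x) (w x) \<and> fst (v x) = fst x"
    have "\<forall>t\<in>set ts. lifts v w t" using Fn by (auto simp: list_all_iff)
    moreover have "\<forall>t\<in>set ts. \<forall>x\<in>tm_vars t. req R (v x) (w x) \<and> fst (v x) = fst x"
      using R(2) by simp
    ultimately obtain R1 where R1: "R1 \<in> BF" "R \<subseteq> R1"
      "\<forall>t\<in>set ts. req R1 (?ev t) (?ew t) \<and> fst (?ev t) = sort_of ?K t"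
      using lifts_list[OF R(1), of ts v w] by blast
    define xs where "xs = map (unhome \<circ> ?ev) ts"
    define ys where "ys = map (unhome \<circ> ?ew) ts"
    have len: "length xs = length ts" "length ys = length ts" by (simp_all add: xs_def ys_def)
    have zip: "set (zip xs ys) \<subseteq> R1" if "map (sort_of ?K) ts = map (\<lambda>_. home_sort M) us" for us :: "unit list"
      unfolding xs_def ys_def by (rule zip_unhome[OF R1(1) _ that]) (use R1(3) in blast)
    show "\<exists>R'\<in>BF. R \<subseteq> R' \<and> req R' (?ev (Fn f ts)) (?ew (Fn f ts)) \<and>
      fst (?ev (Fn f ts)) = sort_of ?K (Fn f ts)"
    proof (cases f)
      case (Inl g)
      have g: "g \<in> Funs L" using Fn.prems Inl by (auto simp: lang_eq_def Let_def lang2_def)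
      have sorts: "map (sort_of ?K) ts = map (\<lambda>_. home_sort M) (fdom L g)"
        using Fn.prems Inl by (simp add: lang_eq_def Let_def lang2_def)
      then have lts: "length ts = length (fdom L g)" by (metis length_map)
      have Rz: "set (zip xs ys) \<subseteq> R1" by (rule zip[OF sorts])
      let ?t = "Fn g (map (\<lambda>i. Var ((), i)) [0..<length ts]) :: (unit, 'f) tm"
      have wf: "wf_tm L ?t" using g one_sorted lts
        by (auto simp: one_sorted_def list_all_iff comp_def intro!: unit_map_const)
      have vars: "((\<lambda>(_, i). xs ! i) x, (\<lambda>(_, i). ys ! i) x) \<in> R1" if x: "x \<in> tm_vars ?t" for x
      proof -
        obtain i where "x = ((), i)" "i < length ts" using x by auto
        then show ?thesis using zip_nth_mem[OF Rz, of i] len by simp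
      qed
      obtain R2 where R2: "R2 \<in> BF" "R1 \<subseteq> R2"
        "(eval C (\<lambda>(_, i). xs ! i) ?t, eval C (\<lambda>(_, i). ys ! i) ?t) \<in> R2"
        by (rule BF_eval[OF R1(1) wf vars])
      have "map (\<lambda>i. xs ! i) [0..<length ts] = xs" "map (\<lambda>i. ys ! i) [0..<length ts] = ys"
        using len map_nth by metis+
      then have "(Fint C g xs, Fint C g ys) \<in> R2" using R2(3) by (simp add: comp_def)
      then have "req R2 (home M (Fint C g xs)) (home M (Fint C g ys))" by (rule req_home[OF R2(1)])
      moreover have "?ev (Fn f ts) = home M (Fint C g xs)" "?ew (Fn f ts) = home M (Fint C g ys)"
        by (simp_all add: Inl xs_def ys_def struc_eq_def) (simp_all add: pair_def)
      moreover have "sort_of ?K (Fn f ts) = home_sort M" by (simp add: Inl lang_eq_def Let_def)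
      ultimately show ?thesis using R2 R1(2) by (intro bexI[of _ R2]) (auto simp: home_def)
    next
      case (Inr s)
      obtain n E where s: "s = (n, E)" by (cases s)
      have E: "(n, E) \<in> eq_sorts L2 N" using Fn.prems Inr s by (auto simp: lang_eq_def Let_def)
      have sorts: "map (sort_of ?K) ts = replicate n (home_sort M)"
        using Fn.prems Inr s by (simp add: lang_eq_def Let_def)
      then have lts: "length ts = n" by (metis length_map length_replicate)
      have Rz: "set (zip xs ys) \<subseteq> R1"
        by (rule zip[of "replicate n ()"]) (simp add: sorts map_replicate_const)
      have "?ev (Fn f ts) = ((n, E), E `` {xs})" "?ew (Fn f ts) = ((n, E), E `` {ys})"
        by (simp_all add: Inr s xs_def ys_def struc_eq_def)
      moreover from this have "req R1 (?ev (Fn f ts)) (?ew (Fn f ts))"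
        unfolding req_def using E len lts Rz by blast
      moreover have "sort_of ?K (Fn f ts) = (n, E)" by (simp add: Inr s lang_eq_def Let_def)
      ultimately show ?thesis using R1(1,2) by (intro bexI[of _ R1]) auto
    qed
  qed
qed

text \<open>The back-and-forth system preserves the formulas about the imaginaries of the pair.\<close>

lemma BF_sat_eq:
  "wf_fm (lang_eq L2 N) \<phi> \<Longrightarrow> R \<in> BF \<Longrightarrow> (\<And>x. x \<in> fv \<phi> \<Longrightarrow> req R (v x) (w x) \<and> fst (v x) = fst x) \<Longrightarrow>
    sat (struc_eq N) v \<phi> \<longleftrightarrow> sat (struc_eq N) w \<phi>"
proof (induction \<phi> arbitrary: v w R)
  case (Eq t u)
  let ?ev = "eval (struc_eq N) v" and ?ew = "eval (struc_eq N) w" and ?K = "lang_eq L2 N"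
  have "\<forall>t'\<in>set [t, u]. \<forall>x\<in>tm_vars t'. req R (v x) (w x) \<and> fst (v x) = fst x"
    using Eq.prems(3) by simp
  moreover have "\<forall>t'\<in>set [t, u]. lifts v w t'" using lifts Eq.prems(1) by simp
  ultimately obtain R' where R': "R' \<in> BF"
    "\<forall>t'\<in>set [t, u]. req R' (?ev t') (?ew t') \<and> fst (?ev t') = sort_of ?K t'"
    using lifts_list[OF Eq.prems(2), of "[t, u]" v w] by blast
  obtain n E xs ys where t: "(n, E) \<in> eq_sorts L2 N" "length xs = n" "length ys = n" "set (zip xs ys) \<subseteq> R'"
    "?ev t = ((n, E), E `` {xs})" "?ew t = ((n, E), E `` {ys})"
    using R'(2) unfolding req_def by auto
  obtain n' E' us ws where u: "length us = n'" "length ws = n'" "set (zip us ws) \<subseteq> R'"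
    "?ev u = ((n', E'), E' `` {us})" "?ew u = ((n', E'), E' `` {ws})"
    using R'(2) unfolding req_def by auto
  have "fst (?ev t) = fst (?ev u)" using R'(2) Eq.prems(1) by simp
  then have nE: "n' = n" "E' = E" using t(5) u(4) by auto
  have equiv: "equiv (tuples M n) E" using t(1) by (simp add: eq_sorts_def definable_equiv_def)
  have "(xs, us) \<in> E \<longleftrightarrow> (ys, ws) \<in> E"
    using BF_equiv[OF R'(1) t(1-4)] u(1-3) nE by simp
  moreover have "xs \<in> tuples M n" "ys \<in> tuples M n" "us \<in> tuples M n" "ws \<in> tuples M n"
    using zip_in_M[OF R'(1) t(4,2,3)] zip_in_M[OF R'(1) u(3,1,2)] nE by auto
  ultimately have "E `` {xs} = E `` {us} \<longleftrightarrow> E `` {ys} = E `` {ws}"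
    using eq_equiv_class_iff[OF equiv] by simp
  then show ?case using t(5,6) u(4,5) nE by simp
next
  case (Rel r ts)
  let ?ev = "eval (struc_eq N) v" and ?ew = "eval (struc_eq N) w" and ?K = "lang_eq L2 N"
  have "\<forall>t\<in>set ts. \<forall>x\<in>tm_vars t. req R (v x) (w x) \<and> fst (v x) = fst x"
    using Rel.prems(3) by fastforce
  moreover have "\<forall>t\<in>set ts. lifts v w t" using lifts Rel.prems(1) by (simp add: list_all_iff)
  ultimately obtain R' where R': "R' \<in> BF"
    "\<forall>t\<in>set ts. req R' (?ev t) (?ew t) \<and> fst (?ev t) = sort_of ?K t"
    using lifts_list[OF Rel.prems(2), of ts v w] by blast
  define xs where "xs = map (unhome \<circ> ?ev) ts"
  define ys where "ys = map (unhome \<circ> ?ew) ts"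
  have len: "length xs = length ts" "length ys = length ts" by (simp_all add: xs_def ys_def)
  have r: "r \<in> Rels L2" using Rel.prems(1) by (simp add: lang_eq_def Let_def)
  have sorts: "map (sort_of ?K) ts = map (\<lambda>_. home_sort M) (rdom L2 r)"
    using Rel.prems(1) by (simp add: lang_eq_def Let_def)
  then have lts: "length ts = length (rdom L2 r)" by (metis length_map)
  have zip: "set (zip xs ys) \<subseteq> R'"
    unfolding xs_def ys_def by (rule zip_unhome[OF R'(1) _ sorts]) (use R'(2) in blast)
  let ?\<phi> = "Rel r (map (\<lambda>i. Var ((), i)) [0..<length ts]) :: (unit, 'f, 'r option) fm"
  have "wf_fm L2 ?\<phi>" using r one_sorted lts
    by (auto simp: one_sorted_def list_all_iff comp_def lang2_def intro!: unit_map_const)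
  then have "sat N (\<lambda>(_, i). xs ! i) ?\<phi> \<longleftrightarrow> sat N (\<lambda>(_, i). ys ! i) ?\<phi>"
  proof (rule BF_sat[OF _ R'(1)])
    fix x assume "x \<in> fv ?\<phi>"
    then obtain i where "x = ((), i)" "i < length ts" by auto
    then show "((\<lambda>(_, i). xs ! i) x, (\<lambda>(_, i). ys ! i) x) \<in> R'"
      using zip_nth_mem[OF zip, of i] len by simp
  qed
  moreover have "map (\<lambda>i. xs ! i) [0..<length ts] = xs" "map (\<lambda>i. ys ! i) [0..<length ts] = ys"
    using len map_nth by metis+
  ultimately have "Rint N r xs \<longleftrightarrow> Rint N r ys" by (simp add: comp_def)
  then show ?case by (simp add: struc_eq_def xs_def ys_def)
next
  case (Neg \<phi>)
  have "sat (struc_eq N) v \<phi> \<longleftrightarrow> sat (struc_eq N) w \<phi>"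
    by (rule Neg.IH[OF _ Neg.prems(2)]) (use Neg.prems in auto)
  then show ?case by simp
next
  case (Conj \<phi> \<psi>)
  have "sat (struc_eq N) v \<phi> \<longleftrightarrow> sat (struc_eq N) w \<phi>"
    by (rule Conj.IH(1)[OF _ Conj.prems(2)]) (use Conj.prems in auto)
  moreover have "sat (struc_eq N) v \<psi> \<longleftrightarrow> sat (struc_eq N) w \<psi>"
    by (rule Conj.IH(2)[OF _ Conj.prems(2)]) (use Conj.prems in auto)
  ultimately show ?case by simp
next
  case (Ex x \<phi>)
  obtain n E i where x: "x = ((n, E), i)" by (metis surj_pair)
  have E: "(n, E) \<in> eq_sorts L2 N" using Ex.prems(1) x by (simp add: lang_eq_def Let_def)
  have *: "\<exists>c\<in>Dom (struc_eq N) (n, E). sat (struc_eq N) (w(x := c)) \<phi>"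
    if R: "R \<in> BF" "\<forall>y\<in>fv (Ex x \<phi>). req R (v y) (w y) \<and> fst (v y) = fst y"
      and b: "b \<in> Dom (struc_eq N) (n, E)" "sat (struc_eq N) (v(x := b)) \<phi>"
    for R v w b
  proof -
    obtain xs where xs: "xs \<in> tuples M n" "b = ((n, E), E `` {xs})" using b(1) by (auto simp: Dom_eq)
    then have "finite (set xs)" "set xs \<subseteq> M" by (auto simp: tuples_def)
    then obtain R' where R': "R' \<in> BF" "R \<subseteq> R'" "set xs \<subseteq> Domain R'" by (rule BF_forth_set[OF R(1)])
    then have "\<forall>x\<in>set xs. \<exists>y. (x, y) \<in> R'" by blast
    then obtain f where f: "\<forall>x\<in>set xs. (x, f x) \<in> R'" by metis
    have zip: "set (zip xs (map f xs)) \<subseteq> R'" using f by (auto simp: set_zip)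
    have len: "length xs = n" "length (map f xs) = n" using xs(1) by (auto simp: tuples_def)
    define c where "c = ((n, E), E `` {map f xs})"
    have "req R' b c" unfolding req_def c_def xs(2) using E len zip by blast
    then have "sat (struc_eq N) (v(x := b)) \<phi> \<longleftrightarrow> sat (struc_eq N) (w(x := c)) \<phi>"
      by (intro Ex.IH[OF _ R'(1)])
        (use Ex.prems(1) R(2) req_mono[OF _ R'(2)] xs(2) x in auto)
    moreover have "c \<in> Dom (struc_eq N) (n, E)"
      using zip_in_M(2)[OF R'(1) zip len] by (auto simp: Dom_eq c_def)
    ultimately show ?thesis using b(2) by blast
  qed
  let ?D = "Dom (struc_eq N) (n, E)"
  have "(\<exists>b\<in>?D. sat (struc_eq N) (v(x := b)) \<phi>) \<longleftrightarrow> (\<exists>b\<in>?D. sat (struc_eq N) (w(x := b)) \<phi>)"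
  proof
    show "(\<exists>b\<in>?D. sat (struc_eq N) (v(x := b)) \<phi>) \<Longrightarrow> (\<exists>b\<in>?D. sat (struc_eq N) (w(x := b)) \<phi>)"
      using *[OF Ex.prems(2), of v w] Ex.prems(3) by blast
    have "\<forall>y\<in>fv (Ex x \<phi>). req (R\<inverse>) (w y) (v y) \<and> fst (w y) = fst y"
      using Ex.prems(3) req_converse req_fst by metis
    then show "(\<exists>b\<in>?D. sat (struc_eq N) (w(x := b)) \<phi>) \<Longrightarrow> (\<exists>b\<in>?D. sat (struc_eq N) (v(x := b)) \<phi>)"
      using *[OF BF_converse[OF Ex.prems(2)], of w v] by blast
  qed
  then show ?case by (simp add: x)
qed

end


section \<open>Counting the conjugates of an imaginary\<close>

lemma set_zip_map: "set (zip xs (map f xs)) = (\<lambda>x. (x, f x)) ` set xs"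
  by (induction xs) auto

lemma set_zip_map_subset: "set xs \<subseteq> X \<Longrightarrow> set (zip xs (map f xs)) \<subseteq> Q \<union> (\<lambda>x. (x, f x)) ` X"
  by (auto simp: set_zip_map)

lemma at_most_classes_antimono: "at_most_classes E X m \<Longrightarrow> Y \<subseteq> X \<Longrightarrow> at_most_classes E Y m"
  unfolding at_most_classes_def by blast

text \<open>If \<open>X\<close> is covered by the classes of the sets \<open>Y i\<close>, the bounds for the \<open>Y i\<close> add up.\<close>

lemma at_most_classes_cover:
  assumes "finite I" "sym E" "trans E"
    and bound: "\<And>i. i \<in> I \<Longrightarrow> at_most_classes E (Y i) k"
    and cover: "\<And>z. z \<in> X \<Longrightarrow> \<exists>i\<in>I. \<exists>y\<in>Y i. (z, y) \<in> E"
  shows "at_most_classes E X (card I * k)"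
  unfolding at_most_classes_def
proof (intro allI impI)
  fix Z assume Z: "Z \<subseteq> X" "finite Z" "pairwise (\<lambda>x y. (x, y) \<notin> E) Z"
  define Zi where "Zi i = {z \<in> Z. \<exists>y\<in>Y i. (z, y) \<in> E}" for i
  have "card (Zi i) \<le> k" if i: "i \<in> I" for i
  proof -
    have "\<forall>z\<in>Zi i. \<exists>y. y \<in> Y i \<and> (z, y) \<in> E" by (auto simp: Zi_def)
    then obtain h where h: "\<forall>z\<in>Zi i. h z \<in> Y i \<and> (z, h z) \<in> E" by metis
    have sep: "h x \<noteq> h y \<and> (h x, h y) \<notin> E" if xy: "x \<in> Zi i" "y \<in> Zi i" "x \<noteq> y" for x y
    proof -
      have "(x, y) \<notin> E" using Z(3) xy by (auto simp: Zi_def pairwise_def)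
      moreover have "(x, h x) \<in> E" "(h y, y) \<in> E" using h xy symD[OF assms(2)] by blast+
      ultimately show ?thesis using transD[OF assms(3)] by metis
    qed
    then have inj: "inj_on h (Zi i)" by (meson inj_onI)
    have "card (h ` Zi i) \<le> k"
      by (rule at_most_classesD[OF bound[OF i]])
        (use h sep Z(2) in \<open>auto simp: pairwise_def Zi_def\<close>)
    then show ?thesis using card_image[OF inj] by simp
  qed
  then have "(\<Sum>i\<in>I. card (Zi i)) \<le> card I * k" using sum_bounded_above[of I "\<lambda>i. card (Zi i)" k] by simp
  moreover have "Z \<subseteq> (\<Union>i\<in>I. Zi i)" using Z(1) cover by (auto simp: Zi_def)
  then have "card Z \<le> card (\<Union>i\<in>I. Zi i)"
    by (rule card_mono[rotated]) (use assms(1) Z(2) in \<open>auto simp: Zi_def\<close>)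
  moreover have "card (\<Union>i\<in>I. Zi i) \<le> (\<Sum>i\<in>I. card (Zi i))" by (rule card_UN_le[OF assms(1)])
  ultimately show "card Z \<le> card I * k" by linarith
qed

context lovely begin

lemma extension_set:
  assumes "very_small B" "finite X" "X \<subseteq> Univ C"
  obtains f where "f ` X \<subseteq> M" "ind (f ` X) B P" "elem_rel L C (Id_on B \<union> (\<lambda>x. (x, f x)) ` X)"
proof -
  obtain cs where cs: "set cs = X" using finite_list[OF assms(2)] by blast
  obtain ds where ds: "length ds = length cs" "set ds \<subseteq> M" "ind (set ds) B P"
    "elem_rel L C (Id_on B \<union> set (zip cs ds))"
    using extension_tuple[OF assms(1), of cs] assms(3) cs by blast
  have "\<forall>x\<in>X. \<exists>y. (x, y) \<in> set (zip cs ds)"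
    using ds(1) cs by (auto simp: in_set_conv_nth set_zip)
  then obtain f where f: "\<forall>x\<in>X. (x, f x) \<in> set (zip cs ds)" by metis
  then have "f ` X \<subseteq> set ds" by (auto dest: set_zip_rightD)
  show thesis
  proof (rule that)
    show "f ` X \<subseteq> M" using \<open>f ` X \<subseteq> set ds\<close> ds(2) by blast
    show "ind (f ` X) B P"
      by (rule ind_mono_left[OF ds(3) \<open>f ` X \<subseteq> set ds\<close>]) (use ds(2) very_small_small[OF assms(1)] in auto)
    show "elem_rel L C (Id_on B \<union> (\<lambda>x. (x, f x)) ` X)"
      by (rule elem_rel_subset[OF ds(4)]) (use f in auto)
  qed
qed

lemma Id_on_BF: "very_small B \<Longrightarrow> Pind B \<Longrightarrow> Id_on B \<in> BF"
proof -
  assume B: "very_small B" "Pind B"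
  obtain f where "elem_rel L C (Id_on B \<union> (\<lambda>x. (x, f x)) ` {})"
    by (rule extension_set[OF B(1), of "{}"]) auto
  then show "Id_on B \<in> BF" using B by (auto simp: BF_def)
qed

text \<open>Finite subsets of a P-independent set lie in very small P-independent subsets.\<close>

lemma ex_vs_Pind:
  assumes "A \<subseteq> M" "Pind A" "finite A1" "A1 \<subseteq> A"
  obtains B where "A1 \<subseteq> B" "B \<subseteq> A" "very_small B" "Pind B"
proof -
  have sub: "A1 \<subseteq> M" "P \<inter> A \<subseteq> M" using assms(1,4) by auto
  have "ind A (P \<inter> A) P" using assms(2) by (simp add: P_independent_def)
  then have A1: "ind A1 (P \<inter> A) P"
    by (rule ind_mono_left[OF _ assms(4)]) (use assms(1) in auto)
  have "A1 \<subseteq> Univ C" using sub M_Univ by blast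
  then obtain D where D: "D \<subseteq> P \<inter> A" "|D| <o \<kappa>" "ind A1 D (P \<inter> A)"
    using ind_local[OF assms(3), of "P \<inter> A"] small_in_M[OF sub(2)] by metis
  have vD: "very_small D" using D assms(1) by (auto simp: very_small_def)
  have DP: "D \<union> (P \<inter> A) = P \<inter> A" "P \<inter> A \<union> P = P" using D(1) by auto
  have "ind A1 D ((P \<inter> A) \<union> P)"
    by (rule ind_trans[OF D(3)]) (use A1 DP vD very_small_small sub in auto)
  then have "ind A1 D P" by (simp add: DP)
  then have "ind A1 (P \<inter> (A1 \<union> D)) P"
    by (rule ind_base_mono) (use D(1) vD very_small_small sub in auto)
  then have "ind (A1 \<union> D) (P \<inter> (A1 \<union> D)) P"
    by (rule ind_mono) (use D(1) sub in auto)
  then have "Pind (A1 \<union> D)" by (simp add: P_independent_def)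
  moreover have "very_small (A1 \<union> D)" by (rule very_small_Un[OF very_small_finite vD]) (use assms(3) sub in auto)
  ultimately show thesis using that[of "A1 \<union> D"] assms(4) D(1) by blast
qed

end

text \<open>An \<open>L\<close>-sort of \<open>M\<^sup>e\<^sup>q\<close>, with a formula \<open>\<epsilon>\<close> defining its equivalence relation.\<close>

locale lovely_sort = lovely L C \<mu> \<kappa>\<^sub>0 \<kappa> ind M P
  for L :: "(unit, 'f, 'r) lang" and C :: "(unit, 'f, 'r, 'a) struc"
    and \<mu> \<kappa>\<^sub>0 \<kappa> :: "'k rel" and ind :: "'a set \<Rightarrow> 'a set \<Rightarrow> 'a set \<Rightarrow> bool"
    and M P :: "'a set" +
  fixes n :: nat and E :: "'a list rel" and \<epsilon> :: "(unit, 'f, 'r) fm"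
  assumes equiv_E: "equiv (tuples M n) E"
    and \<epsilon>: "wf_fm L \<epsilon>" "fv \<epsilon> \<subseteq> UNIV \<times> {..<2 * n}"
    and E_eq: "E = {(xs, ys) \<in> tuples M n \<times> tuples M n. sat (restr C M) (\<lambda>(_, i). (xs @ ys) ! i) \<epsilon>}"
begin

text \<open>The equivalence relation defined by \<open>\<epsilon>\<close> in \<open>C\<close>.\<close>

definition EC :: "'a list rel" where
  "EC = {(xs, ys) \<in> tuples (Univ C) n \<times> tuples (Univ C) n. sat C (\<lambda>(_, i). (xs @ ys) ! i) \<epsilon>}"

lemma EC_M:
  assumes "xs \<in> tuples M n" "ys \<in> tuples M n"
  shows "(xs, ys) \<in> EC \<longleftrightarrow> (xs, ys) \<in> E"
proof -
  have "(\<lambda>(_, i). (xs @ ys) ! i) x \<in> M" if x: "x \<in> fv \<epsilon>" for x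
  proof -
    obtain i where i: "x = ((), i)" "i < 2 * n" using x \<epsilon>(2) by (cases x) auto
    then have "(xs @ ys) ! i \<in> set (xs @ ys)" using assms by (intro nth_mem) (auto simp: tuples_def)
    then show ?thesis using assms i by (auto simp: tuples_def)
  qed
  then have "sat (restr C M) (\<lambda>(_, i). (xs @ ys) ! i) \<epsilon> \<longleftrightarrow> sat C (\<lambda>(_, i). (xs @ ys) ! i) \<epsilon>"
    using M_C \<epsilon>(1) unfolding elementary_substructure_def by blast
  moreover have "xs \<in> tuples (Univ C) n" "ys \<in> tuples (Univ C) n"
    using assms M_Univ by (auto simp: tuples_def)
  ultimately show ?thesis using assms by (auto simp: EC_def E_eq)
qed

lemma elem_rel_zip_tuples:
  assumes "elem_rel L C R" "set (zip xs ys) \<subseteq> R" "length xs = n" "length ys = n"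
  shows "xs \<in> tuples (Univ C) n" "ys \<in> tuples (Univ C) n"
proof -
  have "R \<subseteq> Univ C \<times> Univ C" using elem_rel_Univ[OF assms(1)] by auto
  then show "xs \<in> tuples (Univ C) n" "ys \<in> tuples (Univ C) n"
    using zip_in_tuples[OF assms(2) _ assms(3,4)] by auto
qed

lemma EC_elem:
  assumes R: "elem_rel L C R"
    and xs: "length xs = n" "length ys = n" "set (zip xs ys) \<subseteq> R"
    and us: "length us = n" "length ws = n" "set (zip us ws) \<subseteq> R"
  shows "(xs, us) \<in> EC \<longleftrightarrow> (ys, ws) \<in> EC"
proof -
  have "sat C (\<lambda>(_, i). (xs @ us) ! i) \<epsilon> \<longleftrightarrow> sat C (\<lambda>(_, i). (ys @ ws) ! i) \<epsilon>"
  proof (rule elem_relD[OF R \<epsilon>(1)])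
    fix x assume "x \<in> fv \<epsilon>"
    then obtain i where i: "x = ((), i)" "i < 2 * n" using \<epsilon>(2) by (cases x) auto
    show "((\<lambda>(_, i). (xs @ us) ! i) x, (\<lambda>(_, i). (ys @ ws) ! i) x) \<in> R"
      using zip_append_nth_mem[OF xs(3) us(3) xs(1,2) us(1,2) i(2)] i(1) by simp
  qed
  then show ?thesis
    using elem_rel_zip_tuples[OF R xs(3,1,2)] elem_rel_zip_tuples[OF R us(3,1,2)]
    by (auto simp: EC_def)
qed

text \<open>That \<open>EC\<close> is an equivalence relation is inherited from \<open>M\<close>, by the extension property.\<close>

lemma EC_pull:
  assumes "finite X" "X \<subseteq> Univ C"
  obtains f where "\<forall>xs ys. set xs \<subseteq> X \<longrightarrow> set ys \<subseteq> X \<longrightarrow> length xs = n \<longrightarrow> length ys = n \<longrightarrow>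
    map f xs \<in> tuples M n \<and> ((xs, ys) \<in> EC \<longleftrightarrow> (map f xs, map f ys) \<in> E)"
proof -
  have "very_small {}" by (rule very_small_finite) auto
  then obtain f where f: "f ` X \<subseteq> M" "elem_rel L C (Id_on {} \<union> (\<lambda>x. (x, f x)) ` X)"
    by (rule extension_set[OF _ assms])
  have M: "map f xs \<in> tuples M n" if "set xs \<subseteq> X" "length xs = n" for xs
    using f(1) that by (auto simp: tuples_def)
  have "(xs, ys) \<in> EC \<longleftrightarrow> (map f xs, map f ys) \<in> E"
    if "set xs \<subseteq> X" "set ys \<subseteq> X" "length xs = n" "length ys = n" for xs ys
  proof -
    have "(xs, ys) \<in> EC \<longleftrightarrow> (map f xs, map f ys) \<in> EC"
      by (rule EC_elem[OF f(2)]) (use that set_zip_map_subset in \<open>simp_all only: length_map\<close>)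
    then show ?thesis using EC_M[OF M M] that by simp
  qed
  then show thesis using that M by blast
qed

lemma EC_tuples: "(xs, ys) \<in> EC \<Longrightarrow> length xs = n \<and> set xs \<subseteq> Univ C \<and> length ys = n \<and> set ys \<subseteq> Univ C"
  by (auto simp: EC_def tuples_def)

lemma EC_refl: "xs \<in> tuples (Univ C) n \<Longrightarrow> (xs, xs) \<in> EC"
proof -
  assume xs: "xs \<in> tuples (Univ C) n"
  then obtain f where f: "\<forall>us ys. set us \<subseteq> set xs \<longrightarrow> set ys \<subseteq> set xs \<longrightarrow> length us = n \<longrightarrow>
    length ys = n \<longrightarrow> map f us \<in> tuples M n \<and> ((us, ys) \<in> EC \<longleftrightarrow> (map f us, map f ys) \<in> E)"
    using EC_pull[of "set xs"] by (auto simp: tuples_def)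
  have "map f xs \<in> tuples M n \<and> ((xs, xs) \<in> EC \<longleftrightarrow> (map f xs, map f xs) \<in> E)"
    by (rule f[rule_format]) (use xs in \<open>auto simp: tuples_def\<close>)
  then show ?thesis using equiv_E by (simp add: equiv_def refl_on_def)
qed

lemma EC_sym: "sym EC"
proof (rule symI)
  fix xs ys assume a: "(xs, ys) \<in> EC"
  then obtain f where f: "\<forall>us ws. set us \<subseteq> set xs \<union> set ys \<longrightarrow> set ws \<subseteq> set xs \<union> set ys \<longrightarrow> length us = n \<longrightarrow>
    length ws = n \<longrightarrow> map f us \<in> tuples M n \<and> ((us, ws) \<in> EC \<longleftrightarrow> (map f us, map f ws) \<in> E)"
    using EC_pull[of "set xs \<union> set ys"] EC_tuples[OF a] by auto
  have "(xs, ys) \<in> EC \<longleftrightarrow> (map f xs, map f ys) \<in> E" "(ys, xs) \<in> EC \<longleftrightarrow> (map f ys, map f xs) \<in> E"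
    using f EC_tuples[OF a] by auto
  then show "(ys, xs) \<in> EC" using a equiv_E by (meson equivE symD)
qed

lemma EC_trans: "trans EC"
proof (rule transI)
  fix xs ys zs assume a: "(xs, ys) \<in> EC" "(ys, zs) \<in> EC"
  let ?X = "set xs \<union> set ys \<union> set zs"
  obtain f where f: "\<forall>us ws. set us \<subseteq> ?X \<longrightarrow> set ws \<subseteq> ?X \<longrightarrow> length us = n \<longrightarrow>
    length ws = n \<longrightarrow> map f us \<in> tuples M n \<and> ((us, ws) \<in> EC \<longleftrightarrow> (map f us, map f ws) \<in> E)"
    using EC_pull[of ?X] EC_tuples[OF a(1)] EC_tuples[OF a(2)] by auto
  have "(xs, ys) \<in> EC \<longleftrightarrow> (map f xs, map f ys) \<in> E" "(ys, zs) \<in> EC \<longleftrightarrow> (map f ys, map f zs) \<in> E"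
    "(xs, zs) \<in> EC \<longleftrightarrow> (map f xs, map f zs) \<in> E"
    using f EC_tuples[OF a(1)] EC_tuples[OF a(2)] by auto
  then show "(xs, zs) \<in> EC" using a equiv_E by (meson equivE transD)
qed

lemma EC_definable: "class_rel_definable L C n EC"
  unfolding class_rel_definable_def definable_def
proof (intro exI conjI allI impI)
  show "wf_fm L \<epsilon>" by (rule \<epsilon>(1))
  show "\<forall>x\<in>fv \<epsilon>. 2 * n \<le> snd x \<longrightarrow> undefined x \<in> {}" using \<epsilon>(2) by fastforce
  fix g assume g: "\<forall>i<2 * n. g i \<in> Univ C"
  let ?xs = "map g [0..<n]" and ?ys = "map (\<lambda>l. g (n + l)) [0..<n]"
  have "(?xs @ ?ys) ! i = g i" if "i < 2 * n" for i using that by (auto simp: nth_append)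
  then have "sat C (\<lambda>(_, i). (?xs @ ?ys) ! i) \<epsilon> \<longleftrightarrow> sat C (val (2 * n) g undefined) \<epsilon>"
    by (intro sat_cong) (use \<epsilon>(2) in \<open>auto simp: val_def\<close>)
  moreover have "?xs \<in> tuples (Univ C) n" "?ys \<in> tuples (Univ C) n" using g by (auto simp: tuples_def)
  ultimately show "(?xs, ?ys) \<in> EC \<longleftrightarrow> sat C (val (2 * n) g undefined) \<epsilon>" by (simp add: EC_def)
qed

text \<open>A set of imaginaries of this sort that is invariant under the back-and-forth system over
  \<open>B\<close>, such as a set definable over \<open>B\<close> in the pair.\<close>

definition invariant :: "'a set \<Rightarrow> 'a list set set \<Rightarrow> bool" where
  "invariant B F \<longleftrightarrow> F \<subseteq> tuples M n // E \<and>
     (\<forall>R\<in>BF. \<forall>xs ys. Id_on B \<subseteq> R \<longrightarrow> length xs = n \<longrightarrow> length ys = n \<longrightarrow> set (zip xs ys) \<subseteq> R \<longrightarrow>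
        E `` {xs} \<in> F \<longrightarrow> E `` {ys} \<in> F)"

lemma invariantD:
  assumes "invariant B F" "R \<in> BF" "Id_on B \<subseteq> R" "length xs = n" "length ys = n"
    "set (zip xs ys) \<subseteq> R" "E `` {xs} \<in> F"
  shows "E `` {ys} \<in> F"
  using assms unfolding invariant_def by blast

lemma conjugates_self:
  assumes "very_small B" "c \<in> tuples M n"
  shows "c \<in> conjugates L C B c"
proof -
  have "very_small (B \<union> set c)" by (rule very_small_Un[OF assms(1) very_small_finite]) (use assms(2) in \<open>auto simp: tuples_def\<close>)
  then obtain f where "elem_rel L C (Id_on (B \<union> set c) \<union> (\<lambda>x. (x, f x)) ` {})"
    by (rule extension_set[of _ "{}"]) auto
  moreover have "set (zip c c) \<subseteq> Id_on (set c)" by (auto simp: set_zip)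
  ultimately have "elem_rel L C (Id_on B \<union> set (zip c c))" by (elim elem_rel_subset) auto
  then show ?thesis by (simp add: conjugates_def)
qed

lemma conjugates_tuples:
  assumes "z \<in> conjugates L C B c" "length c = n"
  shows "z \<in> tuples (Univ C) n"
  using conjugates_Univ[OF assms(1)] assms by (simp add: tuples_def conjugates_def)

lemma conjugates_map:
  assumes "z \<in> conjugates L C B c" "elem_rel L C (Id_on B \<union> (\<lambda>x. (x, f x)) ` X)" "set z \<subseteq> X"
  shows "map f z \<in> conjugates L C B c"
proof -
  have len: "length z = length c" and e: "elem_rel L C (Id_on B \<union> set (zip c z))"
    using assms(1) by (auto simp: conjugates_def)
  have "set (zip c (map f z)) \<subseteq> set (zip c z) O (\<lambda>x. (x, f x)) ` X"
  proof
    fix p assume "p \<in> set (zip c (map f z))"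
    then obtain i where i: "i < length z" "p = (c ! i, f (z ! i))" using len by (auto simp: set_zip)
    then have "(c ! i, z ! i) \<in> set (zip c z)" "z ! i \<in> X" using len assms(3) by (auto simp: set_zip)
    then show "p \<in> set (zip c z) O (\<lambda>x. (x, f x)) ` X" using i(2) by blast
  qed
  then have "Id_on B \<union> set (zip c (map f z)) \<subseteq>
    (Id_on B \<union> set (zip c z)) O (Id_on B \<union> (\<lambda>x. (x, f x)) ` X)" by blast
  then have "elem_rel L C (Id_on B \<union> set (zip c (map f z)))"
    by (rule elem_rel_subset[OF elem_rel_relcomp[OF e assms(2)]])
  then show ?thesis using len by (simp add: conjugates_def)
qed

text \<open>A family of inequivalent conjugates is moved to another one by an elementary map over \<open>B\<close>.\<close>

lemma move_conjugates:
  assumes c: "length c = n" and Z: "Z \<subseteq> conjugates L C B c" "pairwise (\<lambda>x y. (x, y) \<notin> EC) Z"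
    and f: "elem_rel L C (Id_on B \<union> (\<lambda>x. (x, f x)) ` (\<Union>(set ` Z)))"
  shows "map f ` Z \<subseteq> conjugates L C B c" "inj_on (map f) Z" "pairwise (\<lambda>x y. (x, y) \<notin> EC) (map f ` Z)"
proof -
  have z: "length z = n" "set z \<subseteq> \<Union>(set ` Z)" "map f z \<in> conjugates L C B c" if "z \<in> Z" for z
  proof -
    show "length z = n" using that Z(1) c by (auto simp: conjugates_def)
    show s: "set z \<subseteq> \<Union>(set ` Z)" using that by auto
    show "map f z \<in> conjugates L C B c" using conjugates_map[OF _ f s] that Z(1) by blast
  qed
  then show "map f ` Z \<subseteq> conjugates L C B c" by blast
  have sep: "(map f x, map f y) \<notin> EC" if xy: "x \<in> Z" "y \<in> Z" "x \<noteq> y" for x y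
  proof -
    have "(x, y) \<in> EC \<longleftrightarrow> (map f x, map f y) \<in> EC"
      by (rule EC_elem[OF f])
        (use z(1,2) xy(1,2) in \<open>simp_all only: length_map set_zip_map_subset\<close>)
    then show ?thesis using Z(2) xy by (auto simp: pairwise_def)
  qed
  show "inj_on (map f) Z"
  proof (rule inj_onI, rule ccontr)
    fix x y assume xy: "x \<in> Z" "y \<in> Z" "map f x = map f y" "x \<noteq> y"
    then show False using sep[of x y] EC_refl[OF conjugates_tuples[OF z(3) c], of x] by simp
  qed
  have "(map f x, map f y) \<notin> EC" if "x \<in> Z" "y \<in> Z" "map f x \<noteq> map f y" for x y
    using sep[of x y] that by auto
  then show "pairwise (\<lambda>x y. (x, y) \<notin> EC) (map f ` Z)" by (auto simp: pairwise_def)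
qed

text \<open>
  If \<open>c\<close> is independent from \<open>P\<close> over \<open>B'\<close>, its conjugates over \<open>B'\<close> give at most as many classes as
  \<open>F\<close> has: finitely many of them can be moved into \<open>M\<close> and made independent from \<open>P\<close> over \<open>B'\<close>;
  then they correspond to \<open>c\<close> under the back-and-forth system.
\<close>

lemma at_most_classes_free:
  assumes B: "B \<subseteq> B'" "very_small B'" "Pind B'" and F: "invariant B F" "finite F"
    and c: "c \<in> tuples M n" "E `` {c} \<in> F" "ind (set c) B' P"
  shows "at_most_classes EC (conjugates L C B' c) (card F)"
proof (rule ccontr)
  assume "\<not> ?thesis"
  then obtain zs where zs: "length zs = Suc (card F)" "distinct zs"
    "set zs \<subseteq> conjugates L C B' c" "pairwise (\<lambda>x y. (x, y) \<notin> EC) (set zs)"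
    by (rule not_at_most_classesE)
  define X where "X = \<Union>(set ` set zs)"
  have X: "finite X" "X \<subseteq> Univ C" using zs(3) conjugates_Univ[of _ L C B' c] by (auto simp: X_def)
  obtain f where f: "f ` X \<subseteq> M" "ind (f ` X) B' P" "elem_rel L C (Id_on B' \<union> (\<lambda>x. (x, f x)) ` X)"
    by (rule extension_set[OF B(2) X])
  have len: "length c = n" using c(1) by (simp add: tuples_def)
  note moved = move_conjugates[OF len zs(3,4) f(3)[unfolded X_def]]
  have z: "length z = n" "set z \<subseteq> X" "map f z \<in> conjugates L C B' c" "map f z \<in> tuples M n"
    if "z \<in> set zs" for z
  proof -
    show l: "length z = n" using that zs(3) len by (auto simp: conjugates_def)
    show s: "set z \<subseteq> X" using that by (auto simp: X_def)
    show "map f z \<in> conjugates L C B' c" using moved(1) that by blast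
    show "map f z \<in> tuples M n" using l s f(1) by (auto simp: tuples_def)
  qed
  have "E `` {map f z} \<in> F" if zz: "z \<in> set zs" for z
  proof (rule invariantD[OF F(1)])
    let ?S = "set (zip c (map f z))"
    have "Domain ?S \<subseteq> set c" by (auto dest: set_zip_leftD)
    moreover have "Range ?S \<subseteq> set (map f z)" by (blast dest: set_zip_rightD)
    moreover have "set (map f z) \<subseteq> f ` X" using z(2)[OF zz] by auto
    ultimately have sub: "Domain ?S \<subseteq> set c" "Range ?S \<subseteq> f ` X" by auto
    show "Id_on B' \<union> ?S \<in> BF"
    proof (rule BF_Un_free[OF Id_on_BF[OF B(2,3)]])
      show "elem_rel L C (Id_on B' \<union> ?S)" using z(3)[OF zz] by (simp add: conjugates_def)
      show "Domain ?S \<subseteq> M" "Range ?S \<subseteq> M" using sub c(1) f(1) by (auto simp: tuples_def)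
      have sm: "sm B'" "sm (set c)" "sm (f ` X)" using very_small_small[OF B(2)] c(1) f(1) by (auto simp: tuples_def)
      show "ind (Domain ?S) (Domain (Id_on B')) P"
        using ind_mono_left[OF c(3) sub(1)] sm by auto
      show "ind (Range ?S) (Range (Id_on B')) P"
        using ind_mono_left[OF f(2) sub(2)] sm by auto
    qed simp
    show "Id_on B \<subseteq> Id_on B' \<union> ?S" using B(1) by auto
  qed (use len z[OF zz] c(2) in auto)
  then have "(\<lambda>z. E `` {map f z}) ` set zs \<subseteq> F" by blast
  moreover have "inj_on (\<lambda>z. E `` {map f z}) (set zs)"
  proof (rule inj_onI, rule ccontr)
    fix x y assume xy: "x \<in> set zs" "y \<in> set zs" "E `` {map f x} = E `` {map f y}" "x \<noteq> y"
    have "(map f x, map f y) \<in> EC"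
      using xy(3) eq_equiv_class_iff[OF equiv_E z(4)[OF xy(1)] z(4)[OF xy(2)]]
        EC_M[OF z(4)[OF xy(1)] z(4)[OF xy(2)]] by simp
    moreover have "map f x \<noteq> map f y" using moved(2) xy by (auto dest: inj_onD)
    ultimately show False using moved(3) xy(1,2) unfolding pairwise_def by blast
  qed
  ultimately have "card (set zs) \<le> card F" using card_inj_on_le F(2) by blast
  then show False using zs(1,2) by (simp add: distinct_card)
qed

text \<open>
  Let \<open>D\<close> be a set of parameters in \<open>P\<close>. If a conjugate \<open>z\<close> of \<open>c\<close> over \<open>B\<close> is independent from \<open>D\<close> over \<open>B\<close>,
  then a conjugate of \<open>D\<close> over \<open>B\<close>, standing to \<open>c\<close> as \<open>D\<close> stands to \<open>z\<close>, can be found in \<open>P\<close>, and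
  it corresponds to \<open>D\<close> under the back-and-forth system. Pulling \<open>c\<close> back along it gives a tuple \<open>y\<close>
  which stands to \<open>D\<close> as \<open>z\<close> does, and which still has its class in \<open>F\<close>.
\<close>

lemma conjugate_over_P:
  assumes B: "very_small B" "Pind B" and F: "invariant B F"
    and c: "c \<in> tuples M n" "E `` {c} \<in> F"
    and z: "z \<in> conjugates L C B c" and D: "D \<subseteq> P" "very_small D" "ind D B (set z)"
  shows "\<exists>y\<in>tuples M n. E `` {y} \<in> F \<and> z \<in> conjugates L C (B \<union> D) y"
proof -
  have len: "length c = n" "length z = n" and e: "elem_rel L C (Id_on B \<union> set (zip c z))"
    using c(1) z by (auto simp: conjugates_def tuples_def)
  have cM: "set c \<subseteq> M" using c(1) by (simp add: tuples_def)
  have zC: "set z \<subseteq> Univ C" by (rule conjugates_Univ[OF z])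
  let ?R0 = "Id_on B \<union> set (zip z c)"
  have "(Id_on B \<union> set (zip c z))\<inverse> = ?R0" by (auto simp: zip_commute[of z])
  then have e0: "elem_rel L C ?R0" using elem_rel_converse[OF e] by simp
  have dom0: "Domain ?R0 = B \<union> set z" "Range ?R0 = B \<union> set c"
  proof -
    have "Domain (set (zip z c)) = set (map fst (zip z c))" "Range (set (zip z c)) = set (map snd (zip z c))"
      by (auto simp: Domain_fst Range_snd)
    then show "Domain ?R0 = B \<union> set z" "Range ?R0 = B \<union> set c" using len by auto
  qed
  have sm: "sm B" "sm (set z)" "sm (set c)" "sm D" "sm (P \<inter> B)"
    using very_small_small[OF B(1)] very_small_small[OF D(2)] cM small_finite[OF _ zC] by auto
  then have "sm (Domain ?R0)" unfolding dom0 by blast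
  then obtain \<sigma> where \<sigma>: "automorphism L C \<sigma>" "\<And>a b. (a, b) \<in> ?R0 \<Longrightarrow> \<sigma> a = b"
    using extend_to_automorphism[OF e0] by metis
  have \<sigma>B: "\<sigma> ` X = X" if "X \<subseteq> B" for X using \<sigma>(2) that by force
  have \<sigma>z: "\<sigma> ` set z = set c"
  proof -
    have "\<sigma> (z ! i) = c ! i" if "i < n" for i
      using \<sigma>(2)[of "z ! i" "c ! i"] that len by (auto simp: set_zip)
    then have "map \<sigma> z = c" using len by (auto intro: nth_equalityI)
    then show ?thesis by (metis list.set_map)
  qed
  have sD: "sm (\<sigma> ` D)" by (rule small_image[OF \<sigma>(1) sm(4)])
  have "ind B (P \<inter> B) P" using B(2) by (simp add: P_independent_def)
  then have "ind B (P \<inter> B) D" by (rule ind_mono) (use D(1) sm in auto)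
  then have "ind D (P \<inter> B) B" using ind_sym sm by blast
  then have 1: "ind (\<sigma> ` D) (P \<inter> B) B"
    using ind_invariant[OF \<sigma>(1)] \<sigma>B sm by (metis Int_lower2 order_refl)
  have 2: "ind (\<sigma> ` D) B (set c)"
    using ind_invariant[OF \<sigma>(1) D(3)] \<sigma>B \<sigma>z sm by (metis order_refl)
  have PB: "P \<inter> B \<union> B = B" by auto
  have "ind (\<sigma> ` D) (P \<inter> B) (B \<union> set c)"
    by (rule ind_trans[OF 1]) (use 2 PB sD sm in auto)
  then have 3: "ind (\<sigma> ` D) (P \<inter> (B \<union> set c)) (B \<union> set c)"
    by (rule ind_base_mono) (use sD sm in auto)
  have vsBc: "very_small (B \<union> set c)" by (rule very_small_Un[OF B(1) very_small_finite]) (use cM in auto)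
  have "|\<sigma> ` D| <o \<kappa>" using D(2) ordLeq_ordLess_trans[OF card_of_image] by (auto simp: very_small_def)
  then obtain R where R: "elem_rel L C (Id_on (B \<union> set c) \<union> R)" "Domain R = \<sigma> ` D" "Range R \<subseteq> P"
    by (rule density_set[OF vsBc sD _ 3])
  define S where "S = {(d, s). d \<in> D \<and> (\<sigma> d, s) \<in> R}"
  have domS: "Domain S = D" "Range S \<subseteq> P" using R(2,3) by (auto simp: S_def)
  have eT: "elem_rel L C (?R0 \<union> S)"
  proof (rule elem_rel_via_automorphism[OF \<sigma> R(1)])
    show "Domain ?R0 \<subseteq> Univ C" by (rule elem_rel_Domain_Univ[OF e0])
    show "Domain S \<subseteq> Univ C" using domS(1) sm(4) by (simp add: small_def)
    show "Id_on (Range ?R0) \<subseteq> Id_on (B \<union> set c) \<union> R" unfolding dom0 by blast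
  qed (auto simp: S_def)
  have R1: "Id_on B \<union> S \<in> BF"
  proof (rule BF_Un_P_subset[OF Id_on_BF[OF B]])
    show "elem_rel L C (Id_on B \<union> S)" by (rule elem_rel_subset[OF eT]) auto
  qed (use domS D in auto)
  obtain R2 where R2: "R2 \<in> BF" "(Id_on B \<union> S)\<inverse> \<subseteq> R2" "set c \<subseteq> Domain R2"
    using BF_forth_set[OF BF_converse[OF R1], of "set c"] cM by blast
  have "\<forall>x\<in>set c. \<exists>y. (x, y) \<in> R2" using R2(3) by blast
  then obtain h where h: "\<forall>x\<in>set c. (x, h x) \<in> R2" by metis
  define y where "y = map h c"
  have zip_y: "set (zip c y) \<subseteq> R2" using h by (auto simp: y_def set_zip_map)
  have ly: "length y = n" using len by (simp add: y_def)
  have yM: "y \<in> tuples M n" by (rule zip_in_M(2)[OF R2(1) zip_y len(1) ly])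
  have "E `` {y} \<in> F"
    by (rule invariantD[OF F R2(1) _ len(1) ly zip_y c(2)]) (use R2(2) in auto)
  moreover have "elem_rel L C (Id_on (B \<union> D) \<union> set (zip y z))"
  proof (rule elem_rel_subset)
    show "elem_rel L C (R2\<inverse> O (?R0 \<union> S)\<inverse>)"
      by (rule elem_rel_relcomp[OF elem_rel_converse[OF BF_D(1)[OF R2(1)]] elem_rel_converse[OF eT]])
    have "set (zip y z) \<subseteq> R2\<inverse> O (?R0 \<union> S)\<inverse>"
    proof
      fix p assume "p \<in> set (zip y z)"
      then obtain i where i: "i < n" "p = (y ! i, z ! i)" using len ly by (auto simp: set_zip)
      have "(c ! i, y ! i) \<in> R2" using zip_y i(1) len ly by (force simp: set_zip)
      moreover have "(z ! i, c ! i) \<in> ?R0 \<union> S" using i(1) len by (force simp: set_zip)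
      ultimately show "p \<in> R2\<inverse> O (?R0 \<union> S)\<inverse>"
        unfolding i(2) by (intro relcompI[where b="c ! i"] converseI)
    qed
    moreover have "Id_on (B \<union> D) \<subseteq> R2\<inverse> O (?R0 \<union> S)\<inverse>"
    proof -
      have "(b, b) \<in> R2\<inverse> O (?R0 \<union> S)\<inverse>" if "(b, b') \<in> Id_on B \<union> S" for b b'
      proof (intro relcompI[where b=b'] converseI)
        show "(b', b) \<in> R2" using that R2(2) by blast
        show "(b, b') \<in> ?R0 \<union> S" using that by auto
      qed
      then show ?thesis using domS(1) by blast
    qed
    ultimately show "Id_on (B \<union> D) \<union> set (zip y z) \<subseteq> R2\<inverse> O (?R0 \<union> S)\<inverse>" by blast
  qed
  then have "z \<in> conjugates L C (B \<union> D) y" using len ly by (simp add: conjugates_def)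
  ultimately show ?thesis using yM by blast
qed

lemma elementary_map_elem_rel:
  assumes "elementary_map L C X f"
  shows "elem_rel L C ((\<lambda>x. (x, f x)) ` X)"
proof (rule elem_relI)
  show "(\<lambda>x. (x, f x)) ` X \<subseteq> Univ C \<times> Univ C" using assms by (auto simp: elementary_map_def)
  fix \<phi> v w assume \<phi>: "wf_fm L \<phi>" "\<forall>x\<in>fv \<phi>. (v x, w x) \<in> (\<lambda>x. (x, f x)) ` X"
  have "sat C w \<phi> \<longleftrightarrow> sat C (f \<circ> v) \<phi>" by (rule sat_cong) (use \<phi>(2) in force)
  moreover have "\<forall>x\<in>fv \<phi>. v x \<in> X" using \<phi>(2) by auto
  ultimately show "sat C v \<phi> \<longleftrightarrow> sat C w \<phi>" using assms \<phi>(1) by (simp add: elementary_map_def)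
qed

text \<open>
  First, some bound on the number of classes among the conjugates of \<open>c\<close> over \<open>B\<close>. Parameters \<open>D\<close> in
  \<open>P\<close> make all members of \<open>F\<close> have boundedly many conjugates over \<open>B \<union> D\<close>. If \<open>c\<close> had too many
  inequivalent conjugates over \<open>B\<close>, they could be chosen independent from \<open>D\<close> over \<open>B\<close>; but then each
  of them is equivalent to a conjugate over \<open>B \<union> D\<close> of a member of \<open>F\<close>.
\<close>

lemma at_most_classes_exists:
  assumes B: "very_small B" "Pind B" and F: "invariant B F" "finite F"
    and c: "c \<in> tuples M n" "E `` {c} \<in> F"
  shows "\<exists>m. at_most_classes EC (conjugates L C B c) m"
proof -
  have "\<forall>e\<in>F. \<exists>r\<in>tuples M n. e = E `` {r}" using F(1) by (auto simp: invariant_def quotient_def)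
  then obtain r where r: "\<And>e. e \<in> F \<Longrightarrow> r e \<in> tuples M n" "\<And>e. e \<in> F \<Longrightarrow> E `` {r e} = e" by metis
  define X where "X = (\<Union>e\<in>F. set (r e))"
  have X: "finite X" "X \<subseteq> M" using F(2) r(1) by (auto simp: X_def tuples_def)
  obtain D where D: "D \<subseteq> P" "very_small D" "ind X (B \<union> D) P" by (rule ex_base_in_P[OF B(1) X])
  have BD: "very_small (B \<union> D)" "Pind (B \<union> D)" using very_small_Un[OF B(1) D(2)] Pind_Un_P[OF B(2) very_small_M[OF B(1)] D(1)] by auto
  have bound: "at_most_classes EC (conjugates L C (B \<union> D) (r e)) (card F)" if e: "e \<in> F" for e
  proof (rule at_most_classes_free[OF _ BD F r(1)[OF e]])
    show "ind (set (r e)) (B \<union> D) P"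
      by (rule ind_mono_left[OF D(3)]) (use e X very_small_small[OF BD(1)] in \<open>auto simp: X_def\<close>)
  qed (use r e in auto)
  define m where "m = card F * card F"
  have "at_most_classes EC (conjugates L C B c) m"
  proof (rule ccontr)
    assume "\<not> ?thesis"
    then obtain zs where zs: "length zs = Suc m" "distinct zs"
      "set zs \<subseteq> conjugates L C B c" "pairwise (\<lambda>x y. (x, y) \<notin> EC) (set zs)"
      by (rule not_at_most_classesE)
    define Y where "Y = \<Union>(set ` set zs)"
    have Y: "finite Y" "Y \<subseteq> Univ C" using zs(3) conjugates_Univ[of _ L C B c] by (auto simp: Y_def)
    have sm: "sm Y" "sm B" "sm D" using small_finite[OF Y] very_small_small B(1) D(2) by auto
    \<comment> \<open>All the tuples are moved together over \<open>B\<close>, away from \<open>D\<close>.\<close>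
    obtain Y' where Y': "equiv_over L C B Y' Y" "ind Y' B D" using ind_extension[OF sm] by blast
    then obtain f where f: "elementary_map L C (Y \<union> B) f" "\<forall>b\<in>B. f b = b" "f ` Y = Y'"
      unfolding equiv_over_def by blast
    have e: "elem_rel L C (Id_on B \<union> (\<lambda>x. (x, f x)) ` Y)"
      by (rule elem_rel_subset[OF elementary_map_elem_rel[OF f(1)]]) (use f(2) in force)
    have smY': "sm Y'"
      using ordLeq_ordLess_trans[OF card_of_image[of f Y]] sm(1) f(1,3)
      by (auto simp: small_def elementary_map_def)
    have DY: "ind D B Y'" using ind_sym[OF Y'(2) smY'] sm by blast
    have len: "length c = n" using c(1) by (simp add: tuples_def)
    note moved = move_conjugates[OF len zs(3,4) e[unfolded Y_def]]
    have "at_most_classes EC (map f ` set zs) m"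
      unfolding m_def
    proof (rule at_most_classes_cover[OF F(2) EC_sym EC_trans bound])
      fix w assume "w \<in> map f ` set zs"
      then obtain z where zz: "z \<in> set zs" "w = map f z" by blast
      have "ind D B (set w)"
        by (rule ind_mono[OF DY]) (use zz f(3) sm smY' in \<open>auto simp: Y_def\<close>)
      then obtain y where y: "y \<in> tuples M n" "E `` {y} \<in> F" "w \<in> conjugates L C (B \<union> D) y"
        using conjugate_over_P[OF B F(1) c _ D(1,2)] moved(1) zz by blast
      define e where "e = E `` {y}"
      have eF: "e \<in> F" using y(2) by (simp add: e_def)
      have ly: "length y = n" "length (r e) = n" "length w = n"
        using y(1,3) r(1)[OF eF] by (auto simp: tuples_def conjugates_def)
      have "(y, r e) \<in> E"
        using eq_equiv_class_iff[OF equiv_E y(1) r(1)[OF eF]] r(2)[OF eF] by (simp add: e_def)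
      then have yr: "(y, r e) \<in> EC" using EC_M[OF y(1) r(1)[OF eF]] by simp
      let ?R = "Id_on (B \<union> D) \<union> set (zip y w)"
      have eR: "elem_rel L C ?R" using y(3) by (simp add: conjugates_def)
      have "Domain ?R \<subseteq> M" using very_small_M[OF BD(1)] y(1) by (auto simp: tuples_def dest: set_zip_leftD)
      then obtain \<tau> where \<tau>: "automorphism L C \<tau>" "\<And>a b. (a, b) \<in> ?R \<Longrightarrow> \<tau> a = b"
        using extend_to_automorphism[OF eR] small_in_M by metis
      let ?Q = "B \<union> D \<union> set y \<union> set (r e)"
      have QM: "?Q \<subseteq> Univ C" using very_small_M[OF BD(1)] y(1) r(1)[OF eF] M_Univ by (auto simp: tuples_def)
      have eQ: "elem_rel L C ((\<lambda>a. (a, \<tau> a)) ` ?Q)"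
        by (rule elem_rel_automorphism[OF one_sorted struc \<tau>(1) QM])
      have "map \<tau> (r e) \<in> conjugates L C (B \<union> D) (r e)"
      proof -
        have "elem_rel L C (Id_on (B \<union> D) \<union> set (zip (r e) (map \<tau> (r e))))"
          by (rule elem_rel_subset[OF eQ]) (use \<tau>(2) in \<open>force simp: set_zip_map\<close>)
        then show ?thesis by (simp add: conjugates_def)
      qed
      moreover have "(y, r e) \<in> EC \<longleftrightarrow> (w, map \<tau> (r e)) \<in> EC"
      proof (rule EC_elem[OF eQ])
        have "\<tau> (y ! i) = w ! i" if "i < n" for i
          using \<tau>(2)[of "y ! i" "w ! i"] that ly by (auto simp: set_zip)
        then have "map \<tau> y = w" using ly by (auto intro: nth_equalityI)
        then show "set (zip y w) \<subseteq> (\<lambda>a. (a, \<tau> a)) ` ?Q" using set_zip_map[of y \<tau>] by auto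
        show "set (zip (r e) (map \<tau> (r e))) \<subseteq> (\<lambda>a. (a, \<tau> a)) ` ?Q" by (auto simp: set_zip_map)
      qed (use ly in auto)
      ultimately show "\<exists>e\<in>F. \<exists>u\<in>conjugates L C (B \<union> D) (r e). (w, u) \<in> EC" using eF yr by blast
    qed
    then have "card (map f ` set zs) \<le> m"
      by (rule at_most_classesD) (use moved(3) in auto)
    then show False using card_image[OF moved(2)] zs(1,2) by (simp add: distinct_card)
  qed
  then show ?thesis ..
qed

text \<open>
  Since the number of classes among the conjugates is bounded, moving a maximal inequivalent family
  of them into \<open>M\<close> yields a representative of the class of \<open>c\<close> that is independent from \<open>P\<close> over \<open>B\<close>.
\<close>

lemma free_representative:
  assumes B: "very_small B" and c: "c \<in> tuples M n"
    and bound: "at_most_classes EC (conjugates L C B c) m"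
  shows "\<exists>u\<in>conjugates L C B c. u \<in> tuples M n \<and> ind (set u) B P \<and> (c, u) \<in> EC"
proof -
  let ?Q = "\<lambda>Z. Z \<subseteq> conjugates L C B c \<and> finite Z \<and> pairwise (\<lambda>x y. (x, y) \<notin> EC) Z"
  have "\<exists>Z. ?Q Z \<and> (\<forall>Z'. ?Q Z' \<longrightarrow> card Z' \<le> card Z)"
  proof (rule ex_has_greatest_nat[where P="?Q" and f=card and k="{}" and b="Suc m"])
    show "?Q {}" by simp
    show "\<forall>Z. ?Q Z \<longrightarrow> card Z < Suc m" using bound by (simp add: at_most_classes_def less_Suc_eq_le)
  qed
  then obtain Z where Z: "Z \<subseteq> conjugates L C B c" "finite Z" "pairwise (\<lambda>x y. (x, y) \<notin> EC) Z"
    and max: "\<And>Z'. ?Q Z' \<Longrightarrow> card Z' \<le> card Z" by blast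
  define X where "X = \<Union>(set ` Z)"
  have X: "finite X" "X \<subseteq> Univ C" using Z conjugates_Univ[of _ L C B c] by (auto simp: X_def)
  obtain f where f: "f ` X \<subseteq> M" "ind (f ` X) B P" "elem_rel L C (Id_on B \<union> (\<lambda>x. (x, f x)) ` X)"
    by (rule extension_set[OF B X])
  have len: "length c = n" using c by (simp add: tuples_def)
  note moved = move_conjugates[OF len Z(1,3) f(3)[unfolded X_def]]
  have "\<exists>w\<in>map f ` Z. (c, w) \<in> EC"
  proof (rule ccontr)
    assume n: "\<not> ?thesis"
    then have n': "(w, c) \<notin> EC" if "w \<in> map f ` Z" for w using that symD[OF EC_sym] by blast
    have "c \<in> tuples (Univ C) n" using c M_Univ by (auto simp: tuples_def)
    then have "c \<notin> map f ` Z" using n EC_refl by blast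
    then have "card (insert c (map f ` Z)) = Suc (card Z)" using Z(2) card_image[OF moved(2)] by simp
    moreover have Q: "?Q (insert c (map f ` Z))"
      using conjugates_self[OF B c] moved(1,3) Z(2) n n' by (auto simp: pairwise_insert)
    ultimately show False using max[OF Q] by linarith
  qed
  then obtain x where x: "x \<in> Z" "(c, map f x) \<in> EC" by blast
  have xX: "set x \<subseteq> X" "length x = n" using x(1) Z(1) len by (auto simp: X_def conjugates_def)
  have "ind (set (map f x)) B P"
    by (rule ind_mono_left[OF f(2)]) (use xX f(1) very_small_small[OF B] in auto)
  moreover have "map f x \<in> tuples M n" using xX f(1) by (auto simp: tuples_def)
  ultimately show ?thesis using moved(1) x by blast
qed

text \<open>The exact bound: \<open>c\<close> may now be assumed to be independent from \<open>P\<close> over \<open>B\<close>.\<close>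

lemma at_most_classes_conjugates:
  assumes B: "very_small B" "Pind B" and F: "invariant B F" "finite F"
    and c: "c \<in> tuples M n" "E `` {c} \<in> F"
  shows "at_most_classes EC (conjugates L C B c) (card F)"
proof -
  obtain m where "at_most_classes EC (conjugates L C B c) m"
    using at_most_classes_exists[OF assms] by blast
  then obtain u where u: "u \<in> conjugates L C B c" "u \<in> tuples M n" "ind (set u) B P" "(c, u) \<in> EC"
    using free_representative[OF B(1) c(1)] by blast
  have "E `` {u} = E `` {c}" using u(4) EC_M[OF c(1) u(2)] equiv_class_eq[OF equiv_E] by blast
  then have "at_most_classes EC (conjugates L C B u) (card F)"
    using at_most_classes_free[OF order_refl B F u(2) _ u(3)] c(2) by simp
  moreover have "conjugates L C B c \<subseteq> conjugates L C B u"
  proof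
    fix z assume z: "z \<in> conjugates L C B c"
    have len: "length z = length c" "length u = length c" using z u(1) by (auto simp: conjugates_def)
    have "elem_rel L C ((Id_on B \<union> set (zip c u))\<inverse> O (Id_on B \<union> set (zip c z)))"
      using u(1) z by (intro elem_rel_relcomp elem_rel_converse) (auto simp: conjugates_def)
    moreover have "set (zip u z) \<subseteq> (set (zip c u))\<inverse> O set (zip c z)"
    proof
      fix p assume "p \<in> set (zip u z)"
      then obtain i where i: "i < length c" "p = (u ! i, z ! i)" using len by (auto simp: set_zip)
      have "(c ! i, u ! i) \<in> set (zip c u)" "(c ! i, z ! i) \<in> set (zip c z)"
        using i(1) len by (auto simp: set_zip)
      then show "p \<in> (set (zip c u))\<inverse> O set (zip c z)" unfolding i(2) by blast
    qed
    ultimately have "elem_rel L C (Id_on B \<union> set (zip u z))"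
      by (elim elem_rel_subset) blast
    then show "z \<in> conjugates L C B u" using len by (simp add: conjugates_def)
  qed
  ultimately show ?thesis by (rule at_most_classes_antimono)
qed

end


section \<open>Defining sets of classes in the imaginaries\<close>

lemma sat_foldr_Ex:
  "sat M v (foldr Ex ys \<phi>) \<longleftrightarrow>
    (\<exists>w. (\<forall>x. x \<notin> set ys \<longrightarrow> w x = v x) \<and> (\<forall>y\<in>set ys. w y \<in> Dom M (fst y)) \<and> sat M w \<phi>)"
proof (induction ys arbitrary: v)
  case Nil
  have "(\<exists>w. (\<forall>x. w x = v x) \<and> sat M w \<phi>) \<longleftrightarrow> sat M v \<phi>"
    by (metis ext)
  then show ?case by simp
next
  case (Cons y ys)
  show ?case
  proof
    assume "sat M v (foldr Ex (y # ys) \<phi>)"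
    then obtain b w where "b \<in> Dom M (fst y)" "\<forall>x. x \<notin> set ys \<longrightarrow> w x = (v(y := b)) x"
      "\<forall>y\<in>set ys. w y \<in> Dom M (fst y)" "sat M w \<phi>"
      using Cons.IH by auto
    moreover from this have "w y \<in> Dom M (fst y)" by (metis fun_upd_same)
    ultimately show "\<exists>w. (\<forall>x. x \<notin> set (y # ys) \<longrightarrow> w x = v x) \<and>
      (\<forall>y\<in>set (y # ys). w y \<in> Dom M (fst y)) \<and> sat M w \<phi>"
      by (intro exI[of _ w]) auto
  next
    assume "\<exists>w. (\<forall>x. x \<notin> set (y # ys) \<longrightarrow> w x = v x) \<and>
      (\<forall>y\<in>set (y # ys). w y \<in> Dom M (fst y)) \<and> sat M w \<phi>"
    then obtain w where w: "\<forall>x. x \<notin> set (y # ys) \<longrightarrow> w x = v x"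
      "\<forall>y\<in>set (y # ys). w y \<in> Dom M (fst y)" "sat M w \<phi>" by blast
    then have "\<forall>x. x \<notin> set ys \<longrightarrow> w x = (v(y := w y)) x" by auto
    then have "sat M (v(y := w y)) (foldr Ex ys \<phi>)" using Cons.IH w(2,3) by auto
    then show "sat M v (foldr Ex (y # ys) \<phi>)" using w(2) by auto
  qed
qed

lemma fv_foldr_Ex: "fv (foldr Ex ys \<phi>) = fv \<phi> - set ys"
  by (induction ys) auto

lemma wf_foldr_Ex: "wf_fm K (foldr Ex ys \<phi>) \<longleftrightarrow> (\<forall>y\<in>set ys. fst y \<in> Sorts K) \<and> wf_fm K \<phi>"
  by (induction ys) auto

text \<open>Formulas of \<open>L\<close> become formulas about \<open>M\<^sup>e\<^sup>q\<close> by reading them in the home sort.\<close>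

abbreviation home_tm :: "'a set \<Rightarrow> (unit, 'f) tm \<Rightarrow> ('a eq_sort, 'f + 'a eq_sort) tm" where
  "home_tm M \<equiv> map_tm (\<lambda>_. home_sort M) Inl"

abbreviation home_fm :: "'a set \<Rightarrow> (unit, 'f, 'r) fm \<Rightarrow> ('a eq_sort, 'f + 'a eq_sort, 'r) fm" where
  "home_fm M \<equiv> map_fm (\<lambda>_. home_sort M) Inl id"

lemma tm_vars_home_tm: "tm_vars (home_tm M t) = (\<lambda>x. (home_sort M, snd x)) ` tm_vars t"
  by (induction t) (auto simp: map_prod_def split_def)

lemma fv_home_fm: "fv (home_fm M \<phi>) = (\<lambda>x. (home_sort M, snd x)) ` fv \<phi>"
proof (induction \<phi>)
  case (Ex x \<phi>)
  have "inj (\<lambda>x :: unit var. (home_sort M, snd x))" by (auto intro!: injI)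
  then show ?case using Ex by (simp add: image_set_diff map_prod_def split_def)
qed (auto simp: tm_vars_home_tm)

lemma sort_of_home_tm: "sort_of (lang_eq L N) (home_tm (Univ N) t) = home_sort (Univ N)"
  by (cases t) (auto simp: lang_eq_def Let_def map_prod_def split_def)

lemma wf_home_tm:
  assumes "one_sorted L"
  shows "wf_tm L t \<Longrightarrow> wf_tm (lang_eq L N) (home_tm (Univ N) t)"
proof (induction t)
  case (Var x)
  then show ?case using home_sort_eq_sorts[OF assms, of N]
    by (simp add: map_prod_def split_def lang_eq_def Let_def)
next
  case (Fn f ts)
  have "map (sort_of (lang_eq L N)) (map (home_tm (Univ N)) ts) = map (\<lambda>_. home_sort (Univ N)) ts"
    by (simp add: sort_of_home_tm)
  also have "\<dots> = map (\<lambda>_. home_sort (Univ N)) (map (sort_of L) ts)" by simp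
  also have "map (sort_of L) ts = fdom L f" using Fn.prems by simp
  finally have "map (sort_of (lang_eq L N)) (map (home_tm (Univ N)) ts) =
    fdom (lang_eq L N) (Inl f)" by (simp add: lang_eq_def Let_def)
  moreover have "Inl f \<in> Funs (lang_eq L N)" using Fn.prems by (simp add: lang_eq_def Let_def)
  ultimately show ?case using Fn by (simp add: list_all_iff)
qed

lemma wf_home_fm:
  assumes "one_sorted L"
  shows "wf_fm L \<phi> \<Longrightarrow> wf_fm (lang_eq L N) (home_fm (Univ N) \<phi>)"
proof (induction \<phi>)
  case (Eq t u)
  then show ?case by (simp add: wf_home_tm[OF assms] sort_of_home_tm)
next
  case (Rel r ts)
  have "map (sort_of (lang_eq L N)) (map (home_tm (Univ N)) ts) = map (\<lambda>_. home_sort (Univ N)) ts"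
    by (simp add: sort_of_home_tm)
  also have "\<dots> = map (\<lambda>_. home_sort (Univ N)) (map (sort_of L) ts)" by simp
  also have "map (sort_of L) ts = rdom L r" using Rel.prems by simp
  finally have "map (sort_of (lang_eq L N)) (map (home_tm (Univ N)) ts) = rdom (lang_eq L N) r"
    by (simp add: lang_eq_def Let_def)
  moreover have "r \<in> Rels (lang_eq L N)" using Rel.prems by (simp add: lang_eq_def Let_def)
  moreover have "list_all (wf_tm (lang_eq L N)) (map (home_tm (Univ N)) ts)"
    using Rel wf_home_tm[OF assms] by (auto simp: list_all_iff)
  ultimately show ?case by simp
next
  case (Ex x \<phi>)
  then show ?case using home_sort_eq_sorts[OF assms, of N]
    by (simp add: map_prod_def split_def lang_eq_def Let_def)
qed simp_all

lemma eval_home_tm: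
  assumes "\<forall>x\<in>tm_vars t. w (home_sort (Univ N), snd x) = home (Univ N) (v x)"
  shows "eval (struc_eq N) w (home_tm (Univ N) t) = home (Univ N) (eval N v t)"
  using assms
proof (induction t)
  case (Var x)
  then show ?case by (simp add: map_prod_def split_def)
next
  case (Fn f ts)
  have "map (\<lambda>t. unhome (eval (struc_eq N) w (home_tm (Univ N) t))) ts = map (eval N v) ts"
    by (intro map_cong refl) (use Fn in simp)
  then show ?case by (simp add: struc_eq_def comp_def del: map_eq_conv)
qed

lemma home_inject: "home M a = home M b \<longleftrightarrow> a = b"
  by (simp add: home_def)

lemma sat_home_fm:
  assumes "\<forall>x\<in>fv \<phi>. w (home_sort (Univ N), snd x) = home (Univ N) (v x)"
  shows "sat (struc_eq N) w (home_fm (Univ N) \<phi>) \<longleftrightarrow> sat N v \<phi>"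
  using assms
proof (induction \<phi> arbitrary: v w)
  case (Eq t u)
  then show ?case using eval_home_tm[of t w N v] eval_home_tm[of u w N v]
    by (simp add: home_inject)
next
  case (Rel r ts)
  have "map (\<lambda>t. unhome (eval (struc_eq N) w (home_tm (Univ N) t))) ts = map (eval N v) ts"
  proof (intro map_cong refl)
    fix t assume "t \<in> set ts"
    then have "eval (struc_eq N) w (home_tm (Univ N) t) = home (Univ N) (eval N v t)"
      by (intro eval_home_tm) (use Rel in auto)
    then show "unhome (eval (struc_eq N) w (home_tm (Univ N) t)) = eval N v t" by simp
  qed
  moreover have "Rint (struc_eq N) r es \<longleftrightarrow> Rint N r (map unhome es)" for es
    by (simp add: struc_eq_def)
  ultimately show ?case by (simp add: comp_def del: map_eq_conv)
next
  case (Neg \<phi>)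
  then show ?case by simp
next
  case (Conj \<phi> \<psi>)
  have "sat (struc_eq N) w (home_fm (Univ N) \<phi>) \<longleftrightarrow> sat N v \<phi>"
    by (rule Conj.IH(1)) (use Conj.prems in simp)
  moreover have "sat (struc_eq N) w (home_fm (Univ N) \<psi>) \<longleftrightarrow> sat N v \<psi>"
    by (rule Conj.IH(2)) (use Conj.prems in simp)
  ultimately show ?case by (simp add: id_def)
next
  case (Ex x \<phi>)
  let ?h = "home_sort (Univ N)"
  have "sat (struc_eq N) (w((?h, snd x) := home (Univ N) b)) (home_fm (Univ N) \<phi>) \<longleftrightarrow> sat N (v(x := b)) \<phi>" for b
    by (rule Ex.IH) (use Ex.prems in \<open>auto simp: prod_eq_iff\<close>)
  then show ?case by (simp add: map_prod_def split_def Dom_home id_def)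
qed

context lovely_sort begin

text \<open>
  The classes of the solutions in \<open>M\<close> of an \<open>L\<close>-definable predicate are the solutions of a formula
  in \<open>M\<^sup>e\<^sup>q\<close>: the projection of some tuple of home elements satisfying the predicate.
\<close>

lemma class_formula:
  assumes sort: "(n, E) \<in> eq_sorts L (restr C M)" and D: "definable L C B n D" and B: "B \<subseteq> M"
  shows "\<exists>\<psi>v\<in>param_fms (lang_eq L (restr C M)) (struc_eq (restr C M)) (n, E) (home M ` B).
    \<forall>e. solves (struc_eq (restr C M)) (n, E) e \<psi>v \<longleftrightarrow>
      (\<exists>z\<in>tuples M n. D ((!) z) \<and> e = ((n, E), E `` {z}))"
proof -
  let ?N = "restr C M" and ?h = "home_sort M"
  obtain \<phi> v where \<phi>: "wf_fm L \<phi>" "\<forall>x\<in>fv \<phi>. n \<le> snd x \<longrightarrow> v x \<in> B"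
    "\<forall>g. (\<forall>i<n. g i \<in> Univ C) \<longrightarrow> (D g \<longleftrightarrow> sat C (val n g v) \<phi>)"
    by (rule definableE[OF D])
  \<comment> \<open>The indices are shifted because the variable of index 0 is reserved.\<close>
  define \<rho> where "\<rho> x = ((), Suc (snd x))" for x :: "unit var"
  obtain \<phi>' where \<phi>': "wf_fm L \<phi>'" "fv \<phi>' \<subseteq> \<rho> ` fv \<phi>"
    "\<And>(M :: (unit, 'f, 'r, 'a) struc) v. sat M v \<phi>' \<longleftrightarrow> sat M (v \<circ> \<rho>) \<phi>"
    using ex_substitution[OF \<phi>(1), where \<rho>=\<rho>] by auto
  define ys where "ys = map (\<lambda>j. (?h, Suc j)) [0..<n]"
  define \<theta> where "\<theta> = home_fm M \<phi>'"
  define \<pi> :: "('a eq_sort, 'f + 'a eq_sort, 'r) fm" where "\<pi> = Eq (Var ((n, E), 0)) (Fn (Inr (n, E)) (map Var ys))"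
  define \<psi> where "\<psi> = foldr Ex ys (Conj \<theta> \<pi>)"
  define v1 where "v1 x = home M (v ((), snd x - 1))" for x :: "'a eq_sort var"
  have home: "?h \<in> eq_sorts L ?N" using home_sort_eq_sorts[OF one_sorted, of ?N] by simp
  have Dom_h: "Dom (struc_eq ?N) ?h = home M ` M" using Dom_home[of ?N] by simp
  have fv_\<theta>: "\<exists>i. x = (?h, Suc i) \<and> ((), i) \<in> fv \<phi>" if x: "x \<in> fv \<theta>" for x
  proof -
    obtain x' where "x' \<in> fv \<phi>'" "x = (?h, snd x')"
      using x fv_home_fm[of M \<phi>'] by (auto simp: \<theta>_def)
    then obtain y where "y \<in> fv \<phi>" "x' = \<rho> y" using \<phi>'(2) by blast
    then show ?thesis using \<open>x = (?h, snd x')\<close> by (cases y) (auto simp: \<rho>_def)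
  qed
  have "wf_fm (lang_eq L ?N) \<psi>"
  proof -
    have "wf_fm (lang_eq L ?N) \<theta>"
      using wf_home_fm[OF one_sorted \<phi>'(1), of ?N] by (simp add: \<theta>_def)
    moreover have "wf_fm (lang_eq L ?N) \<pi>" "\<forall>y\<in>set ys. fst y \<in> Sorts (lang_eq L ?N)"
      using home sort
      by (auto simp: \<pi>_def ys_def lang_eq_def Let_def list_all_iff comp_def map_replicate_const)
    ultimately show ?thesis by (simp add: \<psi>_def wf_foldr_Ex)
  qed
  moreover have "v1 x \<in> home M ` B \<inter> Dom (struc_eq ?N) (fst x)"
    if x: "x \<in> fv \<psi> - {((n, E), 0)}" for x
  proof -
    have "x \<in> fv \<theta>" "x \<notin> set ys" using x by (auto simp: \<psi>_def fv_foldr_Ex \<pi>_def)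
    then obtain i where i: "x = (?h, Suc i)" "((), i) \<in> fv \<phi>" using fv_\<theta> by blast
    have "\<not> i < n" using \<open>x \<notin> set ys\<close> i(1) by (auto simp: ys_def)
    then have "v ((), i) \<in> B" using \<phi>(2) i(2) by force
    then show ?thesis using i(1) B Dom_h by (auto simp: v1_def)
  qed
  ultimately have "(\<psi>, v1) \<in> param_fms (lang_eq L ?N) (struc_eq ?N) (n, E) (home M ` B)"
    unfolding param_fms_def by blast
  moreover have "solves (struc_eq ?N) (n, E) e (\<psi>, v1) \<longleftrightarrow>
      (\<exists>z\<in>tuples M n. D ((!) z) \<and> e = ((n, E), E `` {z}))" for e
  proof -
    let ?v = "v1(((n, E), 0) := e)"
    have \<theta>: "sat (struc_eq ?N) w \<theta> \<longleftrightarrow> D ((!) z)"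
      if z: "z \<in> tuples M n" and w: "\<forall>j<n. w (?h, Suc j) = home M (z ! j)"
        "\<forall>x. x \<notin> set ys \<longrightarrow> w x = ?v x" for w z
    proof -
      define u where "u x = val n ((!) z) v ((), snd x - 1)" for x :: "unit var"
      have uM: "u x \<in> M \<and> w (?h, snd x) = home M (u x)" if x: "x \<in> fv \<phi>'" for x
      proof -
        obtain i where i: "x = ((), Suc i)" "((), i) \<in> fv \<phi>"
          using x \<phi>'(2) by (force simp: \<rho>_def)
        show ?thesis
        proof (cases "i < n")
          case True
          then show ?thesis using i z w(1) by (auto simp: u_def val_def tuples_def)
        next
          case False
          then have "(?h, Suc i) \<notin> set ys" by (auto simp: ys_def)
          then have "w (?h, Suc i) = ?v (?h, Suc i)" using w(2) by blast
          then have "w (?h, Suc i) = home M (v ((), i))" by (simp add: v1_def)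
          moreover have "v ((), i) \<in> M" using \<phi>(2) i(2) False B by force
          ultimately show ?thesis using i False by (simp add: u_def val_def)
        qed
      qed
      have "sat (struc_eq ?N) w \<theta> \<longleftrightarrow> sat ?N u \<phi>'"
        using sat_home_fm[of \<phi>' w ?N u] uM by (simp add: \<theta>_def)
      also have "\<dots> \<longleftrightarrow> sat C u \<phi>'"
        using M_C \<phi>'(1) uM unfolding elementary_substructure_def by blast
      also have "\<dots> \<longleftrightarrow> sat C (val n ((!) z) v) \<phi>"
        unfolding \<phi>'(3) by (rule sat_cong) (auto simp: u_def \<rho>_def val_def)
      also have "\<dots> \<longleftrightarrow> D ((!) z)"
      proof -
        have "\<forall>i<n. z ! i \<in> Univ C" using z M_Univ nth_mem[of _ z] unfolding tuples_def by blast
        then show ?thesis using \<phi>(3) by blast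
      qed
      finally show ?thesis .
    qed
    have \<pi>: "sat (struc_eq ?N) w \<pi> \<longleftrightarrow> e = ((n, E), E `` {z})"
      if z: "z \<in> tuples M n" and w: "\<forall>j<n. w (?h, Suc j) = home M (z ! j)"
        "\<forall>x. x \<notin> set ys \<longrightarrow> w x = ?v x" for w z
    proof -
      have "map (\<lambda>j. unhome (w (?h, Suc j))) [0..<n] = z"
        using z w(1) by (auto simp: tuples_def intro: nth_equalityI)
      moreover have "((n, E), 0) \<notin> set ys" by (auto simp: ys_def)
      then have "w ((n, E), 0) = ?v ((n, E), 0)" using w(2) by blast
      ultimately show ?thesis by (simp add: \<pi>_def ys_def struc_eq_def comp_def)
    qed
    show ?thesis
    proof
      assume "solves (struc_eq ?N) (n, E) e (\<psi>, v1)"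
      then have "sat (struc_eq ?N) ?v \<psi>" by (simp add: solves_def)
      then obtain w where w: "\<forall>x. x \<notin> set ys \<longrightarrow> w x = ?v x"
        "\<forall>y\<in>set ys. w y \<in> Dom (struc_eq ?N) (fst y)"
        "sat (struc_eq ?N) w \<theta>" "sat (struc_eq ?N) w \<pi>"
        unfolding \<psi>_def sat_foldr_Ex by auto
      define z where "z = map (\<lambda>j. unhome (w (?h, Suc j))) [0..<n]"
      have wj: "w (?h, Suc j) \<in> home M ` M" if "j < n" for j
        using w(2) that Dom_h by (auto simp: ys_def)
      then have z: "z \<in> tuples M n" by (force simp: z_def tuples_def)
      have wz: "\<forall>j<n. w (?h, Suc j) = home M (z ! j)" using wj by (force simp: z_def)
      show "\<exists>z\<in>tuples M n. D ((!) z) \<and> e = ((n, E), E `` {z})"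
        using z w(3,4) \<theta>[OF z wz w(1)] \<pi>[OF z wz w(1)] by blast
    next
      assume "\<exists>z\<in>tuples M n. D ((!) z) \<and> e = ((n, E), E `` {z})"
      then obtain z where z: "z \<in> tuples M n" "D ((!) z)" "e = ((n, E), E `` {z})" by blast
      define w where "w x = (if x \<in> set ys then home M (z ! (snd x - 1)) else ?v x)" for x
      have w1: "\<forall>x. x \<notin> set ys \<longrightarrow> w x = ?v x" by (simp add: w_def)
      have w2: "\<forall>j<n. w (?h, Suc j) = home M (z ! j)" by (auto simp: w_def ys_def)
      have w3: "\<forall>y\<in>set ys. w y \<in> Dom (struc_eq ?N) (fst y)"
        using z(1) Dom_h by (auto simp: w_def ys_def tuples_def intro!: imageI)
      have "sat (struc_eq ?N) w (Conj \<theta> \<pi>)"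
        using \<theta>[OF z(1) w2 w1] \<pi>[OF z(1) w2 w1] z(2,3) by simp
      then have "sat (struc_eq ?N) ?v \<psi>" unfolding \<psi>_def sat_foldr_Ex using w1 w3 by blast
      moreover have "e \<in> Dom (struc_eq ?N) (n, E)" using z(1,3) by (simp add: Dom_eq)
      ultimately show "solves (struc_eq ?N) (n, E) e (\<psi>, v1)" by (simp add: solves_def)
    qed
  qed
  ultimately show ?thesis by blast
qed

text \<open>A class in a finite invariant set \<open>F\<close> lies in an \<open>L\<close>-definable set of at most \<open>card F\<close> classes.\<close>

lemma class_formula_invariant:
  assumes sort: "(n, E) \<in> eq_sorts L (restr C M)"
    and B: "very_small B" "Pind B" and F: "invariant B F" "finite F" and e: "e \<in> F"
  shows "\<exists>\<psi>v\<in>param_fms (lang_eq L (restr C M)) (struc_eq (restr C M)) (n, E) (home M ` B).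
    solves (struc_eq (restr C M)) (n, E) ((n, E), e) \<psi>v \<and>
    finite {b. solves (struc_eq (restr C M)) (n, E) b \<psi>v} \<and>
    card {b. solves (struc_eq (restr C M)) (n, E) b \<psi>v} \<le> card F"
proof -
  obtain c where c: "c \<in> tuples M n" "e = E `` {c}"
    using F(1) e by (auto simp: invariant_def quotient_def)
  have bound: "at_most_classes EC (conjugates L C B c) (card F)"
    by (rule at_most_classes_conjugates[OF B F c(1)]) (use e c in simp)
  have smB: "B \<subseteq> Univ C" "|B| <o \<mu>" using very_small_small[OF B(1)] by (auto simp: small_def)
  have c': "length c = n" "set c \<subseteq> Univ C" using c(1) M_Univ by (auto simp: tuples_def)
  obtain D where D: "definable L C B n D" "D ((!) c)"
    "at_most_classes EC {z \<in> tuples (Univ C) n. D ((!) z)} (card F)"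
    using at_most_classes_definable[OF one_sorted sat_C \<mu> smB c' EC_definable EC_refl bound] by blast
  obtain \<psi>v where \<psi>v: "\<psi>v \<in> param_fms (lang_eq L (restr C M)) (struc_eq (restr C M)) (n, E) (home M ` B)"
    and sol: "\<And>e. solves (struc_eq (restr C M)) (n, E) e \<psi>v \<longleftrightarrow>
      (\<exists>z\<in>tuples M n. D ((!) z) \<and> e = ((n, E), E `` {z}))"
    using class_formula[OF sort D(1) very_small_M[OF B(1)]] by blast
  let ?S = "{b. solves (struc_eq (restr C M)) (n, E) b \<psi>v}"
  have "finite ?S \<and> card ?S \<le> card F"
  proof (rule finite_if_finite_subsets_card_bdd)
    fix G assume G: "G \<subseteq> ?S" "finite G"
    then have "\<forall>g\<in>G. \<exists>z\<in>tuples M n. D ((!) z) \<and> g = ((n, E), E `` {z})" using sol by auto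
    then obtain r where r: "\<forall>g\<in>G. r g \<in> tuples M n \<and> D ((!) (r g)) \<and> g = ((n, E), E `` {r g})" by metis
    have sep: "(r x, r y) \<notin> EC" if xy: "x \<in> G" "y \<in> G" "x \<noteq> y" for x y
    proof
      assume "(r x, r y) \<in> EC"
      then have "(r x, r y) \<in> E" using EC_M r xy by blast
      then have "E `` {r x} = E `` {r y}" by (rule equiv_class_eq[OF equiv_E])
      then show False using r xy by metis
    qed
    have inj: "inj_on r G"
    proof (rule inj_onI)
      fix x y assume "x \<in> G" "y \<in> G" "r x = r y"
      then show "x = y" using r by metis
    qed
    have "card (r ` G) \<le> card F"
    proof (rule at_most_classesD[OF D(3)])
      show "r ` G \<subseteq> {z \<in> tuples (Univ C) n. D ((!) z)}" using r M_Univ by (auto simp: tuples_def)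
      show "pairwise (\<lambda>x y. (x, y) \<notin> EC) (r ` G)" using sep unfolding pairwise_def by blast
    qed (use G(2) in simp)
    then show "card G \<le> card F" using card_image[OF inj] by simp
  qed
  moreover have "solves (struc_eq (restr C M)) (n, E) ((n, E), e) \<psi>v" using sol c D(2) by blast
  ultimately show ?thesis using \<psi>v by blast
qed

end

text \<open>The parameters of an \<open>L\<^sup>2\<close>-formula over \<open>A\<close> lie in a very small P-independent subset of \<open>A\<close>, over
  which the solution set is invariant.\<close>

lemma (in lovely) finite_solutions_bounded:
  assumes A: "A \<subseteq> M" "Pind A" and sort: "s \<in> eq_sorts L (restr C M)"
    and \<phi>v: "\<phi>v \<in> param_fms (lang_eq L2 N) (struc_eq N) s (home M ` A)"
    and e: "solves (struc_eq N) s e \<phi>v" and fin: "finite {b. solves (struc_eq N) s b \<phi>v}"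
  shows "\<exists>\<psi>v\<in>param_fms (lang_eq L (restr C M)) (struc_eq (restr C M)) s (home M ` A).
    solves (struc_eq (restr C M)) s e \<psi>v \<and> finite {b. solves (struc_eq (restr C M)) s b \<psi>v} \<and>
    card {b. solves (struc_eq (restr C M)) s b \<psi>v} \<le> card {b. solves (struc_eq N) s b \<phi>v}"
proof -
  obtain n E where s: "s = (n, E)" by (cases s)
  obtain \<epsilon> where "equiv (tuples M n) E" "wf_fm L \<epsilon>" "fv \<epsilon> \<subseteq> UNIV \<times> {..<2 * n}"
    "E = {(xs, ys) \<in> tuples M n \<times> tuples M n. sat (restr C M) (\<lambda>(_, i). (xs @ ys) ! i) \<epsilon>}"
    using sort s by (auto simp: eq_sorts_def definable_equiv_def)
  then interpret lovely_sort L C \<mu> \<kappa>\<^sub>0 \<kappa> ind M P n E \<epsilon>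
    by unfold_locales
  have sort2: "(n, E) \<in> eq_sorts L2 N" using eq_sorts_expansion[OF expansion_pair] sort s by blast
  obtain \<phi> v where \<phi>: "\<phi>v = (\<phi>, v)" by (cases \<phi>v)
  have wf: "wf_fm (lang_eq L2 N) \<phi>"
    and params: "\<And>x. x \<in> fv \<phi> \<Longrightarrow> x \<noteq> (s, 0) \<Longrightarrow> v x \<in> home M ` A \<inter> Dom (struc_eq N) (fst x)"
    using \<phi>v by (auto simp: \<phi> param_fms_def)
  define A1 where "A1 = (\<lambda>x. unhome (v x)) ` (fv \<phi> - {(s, 0)})"
  have A1: "finite A1" "A1 \<subseteq> A" using params finite_fv by (force simp: A1_def)+
  obtain B where B: "A1 \<subseteq> B" "B \<subseteq> A" "very_small B" "Pind B" by (rule ex_vs_Pind[OF A A1])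
  let ?S = "{b. solves (struc_eq N) s b \<phi>v}"
  define F where "F = snd ` ?S"
  have S: "b = ((n, E), snd b) \<and> snd b \<in> tuples M n // E" if "b \<in> ?S" for b
    using that by (auto simp: solves_def s struc_eq_def)
  have FS: "X \<in> F \<longleftrightarrow> solves (struc_eq N) s ((n, E), X) \<phi>v" for X
  proof
    assume "X \<in> F"
    then obtain b where "b \<in> ?S" "X = snd b" by (auto simp: F_def)
    then show "solves (struc_eq N) s ((n, E), X) \<phi>v" using S[of b] by simp
  next
    assume "solves (struc_eq N) s ((n, E), X) \<phi>v"
    then show "X \<in> F" unfolding F_def by (intro image_eqI[of _ _ "((n, E), X)"]) simp_all
  qed
  have "invariant B F"
    unfolding invariant_def
  proof (intro conjI ballI allI impI)
    show "F \<subseteq> tuples M n // E" using S by (auto simp: F_def)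
    fix R xs ys assume R: "R \<in> BF" "Id_on B \<subseteq> R" "length xs = n" "length ys = n" "set (zip xs ys) \<subseteq> R"
      and xs: "E `` {xs} \<in> F"
    let ?e = "((n, E), E `` {xs})" and ?e' = "((n, E), E `` {ys})"
    have e: "req R ?e ?e'" unfolding req_def using sort2 R by blast
    have "sat (struc_eq N) (v((s, 0) := ?e)) \<phi> \<longleftrightarrow> sat (struc_eq N) (v((s, 0) := ?e')) \<phi>"
    proof (rule BF_sat_eq[OF wf R(1)])
      fix x assume x: "x \<in> fv \<phi>"
      show "req R ((v((s, 0) := ?e)) x) ((v((s, 0) := ?e')) x) \<and> fst ((v((s, 0) := ?e)) x) = fst x"
      proof (cases "x = (s, 0)")
        case True
        then show ?thesis using e s by simp
      next
        case False
        obtain a where a: "a \<in> A" "v x = home M a" using params[OF x False] by blast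
        have "unhome (v x) \<in> A1" using x False unfolding A1_def by blast
        then have "a \<in> B" using a(2) B(1) by auto
        then have "req R (home M a) (home M a)" using req_home[OF R(1)] R(2) by blast
        moreover have "fst (v x) = fst x" using params[OF x False] by (cases "fst x") (auto simp: struc_eq_def)
        ultimately show ?thesis using False a(2) by simp
      qed
    qed
    moreover have "?e' \<in> Dom (struc_eq N) s"
      using zip_in_M(2)[OF R(1,5,3,4)] by (simp add: s Dom_eq)
    ultimately show "E `` {ys} \<in> F" using xs by (simp add: FS solves_def \<phi>)
  qed
  moreover have "finite F" using fin by (simp add: F_def)
  moreover have "snd e \<in> F" using e by (auto simp: F_def)
  ultimately obtain \<psi>v where
    \<psi>v: "\<psi>v \<in> param_fms (lang_eq L (restr C M)) (struc_eq (restr C M)) s (home M ` B)"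
    "solves (struc_eq (restr C M)) s ((n, E), snd e) \<psi>v"
    "finite {b. solves (struc_eq (restr C M)) s b \<psi>v}"
    "card {b. solves (struc_eq (restr C M)) s b \<psi>v} \<le> card F"
    using class_formula_invariant[OF sort[unfolded s] B(3,4)] s by blast
  have "\<psi>v \<in> param_fms (lang_eq L (restr C M)) (struc_eq (restr C M)) s (home M ` A)"
    using \<psi>v(1) B(2) by (auto simp: param_fms_def)
  moreover have "card F \<le> card ?S" unfolding F_def by (rule card_image_le[OF fin])
  moreover have "((n, E), snd e) = e" using S[of e] e by simp
  ultimately show ?thesis using \<psi>v(2-4) by (intro bexI[of _ \<psi>v]) auto
qed

lemma univ_eq_sort:
  assumes "e \<in> univ_eq L (restr C M)" "solves (struc_eq (pair C M P)) s e \<phi>v"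
  shows "s \<in> eq_sorts L (restr C M)"
proof -
  obtain n E where "(n, E) \<in> eq_sorts L (restr C M)" "e \<in> Dom (struc_eq (restr C M)) (n, E)"
    using assms(1) by (auto simp: univ_eq_def)
  moreover from this have "s = (n, E)" using assms(2)
    by (cases s) (auto simp: solves_def struc_eq_def)
  ultimately show ?thesis by simp
qed

theorem proposition4p5:
  fixes L :: "(unit, 'f, 'r) lang"
    and T :: "(unit, 'f, 'r) fm set"
    and C :: "(unit, 'f, 'r, 'a) struc"
    and \<mu> \<kappa>\<^sub>0 \<kappa> :: "'k rel"
    and ind :: "'a set \<Rightarrow> 'a set \<Rightarrow> 'a set \<Rightarrow> bool"
    and M P A :: "'a set"
  assumes "one_sorted L"
    and "complete_theory L T"
    and "monster_model L T C \<mu>"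
    and "independence_relation L C \<mu> ind"
    and "is_kappa0 C \<mu> ind \<kappa>\<^sub>0"
    and "Card_order \<kappa>" and "\<kappa> <o \<mu>" and "\<kappa>\<^sub>0 <o \<kappa>" and "|T| <o \<kappa>"
    and "loveliness_first_order L C \<mu> ind \<kappa>"
    and "lovely_pair L C \<mu> ind \<kappa> M P"
    and "A \<subseteq> M" and "P_independent ind P A"
  shows "acl_eq (lang2 L) (pair C M P) A \<inter> univ_eq L (restr C M)
           = acl_eq L (restr C M) A \<inter> univ_eq L (restr C M) \<and>
         dcl_eq (lang2 L) (pair C M P) A \<inter> univ_eq L (restr C M)
           = dcl_eq L (restr C M) A \<inter> univ_eq L (restr C M)"
proof -
  interpret lovely L C \<mu> \<kappa>\<^sub>0 \<kappa> ind M P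
    by unfold_locales (use assms in \<open>auto simp: monster_model_def is_kappa0_def\<close>)
  let ?K = "lang_eq L (restr C M)" and ?S = "struc_eq (restr C M)"
  have exp: "expansion ?K ?S (lang_eq L2 N) (struc_eq N)"
    by (rule expansion_eq[OF expansion_pair])
  have "acl_eq L (restr C M) A \<subseteq> acl_eq L2 N A" "dcl_eq L (restr C M) A \<subseteq> dcl_eq L2 N A"
    unfolding acl_eq_def dcl_eq_def using acl_expansion[OF exp] dcl_expansion[OF exp] by simp_all
  moreover have "e \<in> acl_eq L (restr C M) A"
    if e: "e \<in> acl_eq L2 N A" "e \<in> univ_eq L (restr C M)" for e
  proof -
    obtain s \<phi>v where \<phi>v: "\<phi>v \<in> param_fms (lang_eq L2 N) (struc_eq N) s (home M ` A)"
      "solves (struc_eq N) s e \<phi>v" "finite {b. solves (struc_eq N) s b \<phi>v}"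
      using e(1) by (auto simp: acl_eq_def acl_def)
    have s: "s \<in> eq_sorts L (restr C M)" by (rule univ_eq_sort[OF e(2) \<phi>v(2)])
    then have "s \<in> Sorts ?K" by (simp add: lang_eq_def Let_def)
    then show ?thesis
      using finite_solutions_bounded[OF assms(12,13) s \<phi>v] unfolding acl_eq_def acl_def by auto
  qed
  moreover have "e \<in> dcl_eq L (restr C M) A"
    if e: "e \<in> dcl_eq L2 N A" "e \<in> univ_eq L (restr C M)" for e
  proof -
    obtain s \<phi>v where \<phi>v: "\<phi>v \<in> param_fms (lang_eq L2 N) (struc_eq N) s (home M ` A)"
      and sol: "{b. solves (struc_eq N) s b \<phi>v} = {e}"
      using e(1) by (auto simp: dcl_eq_def dcl_def)
    have \<phi>v': "solves (struc_eq N) s e \<phi>v" "finite {b. solves (struc_eq N) s b \<phi>v}" using sol by auto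
    have s: "s \<in> eq_sorts L (restr C M)" by (rule univ_eq_sort[OF e(2) \<phi>v'(1)])
    then have "s \<in> Sorts ?K" by (simp add: lang_eq_def Let_def)
    obtain \<psi>v where \<psi>v: "\<psi>v \<in> param_fms ?K ?S s (home M ` A)" "solves ?S s e \<psi>v"
      "finite {b. solves ?S s b \<psi>v}" "card {b. solves ?S s b \<psi>v} \<le> 1"
      using finite_solutions_bounded[OF assms(12,13) s \<phi>v \<phi>v'] sol by auto
    have "b = e" if "solves ?S s b \<psi>v" for b
      using \<psi>v(2,4) that card_le_Suc0_iff_eq[OF \<psi>v(3)] by fastforce
    then have "{b. solves ?S s b \<psi>v} = {e}" using \<psi>v(2) by blast
    then show ?thesis using \<psi>v(1) \<open>s \<in> Sorts ?K\<close> unfolding dcl_eq_def dcl_def by auto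
  qed
  ultimately show ?thesis by blast
qed

end
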